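(* Let $k$ be a field and let $\mathcal{C}$ and $\mathcal{D}$ be Morita equivalent $k$-categories. Then, up to equivalence of categories, $\mathcal{D}$ is obtained from $\mathcal{C}$ by contractions and expansions. That is, there is a finite sequence of $k$-categories $\mathcal{C}=\mathcal{C}^{(0)},\mathcal{C}^{(1)},\dots,\mathcal{C}^{(m)}=\mathcal{D}$ such that, for each $i$, the category $\mathcal{C}^{(i+1)}$ is equivalent to $\mathcal{C}^{(i)}$, or is a contraction of $\mathcal{C}^{(i)}$, or is an expansion of $\mathcal{C}^{(i)}$.
   Context: A $k$-category is a category whose objects form a set $\mathcal{C}_0$, whose morphism sets ${}_y\mathcal{C}_x$ (from $x$ to $y$) are $k$-vector spaces, and whose composition is $k$-bilinear. Functors and equivalences between $k$-linear categories are understood to be $k$-linear. A left $\mathcal{C}$-module is a $k$-linear covariant functor from $\mathcal{C}$ to $k$-vector spaces, with natural transformations as morphisms; two $k$-categories are Morita equivalent if their categories of left modules are equivalent. Contraction: let $E=\{E_i\}_{i\in I}$ be a partition of $\mathcal{C}_0$ into finite sets. The contraction $\mathcal{C}_E$ has set of objects $I$, morphisms ${}_j(\mathcal{C}_E)_i=\bigoplus_{y\in E_j,\,x\in E_i}{}_y\mathcal{C}_x$, and composition given by the matrix product combined with the composition of $\mathcal{C}$. Expansion: for each object $x$ of $\mathcal{C}$ choose a finite complete system $F_x$ of orthogonal idempotents of the algebra ${}_x\mathcal{C}_x$ (pairwise orthogonal idempotents with sum $1_x$, not required to be primitive). The expansion of $\mathcal{C}$ along this choice has as set of objects the disjoint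 union of the sets $F_x$; the morphisms from $e\in F_x$ to $f\in F_y$ are $f\,{}_y\mathcal{C}_x\,e$, and composition is that of $\mathcal{C}$.
   Formalization: Blocks of the partition in a contraction may be empty (giving zero objects): with nonempty blocks the claim fails when C has no objects and D has only zero objects. Being a contraction or expansion is taken up to isomorphism, which is harmless since equivalences are allowed steps. *)

theory Defs
  imports "HOL-Algebra.Module" "HOL-Library.FuncSet" "HOL-Library.Disjoint_Sets"
begin

section \<open>Linear maps and products of vector spaces\<close>

text \<open>Vector spaces over a field \<open>K\<close> are the library's \<open>K\<close>-modules. The fields \<open>mult\<close> and \<open>one\<close>
  which the record type \<open>module\<close> inherits from \<open>ring\<close> play no role.\<close>

definition linear_maps ::
  "('k, 'r) ring_scheme \<Rightarrow> ('k, 'a) module \<Rightarrow> ('k, 'b) module \<Rightarrow> ('a \<Rightarrow> 'b) set" where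
  "linear_maps K V W =
    {h \<in> carrier V \<rightarrow> carrier W.
      (\<forall>v\<in>carrier V. \<forall>w\<in>carrier V. h (v \<oplus>\<^bsub>V\<^esub> w) = h v \<oplus>\<^bsub>W\<^esub> h w) \<and>
      (\<forall>a\<in>carrier K. \<forall>v\<in>carrier V. h (a \<odot>\<^bsub>V\<^esub> v) = a \<odot>\<^bsub>W\<^esub> h v)}"

definition prod_space :: "'i set \<Rightarrow> ('i \<Rightarrow> ('k, 'a) module) \<Rightarrow> ('k, 'i \<Rightarrow> 'a) module" where
  "prod_space A V =
    \<lparr>carrier = (\<Pi>\<^sub>E a\<in>A. carrier (V a)),
     mult = undefined, one = undefined,
     zero = (\<lambda>a\<in>A. \<zero>\<^bsub>V a\<^esub>),
     add = (\<lambda>f g. \<lambda>a\<in>A. f a \<oplus>\<^bsub>V a\<^esub> g a),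
     smult = (\<lambda>c f. \<lambda>a\<in>A. c \<odot>\<^bsub>V a\<^esub> f a)\<rparr>"

section \<open>Linear categories\<close>

text \<open>\<open>Hom C x y\<close> is the space of morphisms from \<open>x\<close> to \<open>y\<close>, and \<open>Comp C x y z g f\<close> is the composite
  of \<open>f\<close> from \<open>x\<close> to \<open>y\<close> followed by \<open>g\<close> from \<open>y\<close> to \<open>z\<close>. All operations are indexed by objects, so
  distinct morphism spaces need not be disjoint.\<close>

record ('o, 'm, 'k) kcat =
  Obj :: "'o set"
  Hom :: "'o \<Rightarrow> 'o \<Rightarrow> ('k, 'm) module"
  Comp :: "'o \<Rightarrow> 'o \<Rightarrow> 'o \<Rightarrow> 'm \<Rightarrow> 'm \<Rightarrow> 'm"
  Ident :: "'o \<Rightarrow> 'm"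

locale k_category = field K for K (structure) +
  fixes C :: "('o, 'm, 'a) kcat"
  assumes hom_space: "\<lbrakk>x \<in> Obj C; y \<in> Obj C\<rbrakk> \<Longrightarrow> module K (Hom C x y)"
    and ident_closed: "x \<in> Obj C \<Longrightarrow> Ident C x \<in> carrier (Hom C x x)"
    and comp_linear_left:
      "\<lbrakk>x \<in> Obj C; y \<in> Obj C; z \<in> Obj C; f \<in> carrier (Hom C x y)\<rbrakk> \<Longrightarrow>
        (\<lambda>g. Comp C x y z g f) \<in> linear_maps K (Hom C y z) (Hom C x z)"
    and comp_linear_right:
      "\<lbrakk>x \<in> Obj C; y \<in> Obj C; z \<in> Obj C; g \<in> carrier (Hom C y z)\<rbrakk> \<Longrightarrow>
        (\<lambda>f. Comp C x y z g f) \<in> linear_maps K (Hom C x y) (Hom C x z)"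
    and comp_assoc:
      "\<lbrakk>w \<in> Obj C; x \<in> Obj C; y \<in> Obj C; z \<in> Obj C;
        f \<in> carrier (Hom C w x); g \<in> carrier (Hom C x y); h \<in> carrier (Hom C y z)\<rbrakk> \<Longrightarrow>
        Comp C w y z h (Comp C w x y g f) = Comp C w x z (Comp C x y z h g) f"
    and comp_ident_left:
      "\<lbrakk>x \<in> Obj C; y \<in> Obj C; f \<in> carrier (Hom C x y)\<rbrakk> \<Longrightarrow> Comp C x y y (Ident C y) f = f"
    and comp_ident_right:
      "\<lbrakk>x \<in> Obj C; y \<in> Obj C; f \<in> carrier (Hom C x y)\<rbrakk> \<Longrightarrow> Comp C x x y f (Ident C x) = f"

definition is_iso :: "('o, 'm, 'k) kcat \<Rightarrow> 'o \<Rightarrow> 'o \<Rightarrow> 'm \<Rightarrow> bool" where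
  "is_iso C x y f \<longleftrightarrow> f \<in> carrier (Hom C x y) \<and>
    (\<exists>g\<in>carrier (Hom C y x). Comp C x y x g f = Ident C x \<and> Comp C y x y f g = Ident C y)"

section \<open>Linear functors, natural transformations and equivalences\<close>

record ('o, 'm, 'p, 'n) kfunctor =
  fobj :: "'o \<Rightarrow> 'p"
  fmor :: "'o \<Rightarrow> 'o \<Rightarrow> 'm \<Rightarrow> 'n"

definition k_functor ::
  "('k, 'r) ring_scheme \<Rightarrow> ('o, 'm, 'k) kcat \<Rightarrow> ('p, 'n, 'k) kcat \<Rightarrow> ('o, 'm, 'p, 'n) kfunctor \<Rightarrow> bool"
  where
  "k_functor K C D F \<longleftrightarrow>
    fobj F \<in> Obj C \<rightarrow> Obj D \<and>
    (\<forall>x\<in>Obj C. \<forall>y\<in>Obj C. fmor F x y \<in> linear_maps K (Hom C x y) (Hom D (fobj F x) (fobj F y))) \<and>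
    (\<forall>x\<in>Obj C. fmor F x x (Ident C x) = Ident D (fobj F x)) \<and>
    (\<forall>x\<in>Obj C. \<forall>y\<in>Obj C. \<forall>z\<in>Obj C. \<forall>f\<in>carrier (Hom C x y). \<forall>g\<in>carrier (Hom C y z).
      fmor F x z (Comp C x y z g f) =
        Comp D (fobj F x) (fobj F y) (fobj F z) (fmor F y z g) (fmor F x y f))"

definition id_functor :: "('o, 'm, 'o, 'm) kfunctor" where
  "id_functor = \<lparr>fobj = (\<lambda>x. x), fmor = (\<lambda>x y f. f)\<rparr>"

definition comp_functor ::
  "('p, 'n, 'q, 'l) kfunctor \<Rightarrow> ('o, 'm, 'p, 'n) kfunctor \<Rightarrow> ('o, 'm, 'q, 'l) kfunctor" where
  "comp_functor G F =
    \<lparr>fobj = (\<lambda>x. fobj G (fobj F x)),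
     fmor = (\<lambda>x y f. fmor G (fobj F x) (fobj F y) (fmor F x y f))\<rparr>"

definition nat_transformations ::
  "('o, 'm, 'k) kcat \<Rightarrow> ('p, 'n, 'k) kcat \<Rightarrow>
   ('o, 'm, 'p, 'n) kfunctor \<Rightarrow> ('o, 'm, 'p, 'n) kfunctor \<Rightarrow> ('o \<Rightarrow> 'n) set" where
  "nat_transformations C D F G =
    {\<eta> \<in> (\<Pi>\<^sub>E x\<in>Obj C. carrier (Hom D (fobj F x) (fobj G x))).
      \<forall>x\<in>Obj C. \<forall>y\<in>Obj C. \<forall>f\<in>carrier (Hom C x y).
        Comp D (fobj F x) (fobj F y) (fobj G y) (\<eta> y) (fmor F x y f) =
        Comp D (fobj F x) (fobj G x) (fobj G y) (fmor G x y f) (\<eta> x)}"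

definition nat_isomorphic ::
  "('o, 'm, 'k) kcat \<Rightarrow> ('p, 'n, 'k) kcat \<Rightarrow>
   ('o, 'm, 'p, 'n) kfunctor \<Rightarrow> ('o, 'm, 'p, 'n) kfunctor \<Rightarrow> bool" where
  "nat_isomorphic C D F G \<longleftrightarrow>
    (\<exists>\<eta>\<in>nat_transformations C D F G. \<forall>x\<in>Obj C. is_iso D (fobj F x) (fobj G x) (\<eta> x))"

definition k_equivalent ::
  "('k, 'r) ring_scheme \<Rightarrow> ('o, 'm, 'k) kcat \<Rightarrow> ('p, 'n, 'k) kcat \<Rightarrow> bool" where
  "k_equivalent K C D \<longleftrightarrow>
    (\<exists>F G. k_functor K C D F \<and> k_functor K D C G \<and>
      nat_isomorphic C C (comp_functor G F) id_functor \<and>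
      nat_isomorphic D D (comp_functor F G) id_functor)"

definition k_isomorphic ::
  "('k, 'r) ring_scheme \<Rightarrow> ('o, 'm, 'k) kcat \<Rightarrow> ('p, 'n, 'k) kcat \<Rightarrow> bool" where
  "k_isomorphic K C D \<longleftrightarrow>
    (\<exists>F. k_functor K C D F \<and> bij_betw (fobj F) (Obj C) (Obj D) \<and>
      (\<forall>x\<in>Obj C. \<forall>y\<in>Obj C.
        bij_betw (fmor F x y) (carrier (Hom C x y)) (carrier (Hom D (fobj F x) (fobj F y)))))"

section \<open>Modules and Morita equivalence\<close>

text \<open>The type \<open>'v\<close> is the universe from which the elements of the vector spaces are taken. Morita
  equivalence does not depend on it, provided that it is infinite and large enough to accommodate the
  objects and morphisms of the two categories.

  Functors are not required to be extensional outside their source category. Functors that agree on the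
  source category are isomorphic objects of \<open>functor_cat\<close>, so this does not affect equivalences.\<close>

definition vect_cat :: "('k, 'r) ring_scheme \<Rightarrow> (('k, 'v) module, 'v \<Rightarrow> 'v, 'k) kcat" where
  "vect_cat K =
    \<lparr>Obj = {V. module K V},
     Hom = (\<lambda>V W. (prod_space (carrier V) (\<lambda>_. W))
                    \<lparr>carrier := linear_maps K V W \<inter> extensional (carrier V)\<rparr>),
     Comp = (\<lambda>U V W g f. compose (carrier U) g f),
     Ident = (\<lambda>V. \<lambda>v\<in>carrier V. v)\<rparr>"

definition functor_cat ::
  "('k, 'r) ring_scheme \<Rightarrow> ('o, 'm, 'k) kcat \<Rightarrow> ('p, 'n, 'k) kcat \<Rightarrow>
   (('o, 'm, 'p, 'n) kfunctor, 'o \<Rightarrow> 'n, 'k) kcat" where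
  "functor_cat K C D =
    \<lparr>Obj = {F. k_functor K C D F},
     Hom = (\<lambda>F G. (prod_space (Obj C) (\<lambda>x. Hom D (fobj F x) (fobj G x)))
                    \<lparr>carrier := nat_transformations C D F G\<rparr>),
     Comp = (\<lambda>F G H \<theta> \<eta>. \<lambda>x\<in>Obj C. Comp D (fobj F x) (fobj G x) (fobj H x) (\<theta> x) (\<eta> x)),
     Ident = (\<lambda>F. \<lambda>x\<in>Obj C. Ident D (fobj F x))\<rparr>"

definition module_cat ::
  "('k, 'r) ring_scheme \<Rightarrow> ('o, 'm, 'k) kcat \<Rightarrow>
   (('o, 'm, ('k, 'v) module, 'v \<Rightarrow> 'v) kfunctor, 'o \<Rightarrow> 'v \<Rightarrow> 'v, 'k) kcat" where
  "module_cat K C = functor_cat K C (vect_cat K)"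

definition morita_equivalent ::
  "'v itself \<Rightarrow> ('k, 'r) ring_scheme \<Rightarrow> ('o, 'm, 'k) kcat \<Rightarrow> ('p, 'n, 'k) kcat \<Rightarrow> bool" where
  "morita_equivalent _ K C D \<longleftrightarrow>
    k_equivalent K
      (module_cat K C :: (('o, 'm, ('k, 'v) module, 'v \<Rightarrow> 'v) kfunctor, 'o \<Rightarrow> 'v \<Rightarrow> 'v, 'k) kcat)
      (module_cat K D :: (('p, 'n, ('k, 'v) module, 'v \<Rightarrow> 'v) kfunctor, 'p \<Rightarrow> 'v \<Rightarrow> 'v, 'k) kcat)"

section \<open>Contractions\<close>

text \<open>As an indexed family, a partition may have empty members; an empty block yields a zero object
  of the contraction. For a category with at least one object such zero objects also arise from
  expansions, by splitting an identity as \<open>1 + 0\<close>. They are indispensable only when the category has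
  no objects: it is Morita equivalent to a category all of whose objects are zero.\<close>

definition finite_partition :: "'o set \<Rightarrow> 'i set \<Rightarrow> ('i \<Rightarrow> 'o set) \<Rightarrow> bool" where
  "finite_partition A I E \<longleftrightarrow>
    (\<Union>i\<in>I. E i) = A \<and> disjoint_family_on E I \<and> (\<forall>i\<in>I. finite (E i))"

text \<open>A morphism from \<open>i\<close> to \<open>j\<close> is a matrix with rows indexed by \<open>E j\<close> and columns by \<open>E i\<close>, whose
  entry at \<open>(y, x)\<close> is a morphism from \<open>x\<close> to \<open>y\<close>.\<close>

definition contraction ::
  "('o, 'm, 'k) kcat \<Rightarrow> 'i set \<Rightarrow> ('i \<Rightarrow> 'o set) \<Rightarrow> ('i, 'o \<times> 'o \<Rightarrow> 'm, 'k) kcat" where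
  "contraction C I E =
    \<lparr>Obj = I,
     Hom = (\<lambda>i j. prod_space (E j \<times> E i) (\<lambda>(y, x). Hom C x y)),
     Comp = (\<lambda>i j l g f. \<lambda>(z, x)\<in>E l \<times> E i.
               \<Oplus>\<^bsub>Hom C x z\<^esub>y\<in>E j. Comp C x y z (g (z, y)) (f (y, x))),
     Ident = (\<lambda>i. \<lambda>(y, x)\<in>E i \<times> E i. if y = x then Ident C x else \<zero>\<^bsub>Hom C x y\<^esub>)\<rparr>"

text \<open>Objects and morphisms of \<open>contraction C I E\<close> and of \<open>D\<close> have different types in general, so being a
  contraction is understood up to isomorphism of categories; similarly for expansions. Since \<open>I\<close> is
  in bijection with the objects of \<open>D\<close>, taking it in the same type is no restriction.\<close>

definition is_contraction ::
  "('k, 'r) ring_scheme \<Rightarrow> ('o, 'm, 'k) kcat \<Rightarrow> ('p, 'n, 'k) kcat \<Rightarrow> bool" where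
  "is_contraction K C D \<longleftrightarrow>
    (\<exists>(I :: 'p set) E. finite_partition (Obj C) I E \<and> k_isomorphic K (contraction C I E) D)"

section \<open>Expansions\<close>

definition complete_orthogonal_idempotents :: "('o, 'm, 'k) kcat \<Rightarrow> 'o \<Rightarrow> 'm set \<Rightarrow> bool" where
  "complete_orthogonal_idempotents C x F \<longleftrightarrow>
    finite F \<and> F \<subseteq> carrier (Hom C x x) \<and>
    (\<forall>e\<in>F. Comp C x x x e e = e) \<and>
    (\<forall>e\<in>F. \<forall>f\<in>F. e \<noteq> f \<longrightarrow> Comp C x x x e f = \<zero>\<^bsub>Hom C x x\<^esub>) \<and>
    (\<Oplus>\<^bsub>Hom C x x\<^esub>e\<in>F. e) = Ident C x"

definition expansion ::
  "('o, 'm, 'k) kcat \<Rightarrow> ('o \<Rightarrow> 'm set) \<Rightarrow> ('o \<times> 'm, 'm, 'k) kcat" where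
  "expansion C F =
    \<lparr>Obj = (SIGMA x:Obj C. F x),
     Hom = (\<lambda>(x, e) (y, f). (Hom C x y)
              \<lparr>carrier := (\<lambda>h. Comp C x y y f (Comp C x x y h e)) ` carrier (Hom C x y)\<rparr>),
     Comp = (\<lambda>(x, _) (y, _) (z, _). Comp C x y z),
     Ident = (\<lambda>(x, e). e)\<rparr>"

definition is_expansion ::
  "('k, 'r) ring_scheme \<Rightarrow> ('o, 'm, 'k) kcat \<Rightarrow> ('p, 'n, 'k) kcat \<Rightarrow> bool" where
  "is_expansion K C D \<longleftrightarrow>
    (\<exists>F. (\<forall>x\<in>Obj C. complete_orthogonal_idempotents C x (F x)) \<and>
      k_isomorphic K (expansion C F) D)"

end

theory Submission
  imports Defs "HOL-Library.Countable"
begin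

text \<open>Let \<open>\<Phi>\<close> be an equivalence from \<open>C\<close>-modules to \<open>D\<close>-modules. Inside the opposite of the category
  of \<open>D\<close>-modules, which has finite biproducts and in which idempotents split, \<open>C\<close> and \<open>D\<close> are the full
  subcategories on the modules \<open>\<Phi> (Hom x -)\<close> and \<open>Hom y -\<close>. Each of these two families consists of direct
  summands of finite sums of members of the other: both are generating, and the identity of a
  representable module factors through a finite sum of generators because the quotient by the images
  of all generators is zero.

  If \<open>s\<close> is a biproduct of objects \<open>t j\<close>, then replacing the \<open>t j\<close> by \<open>s\<close> is a contraction and replacing \<open>s\<close>
  by the \<open>t j\<close> is an expansion. Close the two families under complements with respect to finite sums from
  either family; only as many objects arise as the type \<open>'u\<close> has elements. Every object \<open>a\<close> of the closure
  occurs in a biproduct of \<open>a\<close> with another object of the closure that is also a finite sum of objects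
  of \<open>C\<close>. After duplicating objects, which is an equivalence, one contraction and one expansion thus lead
  from \<open>C\<close> to the closure, and one contraction and one expansion lead from there to \<open>D\<close>.\<close>

section \<open>Linear maps and vector spaces\<close>

text \<open>An expansion never yields a summand alone: splitting \<open>s\<close> also produces the
  complement. The family reached from \<open>C\<close> thus contains complements in sums of objects
  of \<open>C\<close>, the one reached from \<open>D\<close> contains complements in sums of objects
  of \<open>D\<close>, and the two can be matched only if one set of objects is closed under both
  kinds of complement. The opposite category appears because \<open>x\<close> enters
  \<open>Hom x -\<close> contravariantly. A second obstacle is typing: all categories of the chain
  must have objects and morphisms in \<open>'u\<close>, while modules and their morphisms live in
  larger types. Objects are replaced by codes in \<open>'u\<close>; a morphism between retracts of
  finite sums of objects of \<open>D\<close> is determined by finitely many morphisms of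
  \<open>D\<close>, hence has a code in \<open>'u\<close> too. Thirdly, a complete system of
  idempotents is a set, so two zero summands of one \<open>s\<close> would be identified; zero
  summands are removed where this could happen. Finite sums are enough on the module side, because
  factoring the identity of a representable module is a statement about the single element that
  corresponds to it.\<close>

lemma linear_mapsI:
  assumes "\<And>v. v \<in> carrier V \<Longrightarrow> h v \<in> carrier W"
    and "\<And>v w. v \<in> carrier V \<Longrightarrow> w \<in> carrier V \<Longrightarrow> h (v \<oplus>\<^bsub>V\<^esub> w) = h v \<oplus>\<^bsub>W\<^esub> h w"
    and "\<And>a v. a \<in> carrier K \<Longrightarrow> v \<in> carrier V \<Longrightarrow> h (a \<odot>\<^bsub>V\<^esub> v) = a \<odot>\<^bsub>W\<^esub> h v"
  shows "h \<in> linear_maps K V W"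
  using assms by (auto simp: linear_maps_def)

lemma linear_mapsD:
  assumes "h \<in> linear_maps K V W"
  shows "\<And>v. v \<in> carrier V \<Longrightarrow> h v \<in> carrier W"
    and "\<And>v w. v \<in> carrier V \<Longrightarrow> w \<in> carrier V \<Longrightarrow> h (v \<oplus>\<^bsub>V\<^esub> w) = h v \<oplus>\<^bsub>W\<^esub> h w"
    and "\<And>a v. a \<in> carrier K \<Longrightarrow> v \<in> carrier V \<Longrightarrow> h (a \<odot>\<^bsub>V\<^esub> v) = a \<odot>\<^bsub>W\<^esub> h v"
  using assms by (auto simp: linear_maps_def)

lemma linear_maps_zero:
  assumes "h \<in> linear_maps K V W" "module K V" "module K W"
  shows "h \<zero>\<^bsub>V\<^esub> = \<zero>\<^bsub>W\<^esub>"
proof -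
  interpret V: module K V by fact
  interpret W: module K W by fact
  have "h \<zero>\<^bsub>V\<^esub> = h (\<zero>\<^bsub>K\<^esub> \<odot>\<^bsub>V\<^esub> \<zero>\<^bsub>V\<^esub>)" by simp
  also have "\<dots> = \<zero>\<^bsub>K\<^esub> \<odot>\<^bsub>W\<^esub> h \<zero>\<^bsub>V\<^esub>" by (rule linear_mapsD(3)[OF assms(1)]) simp_all
  also have "\<dots> = \<zero>\<^bsub>W\<^esub>" using linear_mapsD(1)[OF assms(1)] by simp
  finally show ?thesis .
qed

lemma linear_maps_finsum:
  assumes "h \<in> linear_maps K V W" "module K V" "module K W"
    and "finite A" "f \<in> A \<rightarrow> carrier V"
  shows "h (finsum V f A) = finsum W (\<lambda>a. h (f a)) A"
proof -
  interpret V: module K V by fact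
  interpret W: module K W by fact
  note h = linear_mapsD[OF assms(1)]
  show ?thesis using assms(4,5)
  proof (induction A rule: finite_induct)
    case empty
    then show ?case using linear_maps_zero[OF assms(1-3)] by simp
  next
    case (insert a A)
    have "finsum V f A \<in> carrier V" using insert by (intro V.finsum_closed) auto
    moreover have "(\<lambda>a. h (f a)) \<in> A \<rightarrow> carrier W" "h (f a) \<in> carrier W"
      using insert h(1) by auto
    ultimately show ?case using insert h(2) by (simp add: Pi_iff)
  qed
qed

text \<open>Closure under negatives comes from scaling by minus one. The morphism spaces of
  \<open>vect_cat\<close> and \<open>functor_cat\<close> are products with a smaller carrier, and
  this is how they become modules over \<open>K\<close>.\<close>

lemma module_restrict_carrier:
  assumes "module K V" "N \<subseteq> carrier V" "\<zero>\<^bsub>V\<^esub> \<in> N"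
    and "\<And>v w. v \<in> N \<Longrightarrow> w \<in> N \<Longrightarrow> v \<oplus>\<^bsub>V\<^esub> w \<in> N"
    and "\<And>a v. a \<in> carrier K \<Longrightarrow> v \<in> N \<Longrightarrow> a \<odot>\<^bsub>V\<^esub> v \<in> N"
  shows "module K (V\<lparr>carrier := N\<rparr>)"
proof -
  interpret V: module K V by fact
  have "\<ominus>\<^bsub>V\<^esub> v \<in> N" if "v \<in> N" for v
  proof -
    have "(\<ominus>\<^bsub>K\<^esub> \<one>\<^bsub>K\<^esub>) \<odot>\<^bsub>V\<^esub> v \<in> N" using assms(5) that by simp
    moreover have "(\<ominus>\<^bsub>K\<^esub> \<one>\<^bsub>K\<^esub>) \<odot>\<^bsub>V\<^esub> v = \<ominus>\<^bsub>V\<^esub> v"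
      using that assms(2) by (subst V.smult_l_minus) auto
    ultimately show ?thesis by simp
  qed
  then have "submodule N K V" by (intro V.submoduleI assms)
  then show ?thesis by (rule submodule.submodule_is_module) fact
qed

lemma module_prod_space:
  assumes "cring K" "\<And>a. a \<in> A \<Longrightarrow> module K (V a)"
  shows "module K (prod_space A V)"
proof (rule moduleI)
  note m = assms(2)
  have ag: "abelian_group (V a)" if "a \<in> A" for a using m[OF that] by (rule module.axioms)
  note am = abelian_group.axioms(1)[OF ag]
  show "abelian_group (prod_space A V)"
  proof (rule abelian_groupI)
    fix f assume f: "f \<in> carrier (prod_space A V)"
    show "\<exists>g\<in>carrier (prod_space A V). g \<oplus>\<^bsub>prod_space A V\<^esub> f = \<zero>\<^bsub>prod_space A V\<^esub>"
      using f by (intro bexI[of _ "\<lambda>a\<in>A. \<ominus>\<^bsub>V a\<^esub> f a"])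
        (auto simp: prod_space_def fun_eq_iff abelian_group.l_neg[OF ag]
           PiE_iff abelian_group.a_inv_closed[OF ag])
  qed (auto simp: prod_space_def PiE_iff fun_eq_iff extensional_def abelian_monoid.a_closed[OF am]
      abelian_monoid.a_assoc[OF am] abelian_monoid.a_comm[OF am] abelian_monoid.l_zero[OF am]
      abelian_monoid.zero_closed[OF am] abelian_monoid.a_lcomm[OF am] abelian_monoid.r_zero[OF am])
qed (auto simp: assms(1) prod_space_def PiE_iff fun_eq_iff extensional_def module.smult_closed[OF assms(2)]
    module.smult_l_distr[OF assms(2)] module.smult_r_distr[OF assms(2)]
    module.smult_assoc1[OF assms(2)] module.smult_one[OF assms(2)])

lemma prod_space_simps:
  "carrier (prod_space A V) = (\<Pi>\<^sub>E a\<in>A. carrier (V a))"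
  "\<zero>\<^bsub>prod_space A V\<^esub> = (\<lambda>a\<in>A. \<zero>\<^bsub>V a\<^esub>)"
  "f \<oplus>\<^bsub>prod_space A V\<^esub> g = (\<lambda>a\<in>A. f a \<oplus>\<^bsub>V a\<^esub> g a)"
  "c \<odot>\<^bsub>prod_space A V\<^esub> f = (\<lambda>a\<in>A. c \<odot>\<^bsub>V a\<^esub> f a)"
  by (simp_all add: prod_space_def)

text \<open>When \<open>r\<close> is injective, \<open>image_space r V\<close> is a copy of \<open>V\<close> in another universe; when
  \<open>r\<close> picks representatives of cosets, it is a quotient of \<open>V\<close>.\<close>

definition image_space :: "('a \<Rightarrow> 'b) \<Rightarrow> ('k, 'a) module \<Rightarrow> ('k, 'b) module" where
  "image_space r V =
    \<lparr>carrier = r ` carrier V, mult = undefined, one = undefined, zero = r \<zero>\<^bsub>V\<^esub>,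
     add = (\<lambda>a b. r (inv_into (carrier V) r a \<oplus>\<^bsub>V\<^esub> inv_into (carrier V) r b)),
     smult = (\<lambda>c a. r (c \<odot>\<^bsub>V\<^esub> inv_into (carrier V) r a))\<rparr>"

text \<open>The condition under which the operations of \<open>image_space\<close> do not depend on
  the preimages picked by \<open>inv_into\<close>. An injective \<open>r\<close> and a map to coset
  representatives both satisfy it, so recoding and quotients are treated together.\<close>

definition linear_congruence :: "('k, 'r) ring_scheme \<Rightarrow> ('k, 'a) module \<Rightarrow> ('a \<Rightarrow> 'b) \<Rightarrow> bool" where
  "linear_congruence K V r \<longleftrightarrow>
    (\<forall>v\<in>carrier V. \<forall>v'\<in>carrier V. \<forall>w\<in>carrier V. \<forall>w'\<in>carrier V.
      r v = r v' \<longrightarrow> r w = r w' \<longrightarrow> r (v \<oplus>\<^bsub>V\<^esub> w) = r (v' \<oplus>\<^bsub>V\<^esub> w')) \<and>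
    (\<forall>c\<in>carrier K. \<forall>v\<in>carrier V. \<forall>v'\<in>carrier V. r v = r v' \<longrightarrow> r (c \<odot>\<^bsub>V\<^esub> v) = r (c \<odot>\<^bsub>V\<^esub> v'))"

lemma linear_congruence_inj: "inj_on r (carrier V) \<Longrightarrow> linear_congruence K V r"
  unfolding linear_congruence_def by (metis inj_onD)

lemma image_space_linear:
  assumes "module K V" "linear_congruence K V r"
  shows "r \<in> linear_maps K V (image_space r V)"
proof (rule linear_mapsI)
  interpret V: module K V by fact
  let ?s = "inv_into (carrier V) r"
  fix v w assume vw: "v \<in> carrier V" "w \<in> carrier V"
  then have "r v = r (?s (r v))" "r w = r (?s (r w))" "?s (r v) \<in> carrier V" "?s (r w) \<in> carrier V"
    by (simp_all add: f_inv_into_f inv_into_into)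
  then have "r (v \<oplus>\<^bsub>V\<^esub> w) = r (?s (r v) \<oplus>\<^bsub>V\<^esub> ?s (r w))"
    using assms(2) vw unfolding linear_congruence_def by blast
  then show "r (v \<oplus>\<^bsub>V\<^esub> w) = r v \<oplus>\<^bsub>image_space r V\<^esub> r w" by (simp add: image_space_def)
next
  interpret V: module K V by fact
  let ?s = "inv_into (carrier V) r"
  fix a v assume vw: "a \<in> carrier K" "v \<in> carrier V"
  then have "r v = r (?s (r v))" "?s (r v) \<in> carrier V"
    by (simp_all add: f_inv_into_f inv_into_into)
  then have "r (a \<odot>\<^bsub>V\<^esub> v) = r (a \<odot>\<^bsub>V\<^esub> ?s (r v))"
    using assms(2) vw unfolding linear_congruence_def by blast
  then show "r (a \<odot>\<^bsub>V\<^esub> v) = a \<odot>\<^bsub>image_space r V\<^esub> r v" by (simp add: image_space_def)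
qed (simp add: image_space_def)

lemma carrier_image_space: "carrier (image_space r V) = r ` carrier V"
  and zero_image_space: "\<zero>\<^bsub>image_space r V\<^esub> = r \<zero>\<^bsub>V\<^esub>"
  by (simp_all add: image_space_def)

text \<open>The axioms are transported along \<open>r\<close>, which is linear and maps onto the new
  carrier.\<close>

lemma module_image_space:
  assumes "module K V" "linear_congruence K V r"
  shows "module K (image_space r V)"
proof -
  interpret V: module K V by fact
  note r = linear_mapsD(2,3)[OF image_space_linear[OF assms], symmetric]
  show ?thesis
  proof (rule moduleI)
    show "abelian_group (image_space r V)"
    proof (rule abelian_groupI)
      fix x assume "x \<in> carrier (image_space r V)"
      then obtain v where "v \<in> carrier V" "x = r v" by (auto simp: carrier_image_space)
      then show "\<exists>y\<in>carrier (image_space r V). y \<oplus>\<^bsub>image_space r V\<^esub> x = \<zero>\<^bsub>image_space r V\<^esub>"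
        by (intro bexI[of _ "r (\<ominus>\<^bsub>V\<^esub> v)"]) (auto simp: carrier_image_space r zero_image_space V.l_neg)
    qed (auto simp: carrier_image_space zero_image_space r V.a_ac)
  qed (auto simp: carrier_image_space r V.smult_l_distr V.smult_r_distr V.smult_assoc1 V.is_cring)
qed

lemma inv_into_image_space_linear:
  assumes "module K V" "inj_on r (carrier V)"
  shows "inv_into (carrier V) r \<in> linear_maps K (image_space r V) V"
proof -
  interpret V: module K V by fact
  note r = linear_mapsD(2,3)[OF image_space_linear[OF assms(1) linear_congruence_inj[OF assms(2)]], symmetric]
  show ?thesis
    by (rule linear_mapsI) (auto simp: carrier_image_space r assms(2))
qed

text \<open>When \<open>N\<close> is a submodule, the predicate under \<open>SOME\<close> depends
  only on the coset of \<open>v\<close>, and so does the chosen element. Representatives instead of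
  sets as elements keep the quotient in the type of \<open>V\<close>, hence in the universe over
  which modules are formed.\<close>

definition coset_rep :: "('k, 'a) module \<Rightarrow> 'a set \<Rightarrow> 'a \<Rightarrow> 'a" where
  "coset_rep V N v = (SOME w. w \<in> carrier V \<and> w \<ominus>\<^bsub>V\<^esub> v \<in> N)"

text \<open>For congruent elements the predicates under \<open>SOME\<close> coincide; conversely, a
  common representative is congruent to both elements.\<close>

lemma coset_rep_eq_iff:
  assumes "module K V" "submodule N K V" and v: "v \<in> carrier V" and w: "w \<in> carrier V"
  shows "coset_rep V N v = coset_rep V N w \<longleftrightarrow> v \<ominus>\<^bsub>V\<^esub> w \<in> N"
proof -
  interpret V: module K V by fact
  note N = V.submoduleE[OF assms(2)]
  have z: "\<zero>\<^bsub>V\<^esub> \<in> N" using subgroup.one_closed[OF submodule.axioms(1)[OF assms(2)]] by simp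
  have tr: "a \<ominus>\<^bsub>V\<^esub> c \<in> N" if "a \<ominus>\<^bsub>V\<^esub> b \<in> N" "b \<ominus>\<^bsub>V\<^esub> c \<in> N" "a \<in> carrier V" "b \<in> carrier V" "c \<in> carrier V" for a b c
  proof -
    have "(a \<ominus>\<^bsub>V\<^esub> b) \<oplus>\<^bsub>V\<^esub> (b \<ominus>\<^bsub>V\<^esub> c) \<in> N" using that N(5) by blast
    moreover have "(a \<ominus>\<^bsub>V\<^esub> b) \<oplus>\<^bsub>V\<^esub> (b \<ominus>\<^bsub>V\<^esub> c) = a \<ominus>\<^bsub>V\<^esub> c"
      using that by (simp add: V.minus_eq V.a_ac V.r_neg1 V.r_neg2)
    ultimately show ?thesis by simp
  qed
  have sy: "b \<ominus>\<^bsub>V\<^esub> a \<in> N" if "a \<ominus>\<^bsub>V\<^esub> b \<in> N" "a \<in> carrier V" "b \<in> carrier V" for a b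
  proof -
    have "\<ominus>\<^bsub>V\<^esub> (a \<ominus>\<^bsub>V\<^esub> b) \<in> N" using that N(3) by blast
    moreover have "\<ominus>\<^bsub>V\<^esub> (a \<ominus>\<^bsub>V\<^esub> b) = b \<ominus>\<^bsub>V\<^esub> a"
      using that by (simp add: V.minus_eq V.a_ac V.minus_add)
    ultimately show ?thesis by simp
  qed
  have ex: "coset_rep V N v \<in> carrier V \<and> coset_rep V N v \<ominus>\<^bsub>V\<^esub> v \<in> N" if "v \<in> carrier V" for v
    unfolding coset_rep_def by (rule someI[of _ v]) (use that z in \<open>simp add: V.minus_eq V.r_neg\<close>)
  show ?thesis
  proof
    assume eq: "coset_rep V N v = coset_rep V N w"
    show "v \<ominus>\<^bsub>V\<^esub> w \<in> N"
      by (rule tr[of _ "coset_rep V N v"])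
        (use ex[OF v] ex[OF w] eq sy[of "coset_rep V N v" v] v w in simp_all)
  next
    assume vw: "v \<ominus>\<^bsub>V\<^esub> w \<in> N"
    have "u \<ominus>\<^bsub>V\<^esub> v \<in> N \<longleftrightarrow> u \<ominus>\<^bsub>V\<^esub> w \<in> N" if "u \<in> carrier V" for u
      using tr[OF _ vw that v w] tr[OF _ sy[OF vw v w] that w v] by blast
    then show "coset_rep V N v = coset_rep V N w"
      unfolding coset_rep_def by (intro arg_cong[where f = Eps]) auto
  qed
qed

lemma linear_congruence_coset_rep:
  assumes "module K V" "submodule N K V"
  shows "linear_congruence K V (coset_rep V N)"
proof -
  interpret V: module K V by fact
  note N = V.submoduleE[OF assms(2)]
  show ?thesis unfolding linear_congruence_def
  proof (intro conjI ballI impI)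
    fix v v' w w' assume c: "v \<in> carrier V" "v' \<in> carrier V" "w \<in> carrier V" "w' \<in> carrier V"
      and eq: "coset_rep V N v = coset_rep V N v'" "coset_rep V N w = coset_rep V N w'"
    have "(v \<ominus>\<^bsub>V\<^esub> v') \<oplus>\<^bsub>V\<^esub> (w \<ominus>\<^bsub>V\<^esub> w') \<in> N"
      using iffD1[OF coset_rep_eq_iff[OF assms c(1,2)] eq(1)]
        iffD1[OF coset_rep_eq_iff[OF assms c(3,4)] eq(2)] by (rule N(5))
    moreover have "(v \<ominus>\<^bsub>V\<^esub> v') \<oplus>\<^bsub>V\<^esub> (w \<ominus>\<^bsub>V\<^esub> w') = (v \<oplus>\<^bsub>V\<^esub> w) \<ominus>\<^bsub>V\<^esub> (v' \<oplus>\<^bsub>V\<^esub> w')"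
      using c by (simp add: V.minus_eq V.a_ac V.minus_add)
    ultimately show "coset_rep V N (v \<oplus>\<^bsub>V\<^esub> w) = coset_rep V N (v' \<oplus>\<^bsub>V\<^esub> w')"
      using c by (subst coset_rep_eq_iff[OF assms]) auto
  next
    fix a v v' assume c: "v \<in> carrier V" "v' \<in> carrier V" "a \<in> carrier K"
      and eq: "coset_rep V N v = coset_rep V N v'"
    have "a \<odot>\<^bsub>V\<^esub> (v \<ominus>\<^bsub>V\<^esub> v') \<in> N"
      using c(3) iffD1[OF coset_rep_eq_iff[OF assms c(1,2)] eq] by (rule N(4))
    moreover have "a \<odot>\<^bsub>V\<^esub> (v \<ominus>\<^bsub>V\<^esub> v') = (a \<odot>\<^bsub>V\<^esub> v) \<ominus>\<^bsub>V\<^esub> (a \<odot>\<^bsub>V\<^esub> v')"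
      using c by (simp add: V.minus_eq V.smult_r_distr V.smult_r_minus)
    ultimately show "coset_rep V N (a \<odot>\<^bsub>V\<^esub> v) = coset_rep V N (a \<odot>\<^bsub>V\<^esub> v')"
      using c by (subst coset_rep_eq_iff[OF assms]) auto
  qed
qed

section \<open>Linear categories\<close>

context k_category
begin

lemma cring_K: "cring K" by (rule is_cring)

lemma hom_group: "x \<in> Obj C \<Longrightarrow> y \<in> Obj C \<Longrightarrow> abelian_group (Hom C x y)"
  using hom_space by (rule module.axioms)

lemma hom_monoid: "x \<in> Obj C \<Longrightarrow> y \<in> Obj C \<Longrightarrow> abelian_monoid (Hom C x y)"
  using hom_group by (rule abelian_group.axioms)

lemma zero_hom: "x \<in> Obj C \<Longrightarrow> y \<in> Obj C \<Longrightarrow> \<zero>\<^bsub>Hom C x y\<^esub> \<in> carrier (Hom C x y)"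
  by (rule abelian_monoid.zero_closed[OF hom_monoid])

lemma add_hom:
  "\<lbrakk>x \<in> Obj C; y \<in> Obj C; f \<in> carrier (Hom C x y); g \<in> carrier (Hom C x y)\<rbrakk>
    \<Longrightarrow> f \<oplus>\<^bsub>Hom C x y\<^esub> g \<in> carrier (Hom C x y)"
  by (rule abelian_monoid.a_closed[OF hom_monoid])

lemma comp_closed:
  assumes "x \<in> Obj C" "y \<in> Obj C" "z \<in> Obj C" "f \<in> carrier (Hom C x y)" "g \<in> carrier (Hom C y z)"
  shows "Comp C x y z g f \<in> carrier (Hom C x z)"
  using linear_mapsD(1)[OF comp_linear_left[OF assms(1-4)]] assms(5) .

lemma comp_add_left:
  assumes "x \<in> Obj C" "y \<in> Obj C" "z \<in> Obj C" "f \<in> carrier (Hom C x y)"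
    "g \<in> carrier (Hom C y z)" "h \<in> carrier (Hom C y z)"
  shows "Comp C x y z (g \<oplus>\<^bsub>Hom C y z\<^esub> h) f = Comp C x y z g f \<oplus>\<^bsub>Hom C x z\<^esub> Comp C x y z h f"
  using linear_mapsD(2)[OF comp_linear_left[OF assms(1-4)]] assms(5,6) .

lemma comp_add_right:
  assumes "x \<in> Obj C" "y \<in> Obj C" "z \<in> Obj C" "g \<in> carrier (Hom C y z)"
    "f \<in> carrier (Hom C x y)" "h \<in> carrier (Hom C x y)"
  shows "Comp C x y z g (f \<oplus>\<^bsub>Hom C x y\<^esub> h) = Comp C x y z g f \<oplus>\<^bsub>Hom C x z\<^esub> Comp C x y z g h"
  using linear_mapsD(2)[OF comp_linear_right[OF assms(1-4)]] assms(5,6) .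

lemma comp_smult_left:
  assumes "x \<in> Obj C" "y \<in> Obj C" "z \<in> Obj C" "f \<in> carrier (Hom C x y)"
    "g \<in> carrier (Hom C y z)" "a \<in> carrier K"
  shows "Comp C x y z (a \<odot>\<^bsub>Hom C y z\<^esub> g) f = a \<odot>\<^bsub>Hom C x z\<^esub> Comp C x y z g f"
  using linear_mapsD(3)[OF comp_linear_left[OF assms(1-4)]] assms(5,6) by blast

lemma comp_smult_right:
  assumes "x \<in> Obj C" "y \<in> Obj C" "z \<in> Obj C" "g \<in> carrier (Hom C y z)"
    "f \<in> carrier (Hom C x y)" "a \<in> carrier K"
  shows "Comp C x y z g (a \<odot>\<^bsub>Hom C x y\<^esub> f) = a \<odot>\<^bsub>Hom C x z\<^esub> Comp C x y z g f"
  using linear_mapsD(3)[OF comp_linear_right[OF assms(1-4)]] assms(5,6) by blast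

lemma comp_zero_left:
  assumes "x \<in> Obj C" "y \<in> Obj C" "z \<in> Obj C" "f \<in> carrier (Hom C x y)"
  shows "Comp C x y z \<zero>\<^bsub>Hom C y z\<^esub> f = \<zero>\<^bsub>Hom C x z\<^esub>"
  using linear_maps_zero[OF comp_linear_left[OF assms(1-4)] hom_space hom_space] assms by blast

lemma comp_zero_right:
  assumes "x \<in> Obj C" "y \<in> Obj C" "z \<in> Obj C" "g \<in> carrier (Hom C y z)"
  shows "Comp C x y z g \<zero>\<^bsub>Hom C x y\<^esub> = \<zero>\<^bsub>Hom C x z\<^esub>"
  using linear_maps_zero[OF comp_linear_right[OF assms(1-4)] hom_space hom_space] assms by blast

lemma comp_finsum_left:
  assumes "x \<in> Obj C" "y \<in> Obj C" "z \<in> Obj C" "f \<in> carrier (Hom C x y)"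
    "finite A" "g \<in> A \<rightarrow> carrier (Hom C y z)"
  shows "Comp C x y z (finsum (Hom C y z) g A) f = finsum (Hom C x z) (\<lambda>a. Comp C x y z (g a) f) A"
  using linear_maps_finsum[OF comp_linear_left[OF assms(1-4)] hom_space hom_space assms(5,6)] assms
  by blast

lemma comp_finsum_right:
  assumes "x \<in> Obj C" "y \<in> Obj C" "z \<in> Obj C" "g \<in> carrier (Hom C y z)"
    "finite A" "f \<in> A \<rightarrow> carrier (Hom C x y)"
  shows "Comp C x y z g (finsum (Hom C x y) f A) = finsum (Hom C x z) (\<lambda>a. Comp C x y z g (f a)) A"
  using linear_maps_finsum[OF comp_linear_right[OF assms(1-4)] hom_space hom_space assms(5,6)] assms
  by blast

lemma finsum_hom:
  "\<lbrakk>x \<in> Obj C; y \<in> Obj C; f \<in> A \<rightarrow> carrier (Hom C x y)\<rbrakk> \<Longrightarrow> finsum (Hom C x y) f A \<in> carrier (Hom C x y)"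
  by (rule abelian_monoid.finsum_closed[OF hom_monoid])

lemma finsum_delta:
  assumes "x \<in> Obj C" "y \<in> Obj C" "finite A" "a \<in> A" "f a \<in> carrier (Hom C x y)"
  shows "finsum (Hom C x y) (\<lambda>b. if a = b then f b else \<zero>\<^bsub>Hom C x y\<^esub>) A = f a"
  using abelian_monoid.finsum_singleton[OF hom_monoid[OF assms(1,2)] assms(4,3), of "\<lambda>b. f a"] assms(5)
  by (simp cong: if_cong)

end

section \<open>Morphisms that factor through sums of given objects\<close>

text \<open>The ideal of morphisms generated by the objects of \<open>T\<close>. It is built from
  composites through single objects, so that it makes sense without biproducts. In a category with
  biproducts, an identity belongs to it exactly when the object is a retract of a finite sum of
  objects of \<open>T\<close>.\<close>

inductive_set thru :: "('o, 'm, 'k) kcat \<Rightarrow> 'o set \<Rightarrow> 'o \<Rightarrow> 'o \<Rightarrow> 'm set"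
  for C :: "('o, 'm, 'k) kcat" and T :: "'o set" and x y :: 'o where
  zero: "\<zero>\<^bsub>Hom C x y\<^esub> \<in> thru C T x y"
| add: "\<lbrakk>f \<in> thru C T x y; t \<in> T; u \<in> carrier (Hom C x t); v \<in> carrier (Hom C t y)\<rbrakk>
    \<Longrightarrow> f \<oplus>\<^bsub>Hom C x y\<^esub> Comp C x t y v u \<in> thru C T x y"

context k_category
begin

lemma thru_hom:
  assumes "f \<in> thru C T x y" "T \<subseteq> Obj C" "x \<in> Obj C" "y \<in> Obj C"
  shows "f \<in> carrier (Hom C x y)"
  using assms by (induction) (auto intro!: zero_hom add_hom intro: comp_closed)

lemma thru_single:
  assumes "t \<in> T" "u \<in> carrier (Hom C x t)" "v \<in> carrier (Hom C t y)"
    "T \<subseteq> Obj C" "x \<in> Obj C" "y \<in> Obj C"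
  shows "Comp C x t y v u \<in> thru C T x y"
  using thru.add[OF thru.zero assms(1-3)] assms
  by (metis abelian_monoid.l_zero comp_closed hom_monoid subsetD)

lemma thru_add:
  assumes "g \<in> thru C T x y" "f \<in> thru C T x y" "T \<subseteq> Obj C" "x \<in> Obj C" "y \<in> Obj C"
  shows "f \<oplus>\<^bsub>Hom C x y\<^esub> g \<in> thru C T x y"
  using assms(1)
proof induction
  case zero
  then show ?case
    using assms(2) thru_hom[OF assms(2-5)] abelian_monoid.r_zero[OF hom_monoid] assms(4,5) by simp
next
  case (add g t u v)
  have "f \<oplus>\<^bsub>Hom C x y\<^esub> (g \<oplus>\<^bsub>Hom C x y\<^esub> Comp C x t y v u) = f \<oplus>\<^bsub>Hom C x y\<^esub> g \<oplus>\<^bsub>Hom C x y\<^esub> Comp C x t y v u"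
    using thru_hom[OF assms(2-5)] thru_hom[OF add.hyps(1) assms(3-5)] add.hyps assms(3-5)
    by (intro abelian_monoid.a_assoc[OF hom_monoid, symmetric] comp_closed) auto
  then show ?case using thru.add[OF add.IH add.hyps(2-4)] by simp
qed

lemma thru_comp_left:
  assumes "f \<in> thru C T x y" "g \<in> carrier (Hom C y z)" "T \<subseteq> Obj C" "x \<in> Obj C" "y \<in> Obj C" "z \<in> Obj C"
  shows "Comp C x y z g f \<in> thru C T x z"
  using assms(1)
proof induction
  case zero
  then show ?case using comp_zero_right assms thru.zero by metis
next
  case (add f t u v)
  have t: "t \<in> Obj C" using add assms by auto
  have "Comp C x y z g (f \<oplus>\<^bsub>Hom C x y\<^esub> Comp C x t y v u)
      = Comp C x y z g f \<oplus>\<^bsub>Hom C x z\<^esub> Comp C x y z g (Comp C x t y v u)"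
    using thru_hom[OF add.hyps(1)] assms add.hyps t by (intro comp_add_right comp_closed) auto
  also have "Comp C x y z g (Comp C x t y v u) = Comp C x t z (Comp C t y z g v) u"
    using assms add.hyps t by (intro comp_assoc) auto
  finally show ?case
    using thru.add[OF add.IH add.hyps(2,3) comp_closed[OF t _ _ add.hyps(4) assms(2)]] assms by simp
qed

lemma thru_comp_right:
  assumes "f \<in> thru C T x y" "g \<in> carrier (Hom C w x)" "T \<subseteq> Obj C" "x \<in> Obj C" "y \<in> Obj C" "w \<in> Obj C"
  shows "Comp C w x y f g \<in> thru C T w y"
  using assms(1)
proof induction
  case zero
  then show ?case using comp_zero_left assms thru.zero by metis
next
  case (add f t u v)
  have t: "t \<in> Obj C" using add assms by auto
  have "Comp C w x y (f \<oplus>\<^bsub>Hom C x y\<^esub> Comp C x t y v u) g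
      = Comp C w x y f g \<oplus>\<^bsub>Hom C w y\<^esub> Comp C w x y (Comp C x t y v u) g"
    using thru_hom[OF add.hyps(1)] assms add.hyps t by (intro comp_add_left comp_closed) auto
  also have "Comp C w x y (Comp C x t y v u) g = Comp C w t y v (Comp C w x t u g)"
    using assms add.hyps t by (intro comp_assoc[symmetric]) auto
  finally show ?case
    using thru.add[OF add.IH add.hyps(2) comp_closed[OF _ _ t assms(2) add.hyps(3)] add.hyps(4)] assms by simp
qed

text \<open>The identity of \<open>t\<close> is inserted in the middle of each composite
  \<open>v\<close> after \<open>u\<close>, and the ideal property does the rest. As a consequence,
  two families that generate each other have the same retracts of finite sums.\<close>

lemma thru_trans:
  assumes "f \<in> thru C T x y" "\<And>t. t \<in> T \<Longrightarrow> Ident C t \<in> thru C T' t t"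
    "T \<subseteq> Obj C" "T' \<subseteq> Obj C" "x \<in> Obj C" "y \<in> Obj C"
  shows "f \<in> thru C T' x y"
  using assms(1)
proof induction
  case (add f t u v)
  have t: "t \<in> Obj C" using add assms by auto
  have "Comp C x t t (Ident C t) u \<in> thru C T' x t"
    using assms t add by (intro thru_comp_right) auto
  then have "u \<in> thru C T' x t" using comp_ident_left assms t add by simp
  then have "Comp C x t y v u \<in> thru C T' x y"
    using assms t add by (intro thru_comp_left) auto
  then show ?case using add.IH assms by (intro thru_add) auto
qed (rule thru.zero)

text \<open>Zero objects are left out so that the diagonal idempotents of the corresponding biproduct
  are pairwise distinct.\<close>

lemma thru_family:
  assumes "f \<in> thru C T x y" "T \<subseteq> Obj C" "x \<in> Obj C" "y \<in> Obj C"
  shows "\<exists>(n :: nat) t u v. (\<forall>j<n. t j \<in> T \<and> Ident C (t j) \<noteq> \<zero>\<^bsub>Hom C (t j) (t j)\<^esub> \<and>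
      u j \<in> carrier (Hom C x (t j)) \<and> v j \<in> carrier (Hom C (t j) y)) \<and>
    f = (\<Oplus>\<^bsub>Hom C x y\<^esub>j\<in>{..<n}. Comp C x (t j) y (v j) (u j))"
  using assms(1)
proof induction
  case zero
  show ?case by (intro exI[of _ 0]) (simp add: abelian_monoid.finsum_empty[OF hom_monoid] assms)
next
  case (add f s a b)
  have s: "s \<in> Obj C" using add assms by auto
  from add.IH obtain n :: nat and t u v where
    tuv: "\<And>j. j < n \<Longrightarrow> t j \<in> T \<and> Ident C (t j) \<noteq> \<zero>\<^bsub>Hom C (t j) (t j)\<^esub> \<and>
      u j \<in> carrier (Hom C x (t j)) \<and> v j \<in> carrier (Hom C (t j) y)"
    and f: "f = (\<Oplus>\<^bsub>Hom C x y\<^esub>j\<in>{..<n}. Comp C x (t j) y (v j) (u j))" by blast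
  have fc: "f \<in> carrier (Hom C x y)" using add.hyps(1) thru_hom assms by blast
  have ba: "Comp C x s y b a \<in> carrier (Hom C x y)" using add s assms comp_closed by blast
  show ?case
  proof (cases "Ident C s = \<zero>\<^bsub>Hom C s s\<^esub>")
    case True
    have "a = \<zero>\<^bsub>Hom C x s\<^esub>"
      using comp_ident_left[of x s a] comp_zero_left[of x s s a] True add s assms by simp
    then have "Comp C x s y b a = \<zero>\<^bsub>Hom C x y\<^esub>" using comp_zero_right s add assms by simp
    then have "f \<oplus>\<^bsub>Hom C x y\<^esub> Comp C x s y b a = f"
      using fc abelian_monoid.r_zero[OF hom_monoid] assms by simp
    then show ?thesis using add.IH by simp
  next
    case False
    let ?t = "t(n := s)" and ?u = "u(n := a)" and ?v = "v(n := b)"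
    have *: "(\<Oplus>\<^bsub>Hom C x y\<^esub>j\<in>{..<n}. Comp C x (?t j) y (?v j) (?u j)) = f"
      unfolding f using tuv comp_closed assms
      by (intro abelian_monoid.finsum_cong'[OF hom_monoid]) (auto simp: subset_iff)
    have "(\<Oplus>\<^bsub>Hom C x y\<^esub>j\<in>insert n {..<n}. Comp C x (?t j) y (?v j) (?u j))
      = Comp C x s y b a \<oplus>\<^bsub>Hom C x y\<^esub> (\<Oplus>\<^bsub>Hom C x y\<^esub>j\<in>{..<n}. Comp C x (?t j) y (?v j) (?u j))"
      using tuv comp_closed assms ba
      by (subst abelian_monoid.finsum_insert[OF hom_monoid]) (auto simp: subset_iff Pi_iff)
    then have sum: "(\<Oplus>\<^bsub>Hom C x y\<^esub>j\<in>{..<Suc n}. Comp C x (?t j) y (?v j) (?u j)) = f \<oplus>\<^bsub>Hom C x y\<^esub> Comp C x s y b a"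
      using * fc ba assms abelian_monoid.a_comm[OF hom_monoid] by (simp add: lessThan_Suc)
    have "\<forall>j<Suc n. ?t j \<in> T \<and> Ident C (?t j) \<noteq> \<zero>\<^bsub>Hom C (?t j) (?t j)\<^esub> \<and>
      ?u j \<in> carrier (Hom C x (?t j)) \<and> ?v j \<in> carrier (Hom C (?t j) y)"
      using tuv add False by (auto simp: less_Suc_eq)
    from this sum[symmetric] show ?thesis by (intro exI conjI)
  qed
qed

end

section \<open>Functors\<close>

lemma k_functorD:
  assumes "k_functor K C D F"
  shows "\<And>x. x \<in> Obj C \<Longrightarrow> fobj F x \<in> Obj D"
    and "\<And>x y. x \<in> Obj C \<Longrightarrow> y \<in> Obj C \<Longrightarrow>
      fmor F x y \<in> linear_maps K (Hom C x y) (Hom D (fobj F x) (fobj F y))"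
    and "\<And>x. x \<in> Obj C \<Longrightarrow> fmor F x x (Ident C x) = Ident D (fobj F x)"
    and "\<And>x y z f g. \<lbrakk>x \<in> Obj C; y \<in> Obj C; z \<in> Obj C; f \<in> carrier (Hom C x y); g \<in> carrier (Hom C y z)\<rbrakk>
      \<Longrightarrow> fmor F x z (Comp C x y z g f) =
        Comp D (fobj F x) (fobj F y) (fobj F z) (fmor F y z g) (fmor F x y f)"
    and "\<And>x y f. \<lbrakk>x \<in> Obj C; y \<in> Obj C; f \<in> carrier (Hom C x y)\<rbrakk>
      \<Longrightarrow> fmor F x y f \<in> carrier (Hom D (fobj F x) (fobj F y))"
proof -
  show lin: "\<And>x y. x \<in> Obj C \<Longrightarrow> y \<in> Obj C \<Longrightarrow>
      fmor F x y \<in> linear_maps K (Hom C x y) (Hom D (fobj F x) (fobj F y))"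
    using assms unfolding k_functor_def by blast
  show "\<And>x y f. \<lbrakk>x \<in> Obj C; y \<in> Obj C; f \<in> carrier (Hom C x y)\<rbrakk>
      \<Longrightarrow> fmor F x y f \<in> carrier (Hom D (fobj F x) (fobj F y))"
    using linear_mapsD(1)[OF lin] .
qed (use assms in \<open>auto simp: k_functor_def\<close>)

lemma k_functorI:
  assumes "\<And>x. x \<in> Obj C \<Longrightarrow> fobj F x \<in> Obj D"
    and "\<And>x y. x \<in> Obj C \<Longrightarrow> y \<in> Obj C \<Longrightarrow>
      fmor F x y \<in> linear_maps K (Hom C x y) (Hom D (fobj F x) (fobj F y))"
    and "\<And>x. x \<in> Obj C \<Longrightarrow> fmor F x x (Ident C x) = Ident D (fobj F x)"
    and "\<And>x y z f g. \<lbrakk>x \<in> Obj C; y \<in> Obj C; z \<in> Obj C; f \<in> carrier (Hom C x y); g \<in> carrier (Hom C y z)\<rbrakk>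
      \<Longrightarrow> fmor F x z (Comp C x y z g f) =
        Comp D (fobj F x) (fobj F y) (fobj F z) (fmor F y z g) (fmor F x y f)"
  shows "k_functor K C D F"
  using assms unfolding k_functor_def by auto

lemma k_functor_zero:
  assumes "k_functor K C D F" "k_category K C" "k_category K D" "x \<in> Obj C" "y \<in> Obj C"
  shows "fmor F x y \<zero>\<^bsub>Hom C x y\<^esub> = \<zero>\<^bsub>Hom D (fobj F x) (fobj F y)\<^esub>"
  using assms
  by (intro linear_maps_zero[OF k_functorD(2)[OF assms(1)]] k_category.hom_space)
    (auto intro: k_functorD(1))

lemma k_functor_comp:
  assumes "k_functor K C D F" "k_functor K D E G"
  shows "k_functor K C E (comp_functor G F)"
  by (rule k_functorI)
    (auto simp: comp_functor_def k_functorD[OF assms(1)] k_functorD[OF assms(2)]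
      linear_mapsD[OF k_functorD(2)[OF assms(1)]] linear_mapsD[OF k_functorD(2)[OF assms(2)]]
      intro!: linear_mapsI)

lemma thru_functor:
  assumes "f \<in> thru C T x y" "k_functor K C D F" "k_category K C" "k_category K D"
    "T \<subseteq> Obj C" "x \<in> Obj C" "y \<in> Obj C"
  shows "fmor F x y f \<in> thru D (fobj F ` T) (fobj F x) (fobj F y)"
  using assms(1)
proof induction
  case zero
  then show ?case using k_functor_zero[OF assms(2-4,6,7)] thru.zero by metis
next
  case (add f t u v)
  have t: "t \<in> Obj C" using add assms by auto
  note F = k_functorD[OF assms(2)]
  have "fmor F x y (f \<oplus>\<^bsub>Hom C x y\<^esub> Comp C x t y v u) =
      fmor F x y f \<oplus>\<^bsub>Hom D (fobj F x) (fobj F y)\<^esub> fmor F x y (Comp C x t y v u)"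
    using assms t add
    by (auto intro!: linear_mapsD(2)[OF F(2)]
        intro: k_category.thru_hom[OF assms(3)] k_category.comp_closed[OF assms(3)])
  also have "fmor F x y (Comp C x t y v u) =
      Comp D (fobj F x) (fobj F t) (fobj F y) (fmor F t y v) (fmor F x t u)"
    using assms t add by (intro F)
  finally show ?case using thru.add[OF add.IH, of "fobj F t"] add.hyps F(5) t assms by simp
qed

section \<open>Fully faithful functors and full subcategories\<close>

definition fully_faithful ::
  "('k, 'r) ring_scheme \<Rightarrow> ('o, 'm, 'k) kcat \<Rightarrow> ('p, 'n, 'k) kcat \<Rightarrow> ('o, 'm, 'p, 'n) kfunctor \<Rightarrow> bool" where
  "fully_faithful K C D F \<longleftrightarrow> k_functor K C D F \<and>
    (\<forall>x\<in>Obj C. \<forall>y\<in>Obj C.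
      bij_betw (fmor F x y) (carrier (Hom C x y)) (carrier (Hom D (fobj F x) (fobj F y))))"

lemma fully_faithfulD:
  assumes "fully_faithful K C D F"
  shows "k_functor K C D F"
    and "\<And>x y. \<lbrakk>x \<in> Obj C; y \<in> Obj C\<rbrakk> \<Longrightarrow>
      bij_betw (fmor F x y) (carrier (Hom C x y)) (carrier (Hom D (fobj F x) (fobj F y)))"
    and "\<And>x y f g. \<lbrakk>fmor F x y f = fmor F x y g; x \<in> Obj C; y \<in> Obj C; f \<in> carrier (Hom C x y);
      g \<in> carrier (Hom C x y)\<rbrakk> \<Longrightarrow> f = g"
  using assms unfolding fully_faithful_def bij_betw_def inj_on_def by blast+

lemma linear_maps_inv_into:
  assumes "h \<in> linear_maps K V W" "bij_betw h (carrier V) (carrier W)" "module K V"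
  shows "inv_into (carrier V) h \<in> linear_maps K W V"
proof -
  interpret V: module K V by fact
  have W: "carrier W = h ` carrier V" and inj: "inj_on h (carrier V)"
    using assms(2) by (auto simp: bij_betw_def)
  note h = linear_mapsD(2,3)[OF assms(1), symmetric]
  show ?thesis by (rule linear_mapsI) (auto simp: W inj h)
qed

lemma fully_faithful_comp:
  assumes "fully_faithful K C D F" "fully_faithful K D E G"
  shows "fully_faithful K C E (comp_functor G F)"
  unfolding fully_faithful_def
proof (intro conjI ballI)
  show "k_functor K C E (comp_functor G F)" using assms by (auto intro: k_functor_comp fully_faithfulD)
  fix x y assume xy: "x \<in> Obj C" "y \<in> Obj C"
  note F = k_functorD(1)[OF fully_faithfulD(1)[OF assms(1)]]
  from bij_betw_trans[OF fully_faithfulD(2)[OF assms(1) xy] fully_faithfulD(2)[OF assms(2) F F, OF xy]]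
  show "bij_betw (fmor (comp_functor G F) x y) (carrier (Hom C x y))
     (carrier (Hom E (fobj (comp_functor G F) x) (fobj (comp_functor G F) y)))"
    by (simp add: comp_functor_def comp_def)
qed

text \<open>Contractions and expansions ask for an isomorphism out of the constructed category,
  whereas the explicit functors below are easier to write in the direction towards it.\<close>

lemma k_isomorphic_sym:
  assumes "k_category K X" "fully_faithful K X Y G" "bij_betw (fobj G) (Obj X) (Obj Y)"
  shows "k_isomorphic K Y X"
proof -
  interpret X: k_category K X by fact
  note G = k_functorD[OF fully_faithfulD(1)[OF assms(2)]]
  note bij = fully_faithfulD(2)[OF assms(2)]
  define g where "g = inv_into (Obj X) (fobj G)"
  define F where "F = \<lparr>fobj = g,
    fmor = \<lambda>a b. inv_into (carrier (Hom X (g a) (g b))) (fmor G (g a) (g b))\<rparr>"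
  have Y: "Obj Y = fobj G ` Obj X" and inj: "inj_on (fobj G) (Obj X)"
    using assms(3) by (auto simp: bij_betw_def)
  have g: "g (fobj G x) = x" if "x \<in> Obj X" for x using that inj by (simp add: g_def)
  have hom: "carrier (Hom Y (fobj G x) (fobj G y)) = fmor G x y ` carrier (Hom X x y)"
    if "x \<in> Obj X" "y \<in> Obj X" for x y using bij[OF that] by (simp add: bij_betw_def)
  have inv: "inv_into (carrier (Hom X x y)) (fmor G x y) (fmor G x y f) = f"
    if "x \<in> Obj X" "y \<in> Obj X" "f \<in> carrier (Hom X x y)" for x y f
    using bij[OF that(1,2)] that by (simp add: bij_betw_def)
  have "k_functor K Y X F"
  proof (rule k_functorI)
    fix a b assume "a \<in> Obj Y" "b \<in> Obj Y"
    then obtain x y where xy: "x \<in> Obj X" "y \<in> Obj X" "a = fobj G x" "b = fobj G y" by (auto simp: Y)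
    then show "fmor F a b \<in> linear_maps K (Hom Y a b) (Hom X (fobj F a) (fobj F b))"
      by (simp add: F_def g linear_maps_inv_into[OF G(2) bij X.hom_space])
  next
    fix a assume "a \<in> Obj Y"
    then obtain x where x: "x \<in> Obj X" "a = fobj G x" by (auto simp: Y)
    then show "fmor F a a (Ident Y a) = Ident X (fobj F a)"
      by (simp add: F_def g G(3)[symmetric] inv X.ident_closed)
  next
    fix a b c k h assume "a \<in> Obj Y" "b \<in> Obj Y" "c \<in> Obj Y" and
      kh: "k \<in> carrier (Hom Y a b)" "h \<in> carrier (Hom Y b c)"
    then obtain x y z where xyz: "x \<in> Obj X" "y \<in> Obj X" "z \<in> Obj X"
      and abc: "a = fobj G x" "b = fobj G y" "c = fobj G z" by (auto simp: Y)
    obtain k' h' where kh': "k' \<in> carrier (Hom X x y)" "h' \<in> carrier (Hom X y z)"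
      "k = fmor G x y k'" "h = fmor G y z h'" using kh xyz hom abc by auto
    show "fmor F a c (Comp Y a b c h k) =
       Comp X (fobj F a) (fobj F b) (fobj F c) (fmor F b c h) (fmor F a b k)"
      using xyz kh' by (simp add: abc F_def g G(4)[symmetric] inv X.comp_closed)
  qed (auto simp: F_def Y g)
  moreover have "bij_betw (fobj F) (Obj Y) (Obj X)"
    using bij_betw_inv_into[OF assms(3)] by (simp add: F_def g_def)
  moreover have "bij_betw (fmor F a b) (carrier (Hom Y a b)) (carrier (Hom X (fobj F a) (fobj F b)))"
    if "a \<in> Obj Y" "b \<in> Obj Y" for a b
    using that bij_betw_inv_into[OF bij] by (auto simp: Y F_def g)
  ultimately show ?thesis unfolding k_isomorphic_def by blast
qed

lemma k_equivalent_sym: "k_equivalent K X Y \<Longrightarrow> k_equivalent K Y X"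
  unfolding k_equivalent_def by blast

text \<open>The full subcategory of \<open>B\<close> on a family of objects in which repetitions are
  allowed: the indices become the objects. This permits both duplicating objects and choosing the
  type in which they live.\<close>

definition pull_cat :: "('o, 'm, 'k) kcat \<Rightarrow> ('i \<Rightarrow> 'o) \<Rightarrow> 'i set \<Rightarrow> ('i, 'm, 'k) kcat" where
  "pull_cat B b I = \<lparr>Obj = I, Hom = (\<lambda>i j. Hom B (b i) (b j)),
    Comp = (\<lambda>i j l. Comp B (b i) (b j) (b l)), Ident = (\<lambda>i. Ident B (b i))\<rparr>"

lemma pull_cat_simps [simp]:
  "Obj (pull_cat B b I) = I" "Hom (pull_cat B b I) i j = Hom B (b i) (b j)"
  "Comp (pull_cat B b I) i j l = Comp B (b i) (b j) (b l)" "Ident (pull_cat B b I) i = Ident B (b i)"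
  by (simp_all add: pull_cat_def)

lemma k_category_pull_cat:
  assumes "k_category K B" "b \<in> I \<rightarrow> Obj B"
  shows "k_category K (pull_cat B b I)"
proof -
  interpret B: k_category K B by fact
  have b: "i \<in> I \<Longrightarrow> b i \<in> Obj B" for i using assms(2) by auto
  show ?thesis
    by (intro k_category.intro k_category_axioms.intro B.field_axioms)
      (simp_all add: b B.ident_closed B.comp_ident_left B.comp_ident_right
        B.comp_linear_left B.comp_linear_right B.hom_space, simp add: b B.comp_assoc)
qed

text \<open>Indices, or objects of \<open>X\<close>, with the same value in \<open>B\<close> are
  isomorphic through the identity of that value. Hence a choice of an index for each object and of
  an object for each index gives functors in both directions, and the two composites are isomorphic
  to identities.\<close>

lemma k_equivalent_pull_cat:
  assumes X: "k_category K X" and B: "k_category K B" and ff: "fully_faithful K X B F"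
    and img: "b ` I = fobj F ` Obj X"
  shows "k_equivalent K X (pull_cat B b I)"
proof -
  interpret X: k_category K X by fact
  interpret B: k_category K B by fact
  note F = k_functorD[OF fully_faithfulD(1)[OF ff]]
  \<comment> \<open>\<open>s\<close> chooses an index and \<open>t\<close> an object of
    \<open>X\<close> with a prescribed value in \<open>B\<close>; the later \<open>r\<close> lifts
    morphisms of \<open>B\<close> along \<open>F\<close>.\<close>
  define s where "s = inv_into I b"
  define t where "t = inv_into (Obj X) (fobj F)"
  have s: "s (fobj F x) \<in> I" "b (s (fobj F x)) = fobj F x" if "x \<in> Obj X" for x
    using that img unfolding s_def by (auto intro!: inv_into_into f_inv_into_f)
  have t: "t (b i) \<in> Obj X" "fobj F (t (b i)) = b i" if "i \<in> I" for i
    using that img unfolding t_def by (auto intro!: inv_into_into f_inv_into_f)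
  have t': "t (fobj F x) \<in> Obj X" "fobj F (t (fobj F x)) = fobj F x" if "x \<in> Obj X" for x
    using that unfolding t_def by (auto intro!: inv_into_into f_inv_into_f)
  have bI: "b i \<in> Obj B" if "i \<in> I" for i using that t F(1) by metis
  have s': "s (b i) \<in> I" "b (s (b i)) = b i" if "i \<in> I" for i
    using s[OF t(1)[OF that]] t[OF that] by simp_all
  define r where "r x y = inv_into (carrier (Hom X x y)) (fmor F x y)" for x y
  have r: "r x y g \<in> carrier (Hom X x y)" "fmor F x y (r x y g) = g"
    if "x \<in> Obj X" "y \<in> Obj X" "g \<in> carrier (Hom B (fobj F x) (fobj F y))" for x y g
    using fully_faithfulD(2)[OF ff that(1,2)] that(3) unfolding r_def bij_betw_def
    by (auto intro!: inv_into_into f_inv_into_f)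
  have r_lin: "r x y \<in> linear_maps K (Hom B (fobj F x) (fobj F y)) (Hom X x y)"
    if "x \<in> Obj X" "y \<in> Obj X" for x y
    unfolding r_def by (intro linear_maps_inv_into F fully_faithfulD(2)[OF ff] X.hom_space that)
  note faithful = fully_faithfulD(3)[OF ff]
  define F' where "F' = \<lparr>fobj = \<lambda>x. s (fobj F x), fmor = fmor F\<rparr>"
  define G where "G = \<lparr>fobj = \<lambda>i. t (b i), fmor = \<lambda>i j. r (t (b i)) (t (b j))\<rparr>"
  let ?P = "pull_cat B b I"
  have "k_functor K X ?P F'"
    by (rule k_functorI) (simp_all add: F'_def s F)
  moreover have "k_functor K ?P X G"
  proof (rule k_functorI)
    fix i j assume "i \<in> Obj ?P" "j \<in> Obj ?P"
    then show "fmor G i j \<in> linear_maps K (Hom ?P i j) (Hom X (fobj G i) (fobj G j))"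
      using r_lin[of "t (b i)" "t (b j)"] by (simp add: G_def t)
  next
    fix i assume i: "i \<in> Obj ?P"
    then have "fmor F (t (b i)) (t (b i)) (r (t (b i)) (t (b i)) (Ident B (b i))) =
      fmor F (t (b i)) (t (b i)) (Ident X (t (b i)))"
      by (subst r) (auto simp: t F B.ident_closed bI)
    from faithful[OF this] i show "fmor G i i (Ident ?P i) = Ident X (fobj G i)"
      by (simp add: G_def t r X.ident_closed B.ident_closed bI)
  next
    fix i j l f g assume ijl: "i \<in> Obj ?P" "j \<in> Obj ?P" "l \<in> Obj ?P"
      and fg: "f \<in> carrier (Hom ?P i j)" "g \<in> carrier (Hom ?P j l)"
    have "Comp B (b i) (b j) (b l) g f \<in> carrier (Hom B (b i) (b l))"
      using fg ijl by (simp add: B.comp_closed bI)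
    with fg ijl have "fmor F (t (b i)) (t (b l)) (r (t (b i)) (t (b l)) (Comp B (b i) (b j) (b l) g f)) =
      fmor F (t (b i)) (t (b l)) (Comp X (t (b i)) (t (b j)) (t (b l)) (r (t (b j)) (t (b l)) g) (r (t (b i)) (t (b j)) f))"
      by (simp add: F(4) r t)
    from faithful[OF this] ijl fg
    show "fmor G i l (Comp ?P i j l g f) =
       Comp X (fobj G i) (fobj G j) (fobj G l) (fmor G j l g) (fmor G i j f)"
      by (simp add: G_def t r X.comp_closed B.comp_closed bI)
  qed (simp add: G_def t)
  moreover have "nat_isomorphic X X (comp_functor G F') id_functor"
    unfolding nat_isomorphic_def
  proof (intro bexI ballI)
    \<comment> \<open>The objects \<open>t (fobj F x)\<close> and \<open>x\<close> have the same
      image under \<open>F\<close>, so the identity of this image lifts to an isomorphism between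
      them. Equations are checked after applying \<open>F\<close>, which is faithful.\<close>
    let ?e = "\<lambda>x\<in>Obj X. r (t (fobj F x)) x (Ident B (fobj F x))"
    have id: "Ident B (fobj F x) \<in> carrier (Hom B (fobj F x) (fobj F x))" if "x \<in> Obj X" for x
      using that F(1) B.ident_closed by blast
    fix x assume x: "x \<in> Obj X"
    let ?x = "t (fobj F x)"
    have e: "r ?x x (Ident B (fobj F x)) \<in> carrier (Hom X ?x x)"
      "fmor F ?x x (r ?x x (Ident B (fobj F x))) = Ident B (fobj F x)"
      "r x ?x (Ident B (fobj F x)) \<in> carrier (Hom X x ?x)"
      "fmor F x ?x (r x ?x (Ident B (fobj F x))) = Ident B (fobj F x)"
      using x id by (simp_all add: r t')
    have "Comp X ?x x ?x (r x ?x (Ident B (fobj F x))) (r ?x x (Ident B (fobj F x))) = Ident X ?x"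
      using x e id by (intro faithful[of ?x ?x])
       (simp_all add: F t' X.comp_closed X.ident_closed B.comp_ident_left)
    moreover have "Comp X x ?x x (r ?x x (Ident B (fobj F x))) (r x ?x (Ident B (fobj F x))) = Ident X x"
      using x e id by (intro faithful[of x x])
       (simp_all add: F t' X.comp_closed X.ident_closed B.comp_ident_left)
    ultimately
    show "is_iso X (fobj (comp_functor G F') x) (fobj id_functor x) (?e x)"
      using x e by (auto simp: is_iso_def comp_functor_def id_functor_def G_def F'_def s)
  next
    let ?e = "\<lambda>x\<in>Obj X. r (t (fobj F x)) x (Ident B (fobj F x))"
    have id: "Ident B (fobj F x) \<in> carrier (Hom B (fobj F x) (fobj F x))" if "x \<in> Obj X" for x
      using that F(1) B.ident_closed by blast
    have e: "r (t (fobj F x)) x (Ident B (fobj F x)) \<in> carrier (Hom X (t (fobj F x)) x)"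
      "fmor F (t (fobj F x)) x (r (t (fobj F x)) x (Ident B (fobj F x))) = Ident B (fobj F x)"
      if "x \<in> Obj X" for x using that id by (simp_all add: r t')
    have "Comp X (t (fobj F x)) (t (fobj F y)) y (r (t (fobj F y)) y (Ident B (fobj F y)))
            (r (t (fobj F x)) (t (fobj F y)) (fmor F x y f)) =
          Comp X (t (fobj F x)) x y f (r (t (fobj F x)) x (Ident B (fobj F x)))"
      if "x \<in> Obj X" "y \<in> Obj X" "f \<in> carrier (Hom X x y)" for x y f
      using that e F(5)[OF that] by (intro faithful[of "t (fobj F x)" y])
       (simp_all add: F t' r X.comp_closed B.comp_ident_left B.comp_ident_right)
    then show "?e \<in> nat_transformations X X (comp_functor G F') id_functor"
      using e by (auto simp: nat_transformations_def comp_functor_def id_functor_def G_def F'_def s PiE_iff)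
  qed
  moreover have "nat_isomorphic ?P ?P (comp_functor F' G) id_functor"
    unfolding nat_isomorphic_def
  proof (intro bexI ballI)
    let ?e = "\<lambda>i\<in>I. Ident B (b i)"
    show "is_iso ?P (fobj (comp_functor F' G) i) (fobj id_functor i) (?e i)" if "i \<in> Obj ?P" for i
      using that by (auto simp: is_iso_def comp_functor_def id_functor_def G_def F'_def s t s' bI
          B.ident_closed B.comp_ident_left intro!: bexI[of _ "Ident B (b i)"])
    show "?e \<in> nat_transformations ?P ?P (comp_functor F' G) id_functor"
      by (auto simp: nat_transformations_def comp_functor_def id_functor_def G_def F'_def s t s' bI r
          B.ident_closed B.comp_ident_left B.comp_ident_right)
  qed
  ultimately show ?thesis unfolding k_equivalent_def by blast
qed

section \<open>Biproducts\<close>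

definition biproduct ::
  "('o, 'm, 'k) kcat \<Rightarrow> 'j set \<Rightarrow> ('j \<Rightarrow> 'o) \<Rightarrow> 'o \<Rightarrow> ('j \<Rightarrow> 'm) \<Rightarrow> ('j \<Rightarrow> 'm) \<Rightarrow> bool" where
  "biproduct C J t s i p \<longleftrightarrow> finite J \<and> s \<in> Obj C \<and>
    (\<forall>j\<in>J. t j \<in> Obj C \<and> i j \<in> carrier (Hom C (t j) s) \<and> p j \<in> carrier (Hom C s (t j))) \<and>
    (\<forall>j\<in>J. \<forall>l\<in>J. Comp C (t j) s (t l) (p l) (i j) =
      (if j = l then Ident C (t j) else \<zero>\<^bsub>Hom C (t j) (t l)\<^esub>)) \<and>
    (\<Oplus>\<^bsub>Hom C s s\<^esub>j\<in>J. Comp C s (t j) s (i j) (p j)) = Ident C s"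

lemma biproductD:
  assumes "biproduct C J t s i p"
  shows "finite J" "s \<in> Obj C"
    "\<And>j. j \<in> J \<Longrightarrow> t j \<in> Obj C" "\<And>j. j \<in> J \<Longrightarrow> i j \<in> carrier (Hom C (t j) s)"
    "\<And>j. j \<in> J \<Longrightarrow> p j \<in> carrier (Hom C s (t j))"
    "\<And>j. j \<in> J \<Longrightarrow> Comp C (t j) s (t j) (p j) (i j) = Ident C (t j)"
    "\<And>j l. j \<in> J \<Longrightarrow> l \<in> J \<Longrightarrow> j \<noteq> l \<Longrightarrow> Comp C (t j) s (t l) (p l) (i j) = \<zero>\<^bsub>Hom C (t j) (t l)\<^esub>"
    "(\<Oplus>\<^bsub>Hom C s s\<^esub>j\<in>J. Comp C s (t j) s (i j) (p j)) = Ident C s"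
  using assms unfolding biproduct_def by auto

context k_category
begin

text \<open>Needed to pass from the summands of a block to the codes of these summands.\<close>

lemma biproduct_reindex:
  assumes "biproduct C J t s i p" "inj_on h J"
    and "\<And>j. j \<in> J \<Longrightarrow> t' (h j) = t j" "\<And>j. j \<in> J \<Longrightarrow> i' (h j) = i j" "\<And>j. j \<in> J \<Longrightarrow> p' (h j) = p j"
  shows "biproduct C (h ` J) t' s i' p'"
proof -
  note bp = biproductD[OF assms(1)]
  have c: "Comp C s (t j) s (i j) (p j) \<in> carrier (Hom C s s)" if "j \<in> J" for j
    using that bp by (intro comp_closed)
  have "(\<Oplus>\<^bsub>Hom C s s\<^esub>j\<in>h ` J. Comp C s (t' j) s (i' j) (p' j))
      = (\<Oplus>\<^bsub>Hom C s s\<^esub>j\<in>J. Comp C s (t' (h j)) s (i' (h j)) (p' (h j)))"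
    using c assms by (intro abelian_monoid.finsum_reindex[OF hom_monoid[OF bp(2) bp(2)]]) auto
  also have "\<dots> = (\<Oplus>\<^bsub>Hom C s s\<^esub>j\<in>J. Comp C s (t j) s (i j) (p j))"
    using c assms by (intro abelian_monoid.finsum_cong'[OF hom_monoid[OF bp(2) bp(2)]]) auto
  also have "\<dots> = Ident C s" by (rule bp)
  finally have *: "(\<Oplus>\<^bsub>Hom C s s\<^esub>j\<in>h ` J. Comp C s (t' j) s (i' j) (p' j)) = Ident C s" .
  show ?thesis unfolding biproduct_def
    using * bp(1-7) assms(3-5) inj_on_eq_iff[OF assms(2)] by simp
qed

text \<open>Orthogonality leaves only the term \<open>j = l\<close> of the sum.\<close>

lemma biproduct_pair:
  assumes bp: "biproduct C J t s i p" and "z \<in> Obj C" "\<And>j. j \<in> J \<Longrightarrow> f j \<in> carrier (Hom C z (t j))" "l \<in> J"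
  shows "Comp C z s (t l) (p l) (\<Oplus>\<^bsub>Hom C z s\<^esub>j\<in>J. Comp C z (t j) s (i j) (f j)) = f l"
proof -
  note bp = biproductD[OF bp]
  have "Comp C z s (t l) (p l) (\<Oplus>\<^bsub>Hom C z s\<^esub>j\<in>J. Comp C z (t j) s (i j) (f j))
    = (\<Oplus>\<^bsub>Hom C z (t l)\<^esub>j\<in>J. Comp C z s (t l) (p l) (Comp C z (t j) s (i j) (f j)))"
    using assms(2-) bp by (intro comp_finsum_right) (auto intro: comp_closed)
  also have "\<dots> = (\<Oplus>\<^bsub>Hom C z (t l)\<^esub>j\<in>J. if l = j then f j else \<zero>\<^bsub>Hom C z (t l)\<^esub>)"
  proof (rule abelian_monoid.finsum_cong'[OF hom_monoid])
    fix j assume j: "j \<in> J"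
    have "Comp C z s (t l) (p l) (Comp C z (t j) s (i j) (f j))
      = Comp C z (t j) (t l) (Comp C (t j) s (t l) (p l) (i j)) (f j)"
      using j assms(2-) bp by (intro comp_assoc) auto
    also have "\<dots> = (if l = j then f j else \<zero>\<^bsub>Hom C z (t l)\<^esub>)"
      using j assms(2-) bp by (auto simp: comp_ident_left comp_zero_left)
    finally show "Comp C z s (t l) (p l) (Comp C z (t j) s (i j) (f j))
      = (if l = j then f j else \<zero>\<^bsub>Hom C z (t l)\<^esub>)" .
  qed (use assms bp in \<open>auto simp: zero_hom\<close>)
  also have "\<dots> = f l" using assms bp by (intro finsum_delta) auto
  finally show ?thesis .
qed

lemma biproduct_copair:
  assumes bp: "biproduct C J t s i p" and "z \<in> Obj C" "\<And>j. j \<in> J \<Longrightarrow> f j \<in> carrier (Hom C (t j) z)" "l \<in> J"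
  shows "Comp C (t l) s z (\<Oplus>\<^bsub>Hom C s z\<^esub>j\<in>J. Comp C s (t j) z (f j) (p j)) (i l) = f l"
proof -
  note bp = biproductD[OF bp]
  have "Comp C (t l) s z (\<Oplus>\<^bsub>Hom C s z\<^esub>j\<in>J. Comp C s (t j) z (f j) (p j)) (i l)
    = (\<Oplus>\<^bsub>Hom C (t l) z\<^esub>j\<in>J. Comp C (t l) s z (Comp C s (t j) z (f j) (p j)) (i l))"
    using assms(2-) bp by (intro comp_finsum_left) (auto intro: comp_closed)
  also have "\<dots> = (\<Oplus>\<^bsub>Hom C (t l) z\<^esub>j\<in>J. if l = j then f j else \<zero>\<^bsub>Hom C (t l) z\<^esub>)"
  proof (rule abelian_monoid.finsum_cong'[OF hom_monoid])
    fix j assume j: "j \<in> J"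
    have "Comp C (t l) s z (Comp C s (t j) z (f j) (p j)) (i l)
      = Comp C (t l) (t j) z (f j) (Comp C (t l) s (t j) (p j) (i l))"
      using j assms(2-) bp by (intro comp_assoc[symmetric]) auto
    also have "\<dots> = (if l = j then f j else \<zero>\<^bsub>Hom C (t l) z\<^esub>)"
      using j assms(2-) bp by (auto simp: comp_ident_right comp_zero_right)
    finally show "Comp C (t l) s z (Comp C s (t j) z (f j) (p j)) (i l)
      = (if l = j then f j else \<zero>\<^bsub>Hom C (t l) z\<^esub>)" .
  qed (use assms bp in \<open>auto simp: zero_hom\<close>)
  also have "\<dots> = f l" using assms bp by (intro finsum_delta) auto
  finally show ?thesis .
qed

text \<open>The identity of \<open>s\<close>, written as the sum of all \<open>i j\<close> after
  \<open>p j\<close>, is composed with \<open>f\<close>.\<close>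

lemma biproduct_expand_left:
  assumes bp: "biproduct C J t s i p" and "z \<in> Obj C" "f \<in> carrier (Hom C z s)"
  shows "f = (\<Oplus>\<^bsub>Hom C z s\<^esub>j\<in>J. Comp C z (t j) s (i j) (Comp C z s (t j) (p j) f))"
proof -
  note bp = biproductD[OF bp]
  have "f = Comp C z s s (Ident C s) f" using assms bp by (simp add: comp_ident_left)
  also have "\<dots> = (\<Oplus>\<^bsub>Hom C z s\<^esub>j\<in>J. Comp C z s s (Comp C s (t j) s (i j) (p j)) f)"
    unfolding bp(8)[symmetric] using assms bp by (intro comp_finsum_left) (auto intro: comp_closed)
  also have "\<dots> = (\<Oplus>\<^bsub>Hom C z s\<^esub>j\<in>J. Comp C z (t j) s (i j) (Comp C z s (t j) (p j) f))"
    using assms bp by (intro abelian_monoid.finsum_cong'[OF hom_monoid])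
      (auto simp: comp_assoc[symmetric] intro!: comp_closed)
  finally show ?thesis .
qed

lemma biproduct_expand_right:
  assumes bp: "biproduct C J t s i p" and "z \<in> Obj C" "f \<in> carrier (Hom C s z)"
  shows "f = (\<Oplus>\<^bsub>Hom C s z\<^esub>j\<in>J. Comp C s (t j) z (Comp C (t j) s z f (i j)) (p j))"
proof -
  note bp = biproductD[OF bp]
  have "f = Comp C s s z f (Ident C s)" using assms bp by (simp add: comp_ident_right)
  also have "\<dots> = (\<Oplus>\<^bsub>Hom C s z\<^esub>j\<in>J. Comp C s s z f (Comp C s (t j) s (i j) (p j)))"
    unfolding bp(8)[symmetric] using assms bp by (intro comp_finsum_right) (auto intro: comp_closed)
  also have "\<dots> = (\<Oplus>\<^bsub>Hom C s z\<^esub>j\<in>J. Comp C s (t j) z (Comp C (t j) s z f (i j)) (p j))"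
    using assms bp by (intro abelian_monoid.finsum_cong'[OF hom_monoid])
      (auto simp: comp_assoc intro!: comp_closed)
  finally show ?thesis .
qed

lemma biproduct_thru:
  assumes bp: "biproduct C J t s i p" and "t ` J \<subseteq> T" "T \<subseteq> Obj C"
  shows "Ident C s \<in> thru C T s s"
proof -
  note bp = biproductD[OF bp]
  have "(\<Oplus>\<^bsub>Hom C s s\<^esub>j\<in>A. Comp C s (t j) s (i j) (p j)) \<in> thru C T s s" if "finite A" "A \<subseteq> J" for A
    using that
  proof (induction A rule: finite_induct)
    case empty
    show ?case
      by (subst abelian_monoid.finsum_empty[OF hom_monoid[OF bp(2) bp(2)]]) (rule thru.zero)
  next
    case (insert a A)
    have "(\<Oplus>\<^bsub>Hom C s s\<^esub>j\<in>insert a A. Comp C s (t j) s (i j) (p j))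
      = Comp C s (t a) s (i a) (p a) \<oplus>\<^bsub>Hom C s s\<^esub> (\<Oplus>\<^bsub>Hom C s s\<^esub>j\<in>A. Comp C s (t j) s (i j) (p j))"
      using insert bp by (intro abelian_monoid.finsum_insert[OF hom_monoid]) (auto intro!: comp_closed)
    moreover have "Comp C s (t a) s (i a) (p a) \<in> thru C T s s"
      using insert bp assms by (intro thru_single) auto
    ultimately show ?case using insert assms bp(2) thru_add by auto
  qed
  from this[OF bp(1)] bp(8) show ?thesis by simp
qed

text \<open>Composing with \<open>p j\<close> turns the idempotent of \<open>j\<close> into
  \<open>p j\<close> and that of \<open>l\<close> into zero, so equality forces \<open>p j\<close>
  to vanish. This matters for expansions, where coinciding idempotents would give one object instead
  of two.\<close>

lemma biproduct_idempotents_distinct: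
  assumes bp: "biproduct C J t s i p" and "j \<in> J" "l \<in> J" "j \<noteq> l"
    and eq: "Comp C s (t j) s (i j) (p j) = Comp C s (t l) s (i l) (p l)"
  shows "Ident C (t j) = \<zero>\<^bsub>Hom C (t j) (t j)\<^esub>"
proof -
  note bp = biproductD[OF bp]
  have *: "Comp C s s (t j) (p j) (Comp C s (t l) s (i l) (p l)) = Comp C s (t l) (t j) (Comp C (t l) s (t j) (p j) (i l)) (p l)"
     if "l \<in> J" for l
    using that bp assms by (intro comp_assoc) auto
  have "p j = \<zero>\<^bsub>Hom C s (t j)\<^esub>"
    using *[OF assms(2)] *[OF assms(3)] eq bp assms(2-4) by (auto simp: comp_ident_left comp_zero_left)
  moreover have "Comp C (t j) s (t j) \<zero>\<^bsub>Hom C s (t j)\<^esub> (i j) = \<zero>\<^bsub>Hom C (t j) (t j)\<^esub>"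
    using bp assms(2) by (intro comp_zero_left) auto
  ultimately show ?thesis using bp(6)[OF assms(2)] by simp
qed

text \<open>Biproducts are given by linear equations between finitely many morphisms, and linear
  functors preserve these.\<close>

lemma biproduct_functor:
  assumes bp: "biproduct C J t s i p" and F: "k_functor K C D F" and D: "k_category K D"
  shows "biproduct D J (\<lambda>j. fobj F (t j)) (fobj F s) (\<lambda>j. fmor F (t j) s (i j)) (\<lambda>j. fmor F s (t j) (p j))"
proof -
  note bp = biproductD[OF bp]
  note F = k_functorD[OF F]
  interpret D: k_category K D by fact
  have z: "fmor F x y \<zero>\<^bsub>Hom C x y\<^esub> = \<zero>\<^bsub>Hom D (fobj F x) (fobj F y)\<^esub>" if "x \<in> Obj C" "y \<in> Obj C" for x y
    using that F by (intro linear_maps_zero[OF F(2)] hom_space D.hom_space) auto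
  have "(\<Oplus>\<^bsub>Hom D (fobj F s) (fobj F s)\<^esub>j\<in>J. Comp D (fobj F s) (fobj F (t j)) (fobj F s) (fmor F (t j) s (i j)) (fmor F s (t j) (p j)))
    = (\<Oplus>\<^bsub>Hom D (fobj F s) (fobj F s)\<^esub>j\<in>J. fmor F s s (Comp C s (t j) s (i j) (p j)))"
    using bp F by (intro abelian_monoid.finsum_cong'[OF D.hom_monoid])
      (auto simp: comp_closed intro!: D.comp_closed)
  also have "\<dots> = fmor F s s (\<Oplus>\<^bsub>Hom C s s\<^esub>j\<in>J. Comp C s (t j) s (i j) (p j))"
    using bp F by (intro linear_maps_finsum[OF F(2), symmetric] hom_space D.hom_space) (auto intro!: comp_closed)
  also have "\<dots> = Ident D (fobj F s)" using bp F by simp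
  finally show ?thesis
    unfolding biproduct_def using bp F(1,3,5) z by (auto simp: F(4)[symmetric])
qed

end

section \<open>Contractions and expansions from biproducts\<close>

text \<open>A morphism between biproducts amounts to the matrix of its components, and composition
  becomes the matrix product. The map \<open>blk\<close> tells in which block a summand is
  merged.\<close>

lemma is_contraction_biproducts:
  fixes b :: "'i \<Rightarrow> 'o"
  assumes B: "k_category K B" and blk: "blk \<in> J \<rightarrow> I" and b: "b \<in> I \<rightarrow> Obj B"
    and bp: "\<And>x. x \<in> I \<Longrightarrow> biproduct B {j \<in> J. blk j = x} t (b x) i p"
  shows "is_contraction K (pull_cat B t J) (pull_cat B b I)"
proof -
  interpret B: k_category K B by fact
  define E where "E x = {j \<in> J. blk j = x}" for x
  note bp = bp[folded E_def]
  note bpD = biproductD[OF bp]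
  have part: "finite_partition J I E"
    unfolding finite_partition_def using blk bpD(1) by (auto simp: E_def disjoint_family_on_def)
  let ?X = "pull_cat B b I" and ?Y = "contraction (pull_cat B t J) I E"
  have X: "k_category K ?X" using B b by (rule k_category_pull_cat)
  \<comment> \<open>The functor goes from the merged family to the contraction, where the entry at
    \<open>(m, l)\<close> has a closed formula: \<open>p m\<close> after \<open>h\<close> after
    \<open>i l\<close>.\<close>
  define G where "G = \<lparr>fobj = \<lambda>x :: 'i. x, fmor = \<lambda>x y h. \<lambda>(m, l)\<in>E y \<times> E x.
     Comp B (t l) (b y) (t m) (p m) (Comp B (t l) (b x) (b y) h (i l))\<rparr>"
  have Gc: "Comp B (t l) (b y) (t m) (p m) (Comp B (t l) (b x) (b y) h (i l)) \<in> carrier (Hom B (t l) (t m))"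
    if "x \<in> I" "y \<in> I" "h \<in> carrier (Hom B (b x) (b y))" "m \<in> E y" "l \<in> E x" for x y h m l
    using that bpD by (auto intro!: B.comp_closed)
  have "k_functor K ?X ?Y G"
  proof (rule k_functorI)
    fix x assume "x \<in> Obj ?X"
    then show "fobj G x \<in> Obj ?Y" by (simp add: G_def contraction_def)
  next
    fix x y assume xy: "x \<in> Obj ?X" "y \<in> Obj ?X"
    show "fmor G x y \<in> linear_maps K (Hom ?X x y) (Hom ?Y (fobj G x) (fobj G y))"
      using xy
      by (intro linear_mapsI)
        (auto simp: G_def contraction_def prod_space_simps PiE_iff Gc fun_eq_iff bpD B.comp_closed
          B.comp_add_left B.comp_add_right B.comp_smult_left B.comp_smult_right)
  next
    fix x assume x: "x \<in> Obj ?X"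
    show "fmor G x x (Ident ?X x) = Ident ?Y (fobj G x)"
      using x by (auto simp: G_def contraction_def fun_eq_iff bpD B.comp_ident_left)
  next
    fix x y z f g assume xyz: "x \<in> Obj ?X" "y \<in> Obj ?X" "z \<in> Obj ?X"
      and fg: "f \<in> carrier (Hom ?X x y)" "g \<in> carrier (Hom ?X y z)"
    have "Comp B (t l) (b z) (t m) (p m) (Comp B (t l) (b x) (b z) (Comp B (b x) (b y) (b z) g f) (i l)) =
      (\<Oplus>\<^bsub>Hom B (t l) (t m)\<^esub>j\<in>E y. Comp B (t l) (t j) (t m)
        (Comp B (t j) (b z) (t m) (p m) (Comp B (t j) (b y) (b z) g (i j)))
        (Comp B (t l) (b y) (t j) (p j) (Comp B (t l) (b x) (b y) f (i l))))"
      if lm: "l \<in> E x" "m \<in> E z" for l m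
    proof -
      let ?f = "Comp B (t l) (b x) (b y) f (i l)"
      let ?g = "Comp B (b y) (b z) (t m) (p m) g"
      have f: "?f \<in> carrier (Hom B (t l) (b y))" and g: "?g \<in> carrier (Hom B (b y) (t m))"
        using xyz fg lm bpD by (auto intro!: B.comp_closed)
      have "Comp B (t l) (b z) (t m) (p m) (Comp B (t l) (b x) (b z) (Comp B (b x) (b y) (b z) g f) (i l)) =
        Comp B (t l) (b y) (t m) ?g ?f"
        using xyz fg lm bpD by (simp add: B.comp_assoc B.comp_closed)
      \<comment> \<open>Between \<open>g\<close> and \<open>f\<close> the identity of the middle
        object \<open>b y\<close> is inserted as a sum over its block; this is the sum occurring in
        the matrix product.\<close>
      also have "\<dots> = Comp B (t l) (b y) (t m) ?g (\<Oplus>\<^bsub>Hom B (t l) (b y)\<^esub>j\<in>E y. Comp B (t l) (t j) (b y) (i j) (Comp B (t l) (b y) (t j) (p j) ?f))"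
        using B.biproduct_expand_left[OF bp[of y] _ f] xyz lm bpD by simp
      also have "\<dots> = (\<Oplus>\<^bsub>Hom B (t l) (t m)\<^esub>j\<in>E y. Comp B (t l) (b y) (t m) ?g (Comp B (t l) (t j) (b y) (i j) (Comp B (t l) (b y) (t j) (p j) ?f)))"
        using xyz lm bpD f g by (intro B.comp_finsum_right) (auto intro!: B.comp_closed)
      also have "\<dots> = (\<Oplus>\<^bsub>Hom B (t l) (t m)\<^esub>j\<in>E y. Comp B (t l) (t j) (t m)
        (Comp B (t j) (b z) (t m) (p m) (Comp B (t j) (b y) (b z) g (i j)))
        (Comp B (t l) (b y) (t j) (p j) (Comp B (t l) (b x) (b y) f (i l))))"
        using xyz lm bpD f g fg
        by (intro abelian_monoid.finsum_cong'[OF B.hom_monoid])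
          (auto simp: B.comp_assoc B.comp_closed intro!: B.comp_closed)
      finally show ?thesis .
    qed
    then have "fmor G x z (Comp ?X x y z g f) = (\<lambda>(m, l)\<in>E z \<times> E x.
      (\<Oplus>\<^bsub>Hom B (t l) (t m)\<^esub>j\<in>E y. Comp B (t l) (t j) (t m)
        (Comp B (t j) (b z) (t m) (p m) (Comp B (t j) (b y) (b z) g (i j)))
        (Comp B (t l) (b y) (t j) (p j) (Comp B (t l) (b x) (b y) f (i l)))))"
      by (simp add: G_def restrict_def fun_eq_iff)
    also have "\<dots> = Comp ?Y (fobj G x) (fobj G y) (fobj G z) (fmor G y z g) (fmor G x y f)"
    proof -
      have "(\<Oplus>\<^bsub>Hom B (t l) (t m)\<^esub>j\<in>E y. Comp B (t l) (t j) (t m) (fmor G y z g (m, j)) (fmor G x y f (j, l))) =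
       (\<Oplus>\<^bsub>Hom B (t l) (t m)\<^esub>j\<in>E y. Comp B (t l) (t j) (t m)
        (Comp B (t j) (b z) (t m) (p m) (Comp B (t j) (b y) (b z) g (i j)))
        (Comp B (t l) (b y) (t j) (p j) (Comp B (t l) (b x) (b y) f (i l))))"
        if "l \<in> E x" "m \<in> E z" for l m
        using that xyz fg bpD
        by (intro abelian_monoid.finsum_cong'[OF B.hom_monoid]) (auto simp: G_def intro!: B.comp_closed)
      then show ?thesis by (auto simp: contraction_def restrict_def fun_eq_iff G_def)
    qed
    finally show "fmor G x z (Comp ?X x y z g f) =
       Comp ?Y (fobj G x) (fobj G y) (fobj G z) (fmor G y z g) (fmor G x y f)" .
  qed
  moreover have "bij_betw (fmor G x y) (carrier (Hom ?X x y)) (carrier (Hom ?Y (fobj G x) (fobj G y)))"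
    if xy: "x \<in> I" "y \<in> I" for x y
  proof (rule bij_betw_imageI)
    have Y: "carrier (Hom ?Y (fobj G x) (fobj G y)) = (\<Pi>\<^sub>E (m, l)\<in>E y \<times> E x. carrier (Hom B (t l) (t m)))"
      by (simp add: contraction_def prod_space_simps G_def) (rule PiE_cong, auto)
    show "inj_on (fmor G x y) (carrier (Hom ?X x y))"
    proof (rule inj_onI)
      fix h h' assume h: "h \<in> carrier (Hom ?X x y)" "h' \<in> carrier (Hom ?X x y)"
        and eq: "fmor G x y h = fmor G x y h'"
      have ph: "Comp B (b x) (b y) (t m) (p m) h \<in> carrier (Hom B (b x) (t m))"
          "Comp B (b x) (b y) (t m) (p m) h' \<in> carrier (Hom B (b x) (t m))" if "m \<in> E y" for m
        using that h xy bpD by (auto intro!: B.comp_closed)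
      have c: "Comp B (t l) (b x) (t m) (Comp B (b x) (b y) (t m) (p m) h) (i l) =
        Comp B (t l) (b x) (t m) (Comp B (b x) (b y) (t m) (p m) h') (i l)" if "m \<in> E y" "l \<in> E x" for m l
        using that h xy bpD fun_cong[OF eq, of "(m, l)"] by (simp add: G_def B.comp_assoc)
      \<comment> \<open>\<open>h\<close> is recovered from its matrix in two stages: each row
        \<open>p m\<close> after \<open>h\<close> from its entries over the source block, then
        \<open>h\<close> from its rows.\<close>
      have m: "Comp B (b x) (b y) (t m) (p m) h = Comp B (b x) (b y) (t m) (p m) h'" if "m \<in> E y" for m
      proof -
        have "Comp B (b x) (b y) (t m) (p m) h = (\<Oplus>\<^bsub>Hom B (b x) (t m)\<^esub>l\<in>E x. Comp B (b x) (t l) (t m)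
          (Comp B (t l) (b x) (t m) (Comp B (b x) (b y) (t m) (p m) h) (i l)) (p l))"
          using that xy ph bpD by (intro B.biproduct_expand_right[OF bp]) auto
        also have "\<dots> = (\<Oplus>\<^bsub>Hom B (b x) (t m)\<^esub>l\<in>E x. Comp B (b x) (t l) (t m)
          (Comp B (t l) (b x) (t m) (Comp B (b x) (b y) (t m) (p m) h') (i l)) (p l))"
          using that xy h ph bpD
          by (intro abelian_monoid.finsum_cong'[OF B.hom_monoid]) (auto simp: c intro!: B.comp_closed)
        also have "\<dots> = Comp B (b x) (b y) (t m) (p m) h'"
          using that xy ph bpD by (intro B.biproduct_expand_right[OF bp, symmetric]) auto
        finally show ?thesis .
      qed
      have "h = (\<Oplus>\<^bsub>Hom B (b x) (b y)\<^esub>m\<in>E y. Comp B (b x) (t m) (b y) (i m) (Comp B (b x) (b y) (t m) (p m) h))"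
        using xy h bpD by (intro B.biproduct_expand_left[OF bp]) auto
      also have "\<dots> = (\<Oplus>\<^bsub>Hom B (b x) (b y)\<^esub>m\<in>E y. Comp B (b x) (t m) (b y) (i m) (Comp B (b x) (b y) (t m) (p m) h'))"
        using xy h bpD
        by (intro abelian_monoid.finsum_cong'[OF B.hom_monoid]) (auto simp: m intro!: B.comp_closed)
      also have "\<dots> = h'"
        using xy h bpD by (intro B.biproduct_expand_left[OF bp, symmetric]) auto
      finally show "h = h'" .
    qed
    show "fmor G x y ` carrier (Hom ?X x y) = carrier (Hom ?Y (fobj G x) (fobj G y))"
    proof (intro equalityI subsetI)
      fix g assume "g \<in> fmor G x y ` carrier (Hom ?X x y)"
      then show "g \<in> carrier (Hom ?Y (fobj G x) (fobj G y))"
        unfolding Y using Gc xy by (auto simp: G_def split: if_splits)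
    next
      fix g assume "g \<in> carrier (Hom ?Y (fobj G x) (fobj G y))"
      then have gY: "g \<in> (\<Pi>\<^sub>E (m, l)\<in>E y \<times> E x. carrier (Hom B (t l) (t m)))" unfolding Y .
      then have ext: "g \<in> extensional (E y \<times> E x)" by (auto simp: PiE_iff)
      have g: "g (m, l) \<in> carrier (Hom B (t l) (t m))" if "m \<in> E y" "l \<in> E x" for m l
        using PiE_mem[OF gY, of "(m, l)"] that by auto
      \<comment> \<open>The same two stages build a preimage of the matrix \<open>g\<close>: the
        entries are assembled to rows \<open>r m\<close>, the rows to \<open>h\<close>.\<close>
      define r where "r m = (\<Oplus>\<^bsub>Hom B (b x) (t m)\<^esub>l\<in>E x. Comp B (b x) (t l) (t m) (g (m, l)) (p l))" for m
      define h where "h = (\<Oplus>\<^bsub>Hom B (b x) (b y)\<^esub>m\<in>E y. Comp B (b x) (t m) (b y) (i m) (r m))"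
      have r: "r m \<in> carrier (Hom B (b x) (t m))" if "m \<in> E y" for m
        unfolding r_def using that xy g bpD by (intro B.finsum_hom) (auto intro!: B.comp_closed)
      have h: "h \<in> carrier (Hom B (b x) (b y))"
        unfolding h_def using xy r bpD by (intro B.finsum_hom) (auto intro!: B.comp_closed)
      have "Comp B (t l) (b y) (t m) (p m) (Comp B (t l) (b x) (b y) h (i l)) = g (m, l)"
        if lm: "m \<in> E y" "l \<in> E x" for l m
      proof -
        have "Comp B (t l) (b y) (t m) (p m) (Comp B (t l) (b x) (b y) h (i l)) =
          Comp B (t l) (b x) (t m) (Comp B (b x) (b y) (t m) (p m) h) (i l)"
          using lm xy h bpD by (intro B.comp_assoc) auto
        also have "Comp B (b x) (b y) (t m) (p m) h = r m"
          unfolding h_def using lm xy r bpD by (intro B.biproduct_pair[OF bp]) auto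
        also have "Comp B (t l) (b x) (t m) (r m) (i l) = g (m, l)"
          unfolding r_def using lm xy g bpD by (intro B.biproduct_copair[OF bp]) auto
        finally show ?thesis .
      qed
      then have "fmor G x y h = g"
        using ext by (auto simp: G_def fun_eq_iff extensional_def)
      then show "g \<in> fmor G x y ` carrier (Hom ?X x y)" using h by force
    qed
  qed
  ultimately have "fully_faithful K ?X ?Y G" unfolding fully_faithful_def by simp
  moreover have "bij_betw (fobj G) (Obj ?X) (Obj ?Y)" by (simp add: G_def contraction_def bij_betw_def)
  ultimately have "k_isomorphic K ?Y ?X" using k_isomorphic_sym[OF X] by blast
  then show ?thesis unfolding is_contraction_def using part by auto
qed

text \<open>The diagonal idempotents of \<open>b x\<close> form a complete system, and the corner
  between two of them is a copy of the space of morphisms between the corresponding summands.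
  Injectivity on each block keeps different summands from becoming the same object of the
  expansion.\<close>

lemma is_expansion_biproducts:
  fixes b :: "'i \<Rightarrow> 'o" and t :: "'j \<Rightarrow> 'o"
  assumes B: "k_category K B" and blk: "blk \<in> J \<rightarrow> I" and b: "b \<in> I \<rightarrow> Obj B"
    and bp: "\<And>x. x \<in> I \<Longrightarrow> biproduct B {j \<in> J. blk j = x} t (b x) i p"
    and inj: "\<And>x. x \<in> I \<Longrightarrow> inj_on (\<lambda>j. Comp B (b x) (t j) (b x) (i j) (p j)) {j \<in> J. blk j = x}"
  shows "is_expansion K (pull_cat B b I) (pull_cat B t J)"
proof -
  interpret B: k_category K B by fact
  define e where "e j = Comp B (b (blk j)) (t j) (b (blk j)) (i j) (p j)" for j
  define E where "E x = {j \<in> J. blk j = x}" for x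
  define F where "F x = e ` E x" for x
  note bp = bp[folded E_def]
  note bpD = biproductD[OF bp]
  have blkE: "blk j = x" if "j \<in> E x" for j x using that by (simp add: E_def)
  have JE: "blk j \<in> I" "j \<in> E (blk j)" if "j \<in> J" for j using that blk by (auto simp: E_def)
  have inj: "inj_on e (E x)" if "x \<in> I" for x
    using inj[OF that] unfolding E_def e_def inj_on_def by auto
  have tJ: "t j \<in> Obj B" "b (blk j) \<in> Obj B" "i j \<in> carrier (Hom B (t j) (b (blk j)))"
    "p j \<in> carrier (Hom B (b (blk j)) (t j))"
    "Comp B (t j) (b (blk j)) (t j) (p j) (i j) = Ident B (t j)" if "j \<in> J" for j
    using JE[OF that] bpD by auto
  have ec: "e j \<in> carrier (Hom B (b x) (b x))" if "x \<in> I" "j \<in> E x" for x j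
    unfolding e_def blkE[OF that(2)] using that bpD by (intro B.comp_closed) auto
  have ee: "Comp B (b x) (b x) (b x) (e j) (e l) =
     (if j = l then e j else \<zero>\<^bsub>Hom B (b x) (b x)\<^esub>)" if x: "x \<in> I" and jl: "j \<in> E x" "l \<in> E x" for x j l
  proof -
    have "Comp B (b x) (b x) (b x) (e j) (e l) =
      Comp B (b x) (t j) (b x) (i j) (Comp B (b x) (b x) (t j) (p j) (Comp B (b x) (t l) (b x) (i l) (p l)))"
      unfolding e_def blkE[OF jl(1)] blkE[OF jl(2)]
      using x jl bpD by (intro B.comp_assoc[symmetric] B.comp_closed) auto
    also have "Comp B (b x) (b x) (t j) (p j) (Comp B (b x) (t l) (b x) (i l) (p l)) =
      Comp B (b x) (t l) (t j) (Comp B (t l) (b x) (t j) (p j) (i l)) (p l)"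
      using x jl bpD by (intro B.comp_assoc) auto
    finally show ?thesis
      using x jl bpD by (auto simp: e_def blkE B.comp_ident_left B.comp_zero_left B.comp_zero_right)
  qed
  let ?X = "pull_cat B b I" and ?Z = "pull_cat B t J"
  let ?Y = "expansion ?X F"
  have "complete_orthogonal_idempotents ?X x (F x)" if x: "x \<in> I" for x
  proof -
    have "(\<Oplus>\<^bsub>Hom B (b x) (b x)\<^esub>c\<in>F x. c) = (\<Oplus>\<^bsub>Hom B (b x) (b x)\<^esub>j\<in>E x. e j)"
      unfolding F_def using x ec bpD inj
      by (intro abelian_monoid.finsum_reindex[OF B.hom_monoid]) auto
    also have "\<dots> = (\<Oplus>\<^bsub>Hom B (b x) (b x)\<^esub>j\<in>E x. Comp B (b x) (t j) (b x) (i j) (p j))"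
      using x bpD by (intro abelian_monoid.finsum_cong'[OF B.hom_monoid])
        (auto simp: e_def blkE intro!: B.comp_closed)
    also have "\<dots> = Ident B (b x)" using x bpD by simp
    finally show ?thesis
      unfolding complete_orthogonal_idempotents_def using x ec ee bpD(1)
      by (auto simp: F_def)
  qed
  moreover have "k_isomorphic K ?Y ?Z"
  proof (rule k_isomorphic_sym)
    have tO: "t \<in> J \<rightarrow> Obj B" using tJ by auto
    show "k_category K ?Z" by (rule k_category_pull_cat[OF B tO])
    \<comment> \<open>The summand \<open>j\<close> goes to its idempotent on the object of its
      block, and a morphism \<open>f\<close> to the corner element \<open>i l\<close> after
      \<open>f\<close> after \<open>p j\<close>.\<close>
    define G where "G = \<lparr>fobj = \<lambda>j. (blk j, e j), fmor = \<lambda>j l f.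
      Comp B (b (blk j)) (t l) (b (blk l)) (i l) (Comp B (b (blk j)) (t j) (t l) f (p j))\<rparr>"
    have Gc: "fmor G j l f \<in> carrier (Hom B (b (blk j)) (b (blk l)))"
      if "j \<in> J" "l \<in> J" "f \<in> carrier (Hom B (t j) (t l))" for j l f
      unfolding G_def using that tJ by (auto intro!: B.comp_closed)
    have Ge: "Comp B (b (blk j)) (b (blk l)) (b (blk l)) (e l)
       (Comp B (b (blk j)) (b (blk j)) (b (blk l)) (fmor G j l f) (e j)) = fmor G j l f"
      if jl: "j \<in> J" "l \<in> J" "f \<in> carrier (Hom B (t j) (t l))" for j l f
    proof -
      have c: "Comp B (b (blk j)) (t j) (t l) f (p j) \<in> carrier (Hom B (b (blk j)) (t l))"
        using jl tJ by (auto intro!: B.comp_closed)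
      have "Comp B (b (blk j)) (b (blk j)) (b (blk l)) (fmor G j l f) (e j)
        = Comp B (b (blk j)) (t l) (b (blk l)) (i l)
          (Comp B (b (blk j)) (b (blk j)) (t l) (Comp B (b (blk j)) (t j) (t l) f (p j)) (e j))"
        unfolding G_def kfunctor.simps using jl tJ c JE ec by (intro B.comp_assoc[symmetric]) auto
      also have "Comp B (b (blk j)) (b (blk j)) (t l) (Comp B (b (blk j)) (t j) (t l) f (p j)) (e j)
        = Comp B (b (blk j)) (t j) (t l) f (Comp B (b (blk j)) (b (blk j)) (t j) (p j) (e j))"
        using jl tJ c JE ec by (intro B.comp_assoc[symmetric]) auto
      also have "Comp B (b (blk j)) (b (blk j)) (t j) (p j) (e j)
        = Comp B (b (blk j)) (t j) (t j) (Comp B (t j) (b (blk j)) (t j) (p j) (i j)) (p j)"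
        unfolding e_def using jl tJ by (intro B.comp_assoc) auto
      also have "\<dots> = p j" using jl tJ by (simp add: B.comp_ident_left)
      finally have 1: "Comp B (b (blk j)) (b (blk j)) (b (blk l)) (fmor G j l f) (e j) = fmor G j l f"
        by (simp add: G_def)
      have "Comp B (b (blk j)) (b (blk l)) (b (blk l)) (e l) (fmor G j l f)
        = Comp B (b (blk j)) (t l) (b (blk l)) (i l) (Comp B (b (blk j)) (b (blk l)) (t l) (p l) (fmor G j l f))"
        unfolding e_def using jl tJ Gc by (intro B.comp_assoc[symmetric]) auto
      also have "Comp B (b (blk j)) (b (blk l)) (t l) (p l) (fmor G j l f)
        = Comp B (b (blk j)) (t l) (t l) (Comp B (t l) (b (blk l)) (t l) (p l) (i l)) (Comp B (b (blk j)) (t j) (t l) f (p j))"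
        unfolding G_def kfunctor.simps using jl tJ c by (intro B.comp_assoc) auto
      also have "\<dots> = Comp B (b (blk j)) (t j) (t l) f (p j)"
        using jl tJ c by (simp add: B.comp_ident_left)
      finally have 2: "Comp B (b (blk j)) (b (blk l)) (b (blk l)) (e l) (fmor G j l f) = fmor G j l f"
        by (simp add: G_def)
      show ?thesis using 1 2 by simp
    qed
    \<comment> \<open>Sandwiching between \<open>p l\<close> and \<open>i j\<close> undoes
      \<open>fmor G\<close>; injectivity on morphisms follows.\<close>
    have retr: "Comp B (t j) (b (blk l)) (t l) (p l) (Comp B (t j) (b (blk j)) (b (blk l)) (fmor G j l f) (i j)) = f"
      if jl: "j \<in> J" "l \<in> J" "f \<in> carrier (Hom B (t j) (t l))" for j l f
    proof -
      have c: "Comp B (b (blk j)) (t j) (t l) f (p j) \<in> carrier (Hom B (b (blk j)) (t l))"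
        using jl tJ by (auto intro!: B.comp_closed)
      have "Comp B (t j) (b (blk j)) (b (blk l)) (fmor G j l f) (i j) =
        Comp B (t j) (t l) (b (blk l)) (i l) (Comp B (t j) (b (blk j)) (t l) (Comp B (b (blk j)) (t j) (t l) f (p j)) (i j))"
        unfolding G_def kfunctor.simps using jl tJ c by (intro B.comp_assoc[symmetric]) auto
      also have "Comp B (t j) (b (blk j)) (t l) (Comp B (b (blk j)) (t j) (t l) f (p j)) (i j)
        = Comp B (t j) (t j) (t l) f (Comp B (t j) (b (blk j)) (t j) (p j) (i j))"
        using jl tJ by (intro B.comp_assoc[symmetric]) auto
      also have "\<dots> = f" using jl tJ by (simp add: B.comp_ident_right)
      finally have "Comp B (t j) (b (blk l)) (t l) (p l) (Comp B (t j) (b (blk j)) (b (blk l)) (fmor G j l f) (i j))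
        = Comp B (t j) (b (blk l)) (t l) (p l) (Comp B (t j) (t l) (b (blk l)) (i l) f)" by simp
      also have "\<dots> = Comp B (t j) (t l) (t l) (Comp B (t l) (b (blk l)) (t l) (p l) (i l)) f"
        using jl tJ by (intro B.comp_assoc) auto
      also have "\<dots> = f" using jl tJ by (simp add: B.comp_ident_left)
      finally show ?thesis .
    qed
    have carrier_Y: "carrier (Hom ?Y (fobj G j) (fobj G l)) =
      (\<lambda>h. Comp B (b (blk j)) (b (blk l)) (b (blk l)) (e l) (Comp B (b (blk j)) (b (blk j)) (b (blk l)) h (e j)))
        ` carrier (Hom B (b (blk j)) (b (blk l)))" for j l
      by (simp add: expansion_def G_def)
    have GY: "fmor G j l f \<in> carrier (Hom ?Y (fobj G j) (fobj G l))"
      if "j \<in> J" "l \<in> J" "f \<in> carrier (Hom B (t j) (t l))" for j l f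
      unfolding carrier_Y using Ge[OF that] Gc[OF that] by (metis image_eqI)
    have "k_functor K ?Z ?Y G"
    proof (rule k_functorI)
      fix j assume "j \<in> Obj ?Z"
      then show "fobj G j \<in> Obj ?Y" using JE by (auto simp: G_def expansion_def F_def)
    next
      fix j l assume jl: "j \<in> Obj ?Z" "l \<in> Obj ?Z"
      have lin: "fmor G j l \<in> linear_maps K (Hom B (t j) (t l)) (Hom B (b (blk j)) (b (blk l)))"
        using jl tJ by (intro linear_mapsI)
          (auto simp: G_def B.comp_add_left B.comp_add_right B.comp_smult_left B.comp_smult_right B.comp_closed)
      show "fmor G j l \<in> linear_maps K (Hom ?Z j l) (Hom ?Y (fobj G j) (fobj G l))"
        using jl GY linear_mapsD[OF lin] by (intro linear_mapsI) (auto simp: expansion_def G_def)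
    next
      fix j assume j: "j \<in> Obj ?Z"
      then show "fmor G j j (Ident ?Z j) = Ident ?Y (fobj G j)"
        using tJ by (simp add: G_def expansion_def e_def B.comp_ident_left)
    next
      fix j l m f g assume jlm: "j \<in> Obj ?Z" "l \<in> Obj ?Z" "m \<in> Obj ?Z"
        and fg: "f \<in> carrier (Hom ?Z j l)" "g \<in> carrier (Hom ?Z l m)"
      let ?f = "Comp B (b (blk j)) (t j) (t l) f (p j)"
      have f: "?f \<in> carrier (Hom B (b (blk j)) (t l))" using jlm fg tJ by (auto intro!: B.comp_closed)
      have g: "Comp B (b (blk l)) (t l) (t m) g (p l) \<in> carrier (Hom B (b (blk l)) (t m))"
        using jlm fg tJ by (auto intro!: B.comp_closed)
      have "Comp B (b (blk j)) (b (blk l)) (b (blk m)) (fmor G l m g) (fmor G j l f)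
        = Comp B (b (blk j)) (t m) (b (blk m)) (i m) (Comp B (b (blk j)) (b (blk l)) (t m) (Comp B (b (blk l)) (t l) (t m) g (p l)) (fmor G j l f))"
        unfolding G_def kfunctor.simps using jlm fg f g tJ
        by (intro B.comp_assoc[symmetric]) (auto intro!: B.comp_closed)
      also have "Comp B (b (blk j)) (b (blk l)) (t m) (Comp B (b (blk l)) (t l) (t m) g (p l)) (fmor G j l f)
        = Comp B (b (blk j)) (t l) (t m) g (Comp B (b (blk j)) (b (blk l)) (t l) (p l) (fmor G j l f))"
        using jlm fg Gc tJ by (intro B.comp_assoc[symmetric]) auto
      also have "Comp B (b (blk j)) (b (blk l)) (t l) (p l) (fmor G j l f)
        = Comp B (b (blk j)) (t l) (t l) (Comp B (t l) (b (blk l)) (t l) (p l) (i l)) ?f"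
        unfolding G_def kfunctor.simps using jlm fg f tJ by (intro B.comp_assoc) auto
      also have "\<dots> = ?f" using jlm f tJ by (simp add: B.comp_ident_left)
      also have "Comp B (b (blk j)) (t l) (t m) g ?f = Comp B (b (blk j)) (t j) (t m) (Comp B (t j) (t l) (t m) g f) (p j)"
        using jlm fg tJ by (intro B.comp_assoc) auto
      finally show "fmor G j m (Comp ?Z j l m g f) = Comp ?Y (fobj G j) (fobj G l) (fobj G m) (fmor G l m g) (fmor G j l f)"
        by (simp add: G_def expansion_def)
    qed
    moreover have "bij_betw (fmor G j l) (carrier (Hom ?Z j l)) (carrier (Hom ?Y (fobj G j) (fobj G l)))"
      if jl: "j \<in> J" "l \<in> J" for j l
    proof (rule bij_betw_imageI)
      show "inj_on (fmor G j l) (carrier (Hom ?Z j l))"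
        using retr[OF jl] by (intro inj_onI) (metis pull_cat_simps(2))
      \<comment> \<open>For surjectivity: the corner element cut out of \<open>h\<close> comes from
        the component of \<open>h\<close> between the two summands.\<close>
      have "Comp B (b (blk j)) (b (blk l)) (b (blk l)) (e l) (Comp B (b (blk j)) (b (blk j)) (b (blk l)) h (e j))
        \<in> fmor G j l ` carrier (Hom B (t j) (t l))" if h: "h \<in> carrier (Hom B (b (blk j)) (b (blk l)))" for h
      proof
        have hi: "Comp B (t j) (b (blk j)) (b (blk l)) h (i j) \<in> carrier (Hom B (t j) (b (blk l)))"
          using h jl tJ by (auto intro!: B.comp_closed)
        show c: "Comp B (t j) (b (blk l)) (t l) (p l) (Comp B (t j) (b (blk j)) (b (blk l)) h (i j)) \<in> carrier (Hom B (t j) (t l))"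
          using hi jl tJ by (auto intro!: B.comp_closed)
        have "Comp B (b (blk j)) (b (blk j)) (b (blk l)) h (e j) = Comp B (b (blk j)) (t j) (b (blk l)) (Comp B (t j) (b (blk j)) (b (blk l)) h (i j)) (p j)"
          unfolding e_def using h jl tJ by (intro B.comp_assoc) auto
        then have "Comp B (b (blk j)) (b (blk l)) (b (blk l)) (e l) (Comp B (b (blk j)) (b (blk j)) (b (blk l)) h (e j))
          = Comp B (b (blk j)) (t l) (b (blk l)) (i l) (Comp B (b (blk j)) (b (blk l)) (t l) (p l)
             (Comp B (b (blk j)) (t j) (b (blk l)) (Comp B (t j) (b (blk j)) (b (blk l)) h (i j)) (p j)))"
          unfolding e_def using hi jl tJ by (simp add: B.comp_assoc B.comp_closed)
        also have "Comp B (b (blk j)) (b (blk l)) (t l) (p l)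
             (Comp B (b (blk j)) (t j) (b (blk l)) (Comp B (t j) (b (blk j)) (b (blk l)) h (i j)) (p j))
          = Comp B (b (blk j)) (t j) (t l) (Comp B (t j) (b (blk l)) (t l) (p l) (Comp B (t j) (b (blk j)) (b (blk l)) h (i j))) (p j)"
          using hi jl tJ by (intro B.comp_assoc) auto
        finally show "Comp B (b (blk j)) (b (blk l)) (b (blk l)) (e l) (Comp B (b (blk j)) (b (blk j)) (b (blk l)) h (e j))
          = fmor G j l (Comp B (t j) (b (blk l)) (t l) (p l) (Comp B (t j) (b (blk j)) (b (blk l)) h (i j)))"
          by (simp add: G_def)
      qed
      then show "fmor G j l ` carrier (Hom ?Z j l) = carrier (Hom ?Y (fobj G j) (fobj G l))"
        using GY[OF jl] unfolding carrier_Y by auto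
    qed
    ultimately show "fully_faithful K ?Z ?Y G" unfolding fully_faithful_def by simp
    show "bij_betw (fobj G) (Obj ?Z) (Obj ?Y)"
    proof (rule bij_betw_imageI)
      show "inj_on (fobj G) (Obj ?Z)"
      proof (rule inj_onI)
        fix j l assume "j \<in> Obj ?Z" "l \<in> Obj ?Z" "fobj G j = fobj G l"
        then have "j \<in> J" "l \<in> J" "blk j = blk l" "e j = e l" by (auto simp: G_def)
        then show "j = l" using inj_onD[OF inj[of "blk j"], of j l] JE[of j] JE[of l] by simp
      qed
      show "fobj G ` Obj ?Z = Obj ?Y"
        using JE by (auto simp: G_def expansion_def F_def E_def image_iff)
    qed
  qed
  ultimately show ?thesis unfolding is_expansion_def by auto
qed

section \<open>Complements\<close>

definition splits_idempotents :: "('o, 'm, 'k) kcat \<Rightarrow> bool" where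
  "splits_idempotents C \<longleftrightarrow> (\<forall>x\<in>Obj C. \<forall>e\<in>carrier (Hom C x x). Comp C x x x e e = e \<longrightarrow>
    (\<exists>y\<in>Obj C. \<exists>q\<in>carrier (Hom C x y). \<exists>j\<in>carrier (Hom C y x).
      Comp C y x y q j = Ident C y \<and> Comp C x y x j q = e))"

definition has_biproducts :: "('o, 'm, 'k) kcat \<Rightarrow> bool" where
  "has_biproducts C \<longleftrightarrow> (\<forall>(n :: nat) t. (\<forall>j<n. t j \<in> Obj C) \<longrightarrow> (\<exists>s i p. biproduct C {..<n} t s i p))"

text \<open>The injectivity clause is what an expansion requires, since a complete system of
  idempotents is a set and not a family.\<close>

definition strict_biproduct :: "('o, 'm, 'k) kcat \<Rightarrow> 'j set \<Rightarrow> ('j \<Rightarrow> 'o) \<Rightarrow> 'o \<Rightarrow> bool" where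
  "strict_biproduct C J t s \<longleftrightarrow> (\<exists>i p. biproduct C J t s i p \<and>
    inj_on (\<lambda>j. Comp C s (t j) s (i j) (p j)) J)"

context k_category
begin

text \<open>Equal diagonal idempotents force both summands to be zero objects. One zero summand is
  therefore harmless, two are not.\<close>

lemma strict_biproductI:
  assumes bp: "biproduct C J t s i p"
    and nz: "\<And>j l. \<lbrakk>j \<in> J; l \<in> J; j \<noteq> l\<rbrakk> \<Longrightarrow>
      Ident C (t j) \<noteq> \<zero>\<^bsub>Hom C (t j) (t j)\<^esub> \<or> Ident C (t l) \<noteq> \<zero>\<^bsub>Hom C (t l) (t l)\<^esub>"
  shows "strict_biproduct C J t s"
  unfolding strict_biproduct_def
proof (rule exI[of _ i], rule exI[of _ p], intro conjI inj_onI)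
  fix j l assume jl: "j \<in> J" "l \<in> J"
    and eq: "Comp C s (t j) s (i j) (p j) = Comp C s (t l) s (i l) (p l)"
  show "j = l"
  proof (rule ccontr)
    assume "j \<noteq> l"
    then show False
      using nz[OF jl] biproduct_idempotents_distinct[OF bp jl _ eq]
        biproduct_idempotents_distinct[OF bp jl(2,1) _ eq[symmetric]] by auto
  qed
qed (rule bp)

text \<open>Provides blocks with one summand, which carry an object through a contraction or
  expansion unchanged; the object may be zero.\<close>

lemma strict_biproduct_single:
  assumes "x \<in> Obj C"
  shows "strict_biproduct C {j} (\<lambda>_. x) x"
proof -
  have "(\<Oplus>\<^bsub>Hom C x x\<^esub>l\<in>{j}. Comp C x x x (Ident C x) (Ident C x)) = Ident C x"
    using assms
    by (subst abelian_monoid.finsum_insert[OF hom_monoid])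
      (auto simp: comp_ident_left ident_closed abelian_monoid.finsum_empty[OF hom_monoid]
        abelian_monoid.r_zero[OF hom_monoid])
  then have "biproduct C {j} (\<lambda>_. x) x (\<lambda>_. Ident C x) (\<lambda>_. Ident C x)"
    unfolding biproduct_def using assms by (auto simp: ident_closed comp_ident_left)
  then show ?thesis by (rule strict_biproductI) auto
qed

lemma hom_add_eq_self:
  assumes "x \<in> Obj C" "y \<in> Obj C" "f \<in> carrier (Hom C x y)" "g \<in> carrier (Hom C x y)"
    and eq: "f \<oplus>\<^bsub>Hom C x y\<^esub> g = f"
  shows "g = \<zero>\<^bsub>Hom C x y\<^esub>"
proof -
  interpret H: abelian_group "Hom C x y" by (rule hom_group[OF assms(1,2)])
  show ?thesis using H.add.l_cancel_one[OF assms(3,4)] eq by simp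
qed

lemma finsum_two:
  assumes "x \<in> Obj C" "y \<in> Obj C" "f 0 \<in> carrier (Hom C x y)" "f (1 :: nat) \<in> carrier (Hom C x y)"
  shows "finsum (Hom C x y) f {0, 1} = f 0 \<oplus>\<^bsub>Hom C x y\<^esub> f 1"
  using assms
  by (simp add: abelian_monoid.finsum_insert[OF hom_monoid] abelian_monoid.finsum_empty[OF hom_monoid]
        abelian_monoid.r_zero[OF hom_monoid])

text \<open>The formula for the identity makes \<open>x\<close> a retract of \<open>s\<close>; the
  complement is obtained by splitting the complementary idempotent of \<open>s\<close>.\<close>

lemma complement_exists:
  assumes split: "splits_idempotents C" and bp: "biproduct C J t s i p" and x: "x \<in> Obj C"
    and uv: "\<And>j. j \<in> J \<Longrightarrow> u j \<in> carrier (Hom C x (t j))" "\<And>j. j \<in> J \<Longrightarrow> v j \<in> carrier (Hom C (t j) x)"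
    and sum: "Ident C x = (\<Oplus>\<^bsub>Hom C x x\<^esub>j\<in>J. Comp C x (t j) x (v j) (u j))"
  shows "\<exists>x' i' p'. biproduct C {0, 1 :: nat} (\<lambda>k. if k = 0 then x else x') s i' p'"
proof -
  note bpD = biproductD[OF bp]
  note s = bpD(2)
  \<comment> \<open>\<open>U\<close> and \<open>V\<close> are the morphisms between \<open>x\<close>
    and \<open>s\<close> with components \<open>u j\<close> and \<open>v j\<close>; their composite
    on \<open>x\<close> is the given sum, hence the identity.\<close>
  define U where "U = (\<Oplus>\<^bsub>Hom C x s\<^esub>j\<in>J. Comp C x (t j) s (i j) (u j))"
  define V where "V = (\<Oplus>\<^bsub>Hom C s x\<^esub>j\<in>J. Comp C s (t j) x (v j) (p j))"
  have U: "U \<in> carrier (Hom C x s)"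
    unfolding U_def using x bpD uv by (intro finsum_hom) (auto intro!: comp_closed)
  have V: "V \<in> carrier (Hom C s x)"
    unfolding V_def using x bpD uv by (intro finsum_hom) (auto intro!: comp_closed)
  have Vi: "Comp C (t j) s x V (i j) = v j" if "j \<in> J" for j
    unfolding V_def using that x uv by (intro biproduct_copair[OF bp]) auto
  have "Comp C x s x V U = (\<Oplus>\<^bsub>Hom C x x\<^esub>j\<in>J. Comp C x s x V (Comp C x (t j) s (i j) (u j)))"
    unfolding U_def using x V bpD uv by (intro comp_finsum_right) (auto intro!: comp_closed)
  also have "\<dots> = (\<Oplus>\<^bsub>Hom C x x\<^esub>j\<in>J. Comp C x (t j) x (v j) (u j))"
    using x V bpD uv Vi by (intro abelian_monoid.finsum_cong'[OF hom_monoid])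
      (auto simp: comp_assoc intro!: comp_closed)
  finally have VU: "Comp C x s x V U = Ident C x" using sum by simp
  define e where "e = Comp C s x s U V"
  have e: "e \<in> carrier (Hom C s s)" unfolding e_def using x s U V by (intro comp_closed)
  interpret H: abelian_group "Hom C s s" by (rule hom_group[OF s s])
  define d where "d = Ident C s \<ominus>\<^bsub>Hom C s s\<^esub> e"
  have id: "Ident C s \<in> carrier (Hom C s s)" using s by (rule ident_closed)
  have d: "d \<in> carrier (Hom C s s)" unfolding d_def using e id by simp
  have ed: "e \<oplus>\<^bsub>Hom C s s\<^esub> d = Ident C s"
    unfolding d_def using e id by (simp add: H.minus_eq H.a_lcomm[of e] H.r_neg)
  have Ve: "Comp C s s x V e = V"
    unfolding e_def using x s U V VU by (simp add: comp_assoc comp_ident_left)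
  have eU: "Comp C x s s e U = U"
    unfolding e_def using x s U V VU by (simp add: comp_assoc[symmetric] comp_ident_right)
  \<comment> \<open>\<open>V\<close> after the sum of \<open>e\<close> and \<open>d\<close> is
    \<open>V\<close>, and \<open>V\<close> after \<open>e\<close> is already \<open>V\<close>; so
    the remaining term vanishes. The argument for \<open>dU\<close> is dual.\<close>
  have Vd: "Comp C s s x V d = \<zero>\<^bsub>Hom C s x\<^esub>"
  proof -
    have "V \<oplus>\<^bsub>Hom C s x\<^esub> Comp C s s x V d = V"
      using comp_add_right[OF s s x V e d] ed Ve comp_ident_right[OF s x V] by simp
    then show ?thesis
      by (intro hom_add_eq_self[OF s x V] comp_closed[OF s s x d V])
  qed
  have dU: "Comp C x s s d U = \<zero>\<^bsub>Hom C x s\<^esub>"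
  proof -
    have "U \<oplus>\<^bsub>Hom C x s\<^esub> Comp C x s s d U = U"
      using comp_add_left[OF x s s U e d] ed eU comp_ident_left[OF x s U] by simp
    then show ?thesis
      by (intro hom_add_eq_self[OF x s U] comp_closed[OF x s s U d])
  qed
  have "Comp C s s s e d = \<zero>\<^bsub>Hom C s s\<^esub>"
    unfolding e_def using x s U V d Vd comp_assoc[OF s s x s d V U] by (simp add: comp_zero_right)
  then have dd: "Comp C s s s d d = d"
    using comp_add_left[OF s s s d e d] ed comp_ident_left[OF s s d] comp_closed[OF s s s d d] by simp
  obtain y q j where y: "y \<in> Obj C" and q: "q \<in> carrier (Hom C s y)" and j: "j \<in> carrier (Hom C y s)"
    and qj: "Comp C y s y q j = Ident C y" and jq: "Comp C s y s j q = d"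
    using split s d dd unfolding splits_idempotents_def by blast
  \<comment> \<open>Since \<open>d\<close> equals \<open>j\<close> after \<open>q\<close>, it acts
    as the identity on the splitting maps. Hence what is known about \<open>V\<close> after
    \<open>d\<close> passes to \<open>V\<close> after \<open>j\<close>, and what is known about
    \<open>d\<close> after \<open>U\<close> passes to \<open>q\<close> after
    \<open>U\<close>.\<close>
  have Vj: "Comp C y s x V j = \<zero>\<^bsub>Hom C y x\<^esub>"
  proof -
    have "j = Comp C y s s d j"
      unfolding jq[symmetric] using comp_assoc[OF y s y s j q j] qj comp_ident_right[OF y s j] by simp
    then have "Comp C y s x V j = Comp C y s x (Comp C s s x V d) j"
      using comp_assoc[OF y s s x j d V] by simp
    then show ?thesis using Vd comp_zero_left[OF y s x j] by simp
  qed
  have qU: "Comp C x s y q U = \<zero>\<^bsub>Hom C x y\<^esub>"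
  proof -
    have "q = Comp C s s y q d"
      unfolding jq[symmetric] using comp_assoc[OF s y s y q j q] qj comp_ident_left[OF s y q] by simp
    then have "Comp C x s y q U = Comp C x s y q (Comp C x s s d U)"
      using comp_assoc[OF x s s y U d q] by simp
    then show ?thesis using dU comp_zero_right[OF x s y q] by simp
  qed
  let ?t = "\<lambda>k :: nat. if k = 0 then x else y" and ?i = "\<lambda>k :: nat. if k = 0 then U else j"
    and ?p = "\<lambda>k :: nat. if k = 0 then V else q"
  have "(\<Oplus>\<^bsub>Hom C s s\<^esub>k\<in>{0, 1}. Comp C s (?t k) s (?i k) (?p k)) = Ident C s"
    using finsum_two[OF s s, of "\<lambda>k. Comp C s (?t k) s (?i k) (?p k)"] e d ed jq by (simp add: e_def)
  then have "biproduct C {0, 1} ?t s ?i ?p"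
    unfolding biproduct_def using x y s U V q j VU qj Vj qU by auto
  then show ?thesis by blast
qed

text \<open>One object \<open>s\<close> receives two decompositions, into objects of
  \<open>T\<close> and into summands of which the one at position 0 is \<open>x\<close>. Passing
  from the former to the latter is a contraction followed by an expansion. The summands
  \<open>a j\<close> stay in the class of objects to which the lemma applies, so taking complements
  can be iterated.\<close>

lemma decomposition_exists:
  assumes split: "splits_idempotents C" and has: "has_biproducts C"
    and T: "T \<subseteq> Obj C" and x: "x \<in> Obj C" "Ident C x \<in> thru C T x x"
  shows "\<exists>(n :: nat) t s (J :: nat set) a. strict_biproduct C {..<n} t s \<and> t ` {..<n} \<subseteq> T \<and>
    strict_biproduct C J a s \<and> 0 \<in> J \<and> a 0 = x \<and>
    (\<forall>j\<in>J. a j \<in> Obj C \<and> Ident C (a j) \<in> thru C T (a j) (a j))"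
proof -
  obtain n :: nat and t u v where
    tuv: "\<And>j. j < n \<Longrightarrow> t j \<in> T \<and> Ident C (t j) \<noteq> \<zero>\<^bsub>Hom C (t j) (t j)\<^esub> \<and>
      u j \<in> carrier (Hom C x (t j)) \<and> v j \<in> carrier (Hom C (t j) x)"
    and sum: "Ident C x = (\<Oplus>\<^bsub>Hom C x x\<^esub>j\<in>{..<n}. Comp C x (t j) x (v j) (u j))"
    using thru_family[OF x(2) T x(1) x(1)] by blast
  obtain s i p where bp: "biproduct C {..<n} t s i p"
    using has tuv T unfolding has_biproducts_def by blast
  obtain y i' p' where bp': "biproduct C {0, 1 :: nat} (\<lambda>k. if k = 0 then x else y) s i' p'"
    using complement_exists[OF split bp x(1) _ _ sum] tuv by blast
  note bpD = biproductD[OF bp']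
  have s: "s \<in> Obj C" and y: "y \<in> Obj C" using bpD(2) bpD(3)[of 1] by simp_all
  have 1: "strict_biproduct C {..<n} t s" using tuv by (intro strict_biproductI[OF bp]) auto
  have t: "t ` {..<n} \<subseteq> T" using tuv by auto
  \<comment> \<open>The complement \<open>y\<close> is a retract of \<open>s\<close> and therefore
    remains in the class.\<close>
  have "Ident C s \<in> thru C T s s" by (rule biproduct_thru[OF bp t T])
  then have "Comp C y s s (Ident C s) (i' 1) \<in> thru C T y s"
    using bpD(4)[of 1] s y T by (intro thru_comp_right) auto
  then have "Comp C y s y (p' 1) (i' 1) \<in> thru C T y y"
    using bpD(4)[of 1] bpD(5)[of 1] s y T by (intro thru_comp_left) (auto simp: comp_ident_left)
  then have y': "Ident C y \<in> thru C T y y" using bpD(6)[of 1] by simp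
  show ?thesis
  \<comment> \<open>A zero complement is dropped: \<open>x\<close> may be zero too, and then the two
    diagonal idempotents would coincide. Without it, \<open>i' 0\<close> and \<open>p' 0\<close> are
    mutually inverse isomorphisms between \<open>x\<close> and \<open>s\<close>.\<close>
  proof (cases "Ident C y = \<zero>\<^bsub>Hom C y y\<^esub>")
    case True
    have p1: "p' 1 \<in> carrier (Hom C s y)" "i' 1 \<in> carrier (Hom C y s)" using bpD(4,5)[of 1] by simp_all
    have p0: "p' 0 \<in> carrier (Hom C s x)" "i' 0 \<in> carrier (Hom C x s)" using bpD(4,5)[of 0] by simp_all
    have "p' 1 = \<zero>\<^bsub>Hom C s y\<^esub>"
      using comp_ident_left[OF s y p1(1)] comp_zero_left[OF s y y p1(1)] True by simp
    then have "Comp C s y s (i' 1) (p' 1) = \<zero>\<^bsub>Hom C s s\<^esub>" using comp_zero_right s y p1 by simp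
    moreover have "Comp C s x s (i' 0) (p' 0) \<oplus>\<^bsub>Hom C s s\<^esub> Comp C s y s (i' 1) (p' 1) = Ident C s"
      using bpD(8) finsum_two[OF s s, of "\<lambda>k. Comp C s (if k = 0 then x else y) s (i' k) (p' k)"]
        comp_closed[OF s x(1) s p0] comp_closed[OF s y s p1] by simp
    ultimately have e: "Comp C s x s (i' 0) (p' 0) = Ident C s"
      using abelian_monoid.r_zero[OF hom_monoid[OF s s]] comp_closed[OF s x(1) s p0] by simp
    have "biproduct C {0 :: nat} (\<lambda>_. x) s i' p'"
      unfolding biproduct_def using s x(1) p0 bpD(6)[of 0] e comp_closed[OF s x(1) s p0]
      by (simp add: abelian_monoid.finsum_insert[OF hom_monoid] abelian_monoid.finsum_empty[OF hom_monoid]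
        abelian_monoid.r_zero[OF hom_monoid] ident_closed)
    then have "strict_biproduct C {0 :: nat} (\<lambda>_. x) s" by (rule strict_biproductI) auto
    with 1 t x show ?thesis
      by (intro exI[of _ n] exI[of _ t] exI[of _ s] exI[of _ "{0}"] exI[of _ "\<lambda>_. x"]) auto
  next
    case False
    then have "strict_biproduct C {0, 1 :: nat} (\<lambda>k. if k = 0 then x else y) s"
      by (intro strict_biproductI[OF bp']) auto
    with 1 t x y y' show ?thesis
      by (intro exI[of _ n] exI[of _ t] exI[of _ s] exI[of _ "{0, 1}"] exI[of _ "\<lambda>k. if k = 0 then x else y"]) auto
  qed
qed

end

section \<open>Chains of contractions and expansions\<close>

text \<open>The category axioms are part of a step so that they are available for every member of a
  chain; all types are fixed to \<open>'u\<close> so that steps can be iterated.\<close>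

definition morita_step :: "('k, 'r) ring_scheme \<Rightarrow> ('u, 'u, 'k) kcat \<Rightarrow> ('u, 'u, 'k) kcat \<Rightarrow> bool" where
  "morita_step K X Y \<longleftrightarrow> k_category K X \<and> k_category K Y \<and>
    (k_equivalent K X Y \<or> is_contraction K X Y \<or> is_expansion K X Y)"

text \<open>The object \<open>t x j\<close> of \<open>B\<close> is indexed by the code of the pair
  \<open>(x, j)\<close>, so that the objects of the new category lie in \<open>'u\<close>, whatever
  the object type of \<open>B\<close> is. Repeated values give distinct isomorphic objects.\<close>

definition family_cat ::
  "('o, 'u, 'k) kcat \<Rightarrow> ('i \<times> nat \<Rightarrow> 'u) \<Rightarrow> 'i set \<Rightarrow> ('i \<Rightarrow> nat set) \<Rightarrow> ('i \<Rightarrow> nat \<Rightarrow> 'o) \<Rightarrow> ('u, 'u, 'k) kcat" where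
  "family_cat B \<phi> N J t = pull_cat B (\<lambda>u. t (fst (inv_into UNIV \<phi> u)) (snd (inv_into UNIV \<phi> u))) (\<phi> ` Sigma N J)"

lemma family_cat_blocks:
  fixes \<phi> :: "'i \<times> nat \<Rightarrow> 'u"
  assumes B: "k_category K B" and \<phi>: "inj \<phi>"
    and bp: "\<And>x. x \<in> N \<Longrightarrow> strict_biproduct B (J x) (t x) (s x)"
  shows "is_contraction K (family_cat B \<phi> N J t) (family_cat B \<phi> N (\<lambda>_. {0}) (\<lambda>x _. s x))"
    and "is_expansion K (family_cat B \<phi> N (\<lambda>_. {0}) (\<lambda>x _. s x)) (family_cat B \<phi> N J t)"
    and "k_category K (family_cat B \<phi> N J t)"
    and "k_category K (family_cat B \<phi> N (\<lambda>_. {0}) (\<lambda>x _. s x))"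
proof -
  interpret B: k_category K B by fact
  note inv [simp] = inv_f_f[OF \<phi>]
  obtain i p where ip: "\<And>x. x \<in> N \<Longrightarrow> biproduct B (J x) (t x) (s x) (i x) (p x)"
    and inj: "\<And>x. x \<in> N \<Longrightarrow> inj_on (\<lambda>j. Comp B (s x) (t x j) (s x) (i x j) (p x j)) (J x)"
    using bp unfolding strict_biproduct_def by metis
  note ipD = biproductD[OF ip]
  \<comment> \<open>The merged object of the block \<open>x\<close> has the code of
    \<open>(x, 0)\<close>, where 0 is the element of its index set \<open>{0}\<close> and has
    nothing to do with \<open>J x\<close>.\<close>
  define blk where "blk u = \<phi> (fst (inv_into UNIV \<phi> u), 0 :: nat)" for u
  let ?I = "\<phi> ` Sigma N (\<lambda>_. {0})" and ?J = "\<phi> ` Sigma N J"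
  let ?b = "\<lambda>u. s (fst (inv_into UNIV \<phi> u))" and ?t = "\<lambda>u. t (fst (inv_into UNIV \<phi> u)) (snd (inv_into UNIV \<phi> u))"
  let ?i = "\<lambda>u. i (fst (inv_into UNIV \<phi> u)) (snd (inv_into UNIV \<phi> u))" and ?p = "\<lambda>u. p (fst (inv_into UNIV \<phi> u)) (snd (inv_into UNIV \<phi> u))"
  have blk: "blk \<in> ?J \<rightarrow> ?I" by (auto simp: blk_def)
  have b: "?b \<in> ?I \<rightarrow> Obj B" using ipD by auto
  have t: "?t \<in> ?J \<rightarrow> Obj B" using ipD by auto
  have E: "{j \<in> ?J. blk j = \<phi> (x, 0)} = (\<lambda>j. \<phi> (x, j)) ` J x" if "x \<in> N" for x
    using that by (auto simp: blk_def inj_eq[OF \<phi>])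
  have bp': "biproduct B {j \<in> ?J. blk j = u} ?t (?b u) ?i ?p" if "u \<in> ?I" for u
  proof -
    from that obtain x where x: "x \<in> N" "u = \<phi> (x, 0)" by auto
    show ?thesis unfolding x(2) E[OF x(1)]
      by (rule B.biproduct_reindex) (use ip[OF x(1)] injD[OF \<phi>] in \<open>auto intro!: inj_onI\<close>)
  qed
  have inj': "inj_on (\<lambda>j. Comp B (?b u) (?t j) (?b u) (?i j) (?p j)) {j \<in> ?J. blk j = u}" if "u \<in> ?I" for u
  proof -
    from that obtain x where x: "x \<in> N" "u = \<phi> (x, 0)" by auto
    show ?thesis unfolding x(2) E[OF x(1)] using inj[OF x(1)] by (auto simp: inj_on_def)
  qed
  show "is_contraction K (family_cat B \<phi> N J t) (family_cat B \<phi> N (\<lambda>_. {0}) (\<lambda>x _. s x))"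
    unfolding family_cat_def by (rule is_contraction_biproducts[OF B blk b bp'])
  show "is_expansion K (family_cat B \<phi> N (\<lambda>_. {0}) (\<lambda>x _. s x)) (family_cat B \<phi> N J t)"
    unfolding family_cat_def by (rule is_expansion_biproducts[OF B blk b bp' inj'])
  show "k_category K (family_cat B \<phi> N J t)"
    unfolding family_cat_def by (rule k_category_pull_cat[OF B t])
  show "k_category K (family_cat B \<phi> N (\<lambda>_. {0}) (\<lambda>x _. s x))"
    unfolding family_cat_def by (rule k_category_pull_cat[OF B b])
qed

lemma family_cat_image:
  fixes \<phi> :: "'i \<times> nat \<Rightarrow> 'u"
  assumes "inj \<phi>"
  shows "(\<lambda>u. t (fst (inv_into UNIV \<phi> u)) (snd (inv_into UNIV \<phi> u))) ` \<phi> ` Sigma N J = (\<Union>x\<in>N. t x ` J x)"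
  unfolding image_image inv_f_f[OF assms] by force

text \<open>The family of all \<open>t x j\<close> has the same values in \<open>B\<close> as
  \<open>X\<close>, up to repetition, hence is equivalent to \<open>X\<close>; it contracts to the
  \<open>s x\<close>, which expand into the \<open>a x j\<close>. The path can be reversed, as
  merging summands is always a contraction and, for strict biproducts, splitting is an
  expansion.\<close>

lemma morita_chain:
  fixes \<phi> :: "'i \<times> nat \<Rightarrow> 'u" and X :: "('u, 'u, 'k) kcat" and J :: "'i \<Rightarrow> nat set"
  assumes B: "k_category K B" and X: "k_category K X" and ff: "fully_faithful K X B F" and \<phi>: "inj \<phi>"
    and t: "\<And>x. x \<in> N \<Longrightarrow> strict_biproduct B (J x) (t x) (s x)"
    and a: "\<And>x. x \<in> N \<Longrightarrow> strict_biproduct B (L x) (a x) (s x)"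
    and img: "(\<Union>x\<in>N. t x ` J x) = fobj F ` Obj X"
  shows "(morita_step K)\<^sup>*\<^sup>* X (family_cat B \<phi> N L a)" "(morita_step K)\<^sup>*\<^sup>* (family_cat B \<phi> N L a) X"
proof -
  let ?T = "family_cat B \<phi> N J t" and ?A = "family_cat B \<phi> N L a"
    and ?S = "family_cat B \<phi> N (\<lambda>_. {0}) (\<lambda>x _. s x)"
  have bt: "is_contraction K ?T ?S" "is_expansion K ?S ?T" "k_category K ?T" "k_category K ?S"
    by (intro family_cat_blocks[OF B \<phi>]; fact t)+
  have ba: "is_contraction K ?A ?S" "is_expansion K ?S ?A" "k_category K ?A"
    by (intro family_cat_blocks[OF B \<phi>]; fact a)+
  have "k_equivalent K X ?T"
    unfolding family_cat_def using img family_cat_image[OF \<phi>, of t N J]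
    by (intro k_equivalent_pull_cat[OF X B ff]) simp
  then have "morita_step K X ?T" "morita_step K ?T X"
    using X bt(3) k_equivalent_sym[of K X ?T] by (simp_all add: morita_step_def)
  moreover have "morita_step K ?T ?S" "morita_step K ?S ?A" "morita_step K ?A ?S" "morita_step K ?S ?T"
    using bt ba by (simp_all add: morita_step_def)
  ultimately show "(morita_step K)\<^sup>*\<^sup>* X ?A" "(morita_step K)\<^sup>*\<^sup>* ?A X"
    by (meson r_into_rtranclp rtranclp_trans)+
qed

text \<open>Codes and multiplicities do not matter up to equivalence: both categories are pulled
  back along families with the same set of values.\<close>

lemma family_cat_equivalent:
  fixes \<phi> :: "'i \<times> nat \<Rightarrow> 'u" and \<psi> :: "'j \<times> nat \<Rightarrow> 'u"
  assumes B: "k_category K B" and \<phi>: "inj \<phi>" and \<psi>: "inj \<psi>"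
    and a: "\<And>x j. x \<in> N \<Longrightarrow> j \<in> J x \<Longrightarrow> a x j \<in> Obj B"
    and img: "(\<Union>x\<in>N. a x ` J x) = (\<Union>x\<in>M. b x ` L x)"
  shows "k_equivalent K (family_cat B \<phi> N J a) (family_cat B \<psi> M L b)"
proof -
  interpret B: k_category K B by fact
  let ?a = "\<lambda>u. a (fst (inv_into UNIV \<phi> u)) (snd (inv_into UNIV \<phi> u))" and ?b = "\<lambda>u. b (fst (inv_into UNIV \<psi> u)) (snd (inv_into UNIV \<psi> u))"
  define F where "F = \<lparr>fobj = ?a, fmor = \<lambda>_ _ (f :: 'u). f\<rparr>"
  have A: "k_category K (family_cat B \<phi> N J a)"
    unfolding family_cat_def using a by (intro k_category_pull_cat[OF B]) (auto simp: inv_f_f[OF \<phi>])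
  have "k_functor K (family_cat B \<phi> N J a) B F"
    by (rule k_functorI) (auto simp: family_cat_def F_def inv_f_f[OF \<phi>] a intro!: linear_mapsI)
  then have ff: "fully_faithful K (family_cat B \<phi> N J a) B F"
    unfolding fully_faithful_def by (auto simp: family_cat_def F_def bij_betw_def)
  have "?b ` (\<psi> ` Sigma M L) = fobj F ` Obj (family_cat B \<phi> N J a)"
    using family_cat_image[OF \<phi>, of a N J] family_cat_image[OF \<psi>, of b M L] img
    by (simp add: F_def family_cat_def)
  from k_equivalent_pull_cat[OF A B ff this] show ?thesis
    by (simp add: family_cat_def[of B \<psi>])
qed

section \<open>Encodings in an infinite type\<close>

lemma infinite_inj_pair:
  assumes "infinite (UNIV :: 'u set)"
  shows "\<exists>f :: 'u \<times> 'u \<Rightarrow> 'u. inj f"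
proof -
  have "\<exists>f. bij_betw f ((UNIV :: 'u set) \<times> (UNIV :: 'u set)) (UNIV :: 'u set)"
    using card_of_Times_same_infinite[OF assms] by (simp add: card_of_ordIso)
  then show ?thesis by (auto simp: bij_betw_def)
qed

lemma infinite_inj_nat:
  assumes "infinite (UNIV :: 'u set)"
  shows "\<exists>f :: 'u \<times> nat \<Rightarrow> 'u. inj f"
proof -
  obtain f :: "'u \<times> 'u \<Rightarrow> 'u" where f: "inj f" using infinite_inj_pair[OF assms] by blast
  obtain g :: "nat \<Rightarrow> 'u" where g: "inj g" using infinite_countable_subset[OF assms] by blast
  have "inj (\<lambda>(u, n). f (u, g n))" by (auto intro!: injI simp: inj_eq[OF f] inj_eq[OF g])
  then show ?thesis by blast
qed

text \<open>A pairing is iterated along the list from the arbitrary seed \<open>undefined\<close>.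
  The folded value is only known to separate lists of equal length, so the length is recorded as
  well.\<close>

lemma infinite_inj_list:
  assumes "infinite (UNIV :: 'u set)"
  shows "\<exists>f :: 'u list \<Rightarrow> 'u. inj f"
proof -
  obtain f :: "'u \<times> 'u \<Rightarrow> 'u" where f: "inj f" using infinite_inj_pair[OF assms] by blast
  obtain g :: "'u \<times> nat \<Rightarrow> 'u" where g: "inj g" using infinite_inj_nat[OF assms] by blast
  define h where "h xs = foldr (\<lambda>x y. f (x, y)) xs undefined" for xs
  have h: "xs = ys" if "length xs = length ys" "h xs = h ys" for xs ys
    using that by (induction xs ys rule: list_induct2) (auto simp: h_def inj_eq[OF f])
  have "inj (\<lambda>xs. g (h xs, length xs))"
    using h by (auto intro!: injI simp: inj_eq[OF g])
  then show ?thesis by blast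
qed

text \<open>An index is a starting object of one of two categories together with a word, or a single
  object; the additional number is a position in a block. Words and numbers are countable and fit
  into one \<open>nat\<close>; the tags 0, 1, 2 separate the three shapes.\<close>

lemma infinite_inj_index:
  assumes "infinite (UNIV :: 'u set)"
  shows "\<exists>\<phi> :: ((('u + 'u) \<times> (bool \<times> nat) list) + 'u) \<times> nat \<Rightarrow> 'u. inj \<phi>"
proof -
  obtain g :: "'u \<times> nat \<Rightarrow> 'u" where g: "inj g" using infinite_inj_nat[OF assms] by blast
  let ?h = "\<lambda>(i, n :: nat). case i of
      Inl (Inl u, w) \<Rightarrow> (u, to_nat (0 :: nat, w :: (bool \<times> nat) list, n))
    | Inl (Inr u, w) \<Rightarrow> (u, to_nat (1 :: nat, w, n))
    | Inr u \<Rightarrow> (u, to_nat (2 :: nat, [] :: (bool \<times> nat) list, n))"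
  have "inj ?h" by (rule injI) (auto split: sum.splits)
  then have "inj (g \<circ> ?h)" using g by (rule inj_compose[rotated])
  then show ?thesis by blast
qed

section \<open>Linking two categories inside a common ambient category\<close>

lemma (in k_category) decomposition_choice:
  assumes split: "splits_idempotents C" and has: "has_biproducts C"
    and T: "T \<subseteq> Obj C" and R: "R = {x \<in> Obj C. Ident C x \<in> thru C T x x}"
  obtains n :: "'o \<Rightarrow> nat" and t s and J :: "'o \<Rightarrow> nat set" and a
  where "\<And>x. x \<in> R \<Longrightarrow> strict_biproduct C {..<n x} (t x) (s x)"
    and "\<And>x. x \<in> R \<Longrightarrow> t x ` {..<n x} \<subseteq> T"
    and "\<And>x. x \<in> R \<Longrightarrow> strict_biproduct C (J x) (a x) (s x)"
    and "\<And>x. x \<in> R \<Longrightarrow> 0 \<in> J x" and "\<And>x. x \<in> R \<Longrightarrow> a x 0 = x" and "\<And>x. x \<in> R \<Longrightarrow> a x ` J x \<subseteq> R"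
proof -
  \<comment> \<open>The data of a decomposition depend on each other and are therefore chosen as one
    tuple.\<close>
  define P where "P x d \<longleftrightarrow> strict_biproduct C {..<fst d :: nat} (fst (snd d)) (fst (snd (snd d))) \<and>
      fst (snd d) ` {..<fst d} \<subseteq> T \<and>
      strict_biproduct C (fst (snd (snd (snd d))) :: nat set) (snd (snd (snd (snd d)))) (fst (snd (snd d))) \<and>
      0 \<in> fst (snd (snd (snd d))) \<and> snd (snd (snd (snd d))) 0 = x \<and>
      snd (snd (snd (snd d))) ` fst (snd (snd (snd d))) \<subseteq> R" for x d
  have "\<exists>d. P x d" if x: "x \<in> R" for x
  proof -
    from x have "x \<in> Obj C" "Ident C x \<in> thru C T x x" by (auto simp: R)
    from decomposition_exists[OF split has T this] obtain n t s J a where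
      "strict_biproduct C {..<n :: nat} t s" "t ` {..<n} \<subseteq> T" "strict_biproduct C (J :: nat set) a s"
      "0 \<in> J" "a 0 = x" "\<forall>j\<in>J. a j \<in> Obj C \<and> Ident C (a j) \<in> thru C T (a j) (a j)" by blast
    then have "P x (n, t, s, J, a)" by (auto simp: P_def R)
    then show ?thesis by blast
  qed
  then obtain d where d: "\<And>x. x \<in> R \<Longrightarrow> P x (d x)" by metis
  show ?thesis
    by (rule that[of "\<lambda>x. fst (d x)" "\<lambda>x. fst (snd (d x))" "\<lambda>x. fst (snd (snd (d x)))"
          "\<lambda>x. fst (snd (snd (snd (d x))))" "\<lambda>x. snd (snd (snd (snd (d x))))"])
      (use d in \<open>simp_all add: P_def\<close>)
qed

text \<open>Here the morphisms of \<open>B\<close> already lie in \<open>'u\<close>, but there may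
  be too many objects. Only those are used that arise from objects of \<open>C\<close> and
  \<open>D\<close> by repeatedly passing to a summand, and these are named by words.\<close>

lemma morita_steps_ambient:
  fixes B :: "('o, 'u, 'k) kcat" and C D :: "('u, 'u, 'k) kcat"
  assumes inf: "infinite (UNIV :: 'u set)"
    and B: "k_category K B" and C: "k_category K C" and D: "k_category K D"
    and F: "fully_faithful K C B F" and G: "fully_faithful K D B G"
    and split: "splits_idempotents B" and has: "has_biproducts B"
    and FG: "\<And>x. x \<in> Obj C \<Longrightarrow> Ident B (fobj F x) \<in> thru B (fobj G ` Obj D) (fobj F x) (fobj F x)"
    and GF: "\<And>y. y \<in> Obj D \<Longrightarrow> Ident B (fobj G y) \<in> thru B (fobj F ` Obj C) (fobj G y) (fobj G y)"
  shows "(morita_step K)\<^sup>*\<^sup>* C D"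
proof -
  interpret B: k_category K B by fact
  let ?TC = "fobj F ` Obj C" and ?TD = "fobj G ` Obj D"
  have TC: "?TC \<subseteq> Obj B" and TD: "?TD \<subseteq> Obj B"
    using k_functorD(1)[OF fully_faithfulD(1)[OF F]] k_functorD(1)[OF fully_faithfulD(1)[OF G]] by auto
  define R where "R = {A \<in> Obj B. Ident B A \<in> thru B ?TC A A}"
  \<comment> \<open>As the two families generate each other, the class \<open>R\<close> can be
    described by either of them; each of its members has a decomposition of both kinds.\<close>
  have R_D: "R = {A \<in> Obj B. Ident B A \<in> thru B ?TD A A}"
    unfolding R_def using B.thru_trans[OF _ _ TC TD] B.thru_trans[OF _ _ TD TC] FG GF by blast
  obtain nC tC sC JC aC where dC: "\<And>A. A \<in> R \<Longrightarrow> strict_biproduct B {..<nC A :: nat} (tC A) (sC A)"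
    "\<And>A. A \<in> R \<Longrightarrow> tC A ` {..<nC A} \<subseteq> ?TC"
    "\<And>A. A \<in> R \<Longrightarrow> strict_biproduct B (JC A) (aC A) (sC A)"
    "\<And>A. A \<in> R \<Longrightarrow> (0 :: nat) \<in> JC A" "\<And>A. A \<in> R \<Longrightarrow> aC A 0 = A" "\<And>A. A \<in> R \<Longrightarrow> aC A ` JC A \<subseteq> R"
    by (rule B.decomposition_choice[OF split has TC R_def]) blast
  obtain nD tD sD JD aD where dD: "\<And>A. A \<in> R \<Longrightarrow> strict_biproduct B {..<nD A :: nat} (tD A) (sD A)"
    "\<And>A. A \<in> R \<Longrightarrow> tD A ` {..<nD A} \<subseteq> ?TD"
    "\<And>A. A \<in> R \<Longrightarrow> strict_biproduct B (JD A) (aD A) (sD A)"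
    "\<And>A. A \<in> R \<Longrightarrow> (0 :: nat) \<in> JD A" "\<And>A. A \<in> R \<Longrightarrow> aD A 0 = A" "\<And>A. A \<in> R \<Longrightarrow> aD A ` JD A \<subseteq> R"
    by (rule B.decomposition_choice[OF split has TD R_D]) blast
  \<comment> \<open>The letter \<open>(b, j)\<close> selects the summand \<open>j\<close> of the
    decomposition for \<open>C\<close> or for \<open>D\<close>, depending on \<open>b\<close>. If
    there is no such summand, the object is left alone, so every word has a meaning.\<close>
  define next_object where "next_object = (\<lambda>(b, j) A.
    if b \<and> j \<in> JC A then aC A j else if \<not> b \<and> j \<in> JD A then aD A j else A)"
  define e where "e = (\<lambda>(z, w). foldr next_object w (case z of Inl x \<Rightarrow> fobj F x | Inr y \<Rightarrow> fobj G y))"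
  define Z where "Z = (Inl ` Obj C \<union> Inr ` Obj D) \<times> (UNIV :: (bool \<times> nat) list set)"
  have eR: "e z \<in> R" if "z \<in> Z" for z
  proof -
    obtain z' w where z: "z = (z', w)" by force
    have "foldr next_object w (case z' of Inl x \<Rightarrow> fobj F x | Inr y \<Rightarrow> fobj G y) \<in> R"
    proof (induction w)
      case Nil
      show ?case
      proof (cases z')
        case (Inl x)
        then show ?thesis using that z TC FG by (auto simp: Z_def R_D)
      next
        case (Inr y)
        then show ?thesis using that z TD GF by (auto simp: Z_def R_def)
      qed
    next
      case (Cons l w)
      then show ?case using dC(6) dD(6) by (cases l) (auto simp: next_object_def image_subset_iff)
    qed
    then show ?thesis by (simp add: e_def z)
  qed
  \<comment> \<open>Passing to a summand adds a letter to the word; hence the named objects are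
    closed under both kinds of decomposition.\<close>
  have eC: "aC (e z) j \<in> e ` Z" if "z \<in> Z" "j \<in> JC (e z)" for z j
  proof -
    obtain z' w where z: "z = (z', w)" by force
    have "aC (e z) j = e (z', (True, j) # w)"
      using that by (simp add: e_def z next_object_def)
    moreover have "(z', (True, j) # w) \<in> Z" using that z by (simp add: Z_def)
    ultimately show ?thesis by blast
  qed
  have eD: "aD (e z) j \<in> e ` Z" if "z \<in> Z" "j \<in> JD (e z)" for z j
  proof -
    obtain z' w where z: "z = (z', w)" by force
    have "aD (e z) j = e (z', (False, j) # w)"
      using that by (simp add: e_def z next_object_def)
    moreover have "(z', (False, j) # w) \<in> Z" using that z by (simp add: Z_def)
    ultimately show ?thesis by blast
  qed
  have FZ: "fobj F x \<in> e ` Z" if "x \<in> Obj C" for x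
    by (rule image_eqI[of _ _ "(Inl x, [])"]) (use that in \<open>auto simp: e_def Z_def\<close>)
  have GZ: "fobj G y \<in> e ` Z" if "y \<in> Obj D" for y
    by (rule image_eqI[of _ _ "(Inr y, [])"]) (use that in \<open>auto simp: e_def Z_def\<close>)
  obtain \<phi> :: "((('u + 'u) \<times> (bool \<times> nat) list) + 'u) \<times> nat \<Rightarrow> 'u" where \<phi>: "inj \<phi>"
    using infinite_inj_index[OF inf] by blast
  \<comment> \<open>\<open>Inl z\<close> stands for the decomposition of the object named by
    \<open>z\<close>, and \<open>Inr x\<close> for an object of the given category taken alone. The
    latter are there because the sums chosen for the objects of \<open>R\<close> may miss some
    objects of \<open>C\<close>, whereas the values before contraction must be exactly the image of
    \<open>Obj C\<close>.\<close>
  define LC where "LC i = (case i of Inl z \<Rightarrow> JC (e z) | Inr x \<Rightarrow> {0})" for i :: "('u + 'u) \<times> (bool \<times> nat) list + 'u"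
  define bC where "bC i = (case i of Inl z \<Rightarrow> aC (e z) | Inr x \<Rightarrow> (\<lambda>_. fobj F x))" for i
  define LD where "LD i = (case i of Inl z \<Rightarrow> JD (e z) | Inr x \<Rightarrow> {0})" for i :: "('u + 'u) \<times> (bool \<times> nat) list + 'u"
  define bD where "bD i = (case i of Inl z \<Rightarrow> aD (e z) | Inr x \<Rightarrow> (\<lambda>_. fobj G x))" for i
  let ?NC = "Inl ` Z \<union> Inr ` Obj C" and ?ND = "Inl ` Z \<union> Inr ` Obj D"
  have 1: "(morita_step K)\<^sup>*\<^sup>* C (family_cat B \<phi> ?NC LC bC)"
  proof (rule morita_chain(1)[OF B C F \<phi>])
    let ?J = "\<lambda>i. case i of Inl z \<Rightarrow> {..<nC (e z)} | Inr x \<Rightarrow> {0}"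
      and ?t = "\<lambda>i. case i of Inl z \<Rightarrow> tC (e z) | Inr x \<Rightarrow> (\<lambda>_. fobj F x)"
      and ?s = "\<lambda>i. case i of Inl z \<Rightarrow> sC (e z) | Inr x \<Rightarrow> fobj F x"
    show "strict_biproduct B (?J i) (?t i) (?s i)" if "i \<in> ?NC" for i
      using that dC(1) eR TC by (auto intro!: B.strict_biproduct_single)
    show "strict_biproduct B (LC i) (bC i) (?s i)" if "i \<in> ?NC" for i
      using that dC(3) eR TC by (auto simp: LC_def bC_def intro!: B.strict_biproduct_single)
    show "(\<Union>i\<in>?NC. ?t i ` ?J i) = ?TC"
      using dC(2) eR by (fastforce simp: image_subset_iff)
  qed
  have 2: "(morita_step K)\<^sup>*\<^sup>* (family_cat B \<phi> ?ND LD bD) D"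
  proof (rule morita_chain(2)[OF B D G \<phi>])
    let ?J = "\<lambda>i. case i of Inl z \<Rightarrow> {..<nD (e z)} | Inr x \<Rightarrow> {0}"
      and ?t = "\<lambda>i. case i of Inl z \<Rightarrow> tD (e z) | Inr x \<Rightarrow> (\<lambda>_. fobj G x)"
      and ?s = "\<lambda>i. case i of Inl z \<Rightarrow> sD (e z) | Inr x \<Rightarrow> fobj G x"
    show "strict_biproduct B (?J i) (?t i) (?s i)" if "i \<in> ?ND" for i
      using that dD(1) eR TD by (auto intro!: B.strict_biproduct_single)
    show "strict_biproduct B (LD i) (bD i) (?s i)" if "i \<in> ?ND" for i
      using that dD(3) eR TD by (auto simp: LD_def bD_def intro!: B.strict_biproduct_single)
    show "(\<Union>i\<in>?ND. ?t i ` ?J i) = ?TD"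
      using dD(2) eR by (fastforce simp: image_subset_iff)
  qed
  \<comment> \<open>One inclusion is the closure just shown; the other holds because each object is
    the summand 0 of its own decomposition.\<close>
  have imgC: "(\<Union>i\<in>?NC. bC i ` LC i) = e ` Z"
  proof (intro equalityI subsetI)
    fix A assume "A \<in> (\<Union>i\<in>?NC. bC i ` LC i)"
    then show "A \<in> e ` Z" using eC FZ by (auto simp: bC_def LC_def)
  next
    fix A assume "A \<in> e ` Z"
    then obtain z where z: "z \<in> Z" "A = e z" by blast
    then have "A \<in> bC (Inl z) ` LC (Inl z)"
      using dC(4,5)[OF eR[OF z(1)]] by (auto simp: bC_def LC_def image_iff intro!: bexI[of _ 0])
    then show "A \<in> (\<Union>i\<in>?NC. bC i ` LC i)" using z by blast
  qed
  have imgD: "(\<Union>i\<in>?ND. bD i ` LD i) = e ` Z"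
  proof (intro equalityI subsetI)
    fix A assume "A \<in> (\<Union>i\<in>?ND. bD i ` LD i)"
    then show "A \<in> e ` Z" using eD GZ by (auto simp: bD_def LD_def)
  next
    fix A assume "A \<in> e ` Z"
    then obtain z where z: "z \<in> Z" "A = e z" by blast
    then have "A \<in> bD (Inl z) ` LD (Inl z)"
      using dD(4,5)[OF eR[OF z(1)]] by (auto simp: bD_def LD_def image_iff intro!: bexI[of _ 0])
    then show "A \<in> (\<Union>i\<in>?ND. bD i ` LD i)" using z by blast
  qed
  have "e ` Z \<subseteq> Obj B" using eR by (auto simp: R_def)
  then have objC: "bC i j \<in> Obj B" if "i \<in> ?NC" "j \<in> LC i" for i j
    using imgC that by blast
  have objD: "bD i j \<in> Obj B" if "i \<in> ?ND" "j \<in> LD i" for i j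
    using imgD that \<open>e ` Z \<subseteq> Obj B\<close> by blast
  \<comment> \<open>The expanded families for \<open>C\<close> and \<open>D\<close> have the same
    values, namely all objects named by words; this is where the two halves of the chain
    meet.\<close>
  have "k_equivalent K (family_cat B \<phi> ?NC LC bC) (family_cat B \<phi> ?ND LD bD)"
    using objC imgC imgD by (intro family_cat_equivalent[OF B \<phi> \<phi>]) (blast, simp only:)
  moreover have "k_category K (family_cat B \<phi> ?NC LC bC)" "k_category K (family_cat B \<phi> ?ND LD bD)"
    unfolding family_cat_def using objC objD
    by (auto intro!: k_category_pull_cat[OF B] simp: inv_f_f[OF \<phi>])
  ultimately have "morita_step K (family_cat B \<phi> ?NC LC bC) (family_cat B \<phi> ?ND LD bD)"
    by (simp add: morita_step_def)
  with 1 2 show ?thesis by (meson r_into_rtranclp rtranclp_trans)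
qed

section \<open>Recoding the morphisms of a category\<close>

text \<open>Operations decode their arguments, compute in \<open>C\<close> and encode the result.
  Each pair of objects has its own code, because the injections into the new morphism type are found
  separately for each morphism space.\<close>

definition encode_cat ::
  "('o, 'm, 'k) kcat \<Rightarrow> 'o set \<Rightarrow> ('o \<Rightarrow> 'o \<Rightarrow> 'm \<Rightarrow> 'n) \<Rightarrow> ('o, 'n, 'k) kcat" where
  "encode_cat C W enc =
    \<lparr>Obj = W, Hom = (\<lambda>x y. image_space (enc x y) (Hom C x y)),
     Comp = (\<lambda>x y z g f. enc x z (Comp C x y z
       (inv_into (carrier (Hom C y z)) (enc y z) g) (inv_into (carrier (Hom C x y)) (enc x y) f))),
     Ident = (\<lambda>x. enc x x (Ident C x))\<rparr>"

lemma encode_cat_simps: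
  "Obj (encode_cat C W enc) = W"
  "Hom (encode_cat C W enc) x y = image_space (enc x y) (Hom C x y)"
  "Comp (encode_cat C W enc) x y z g f = enc x z (Comp C x y z
       (inv_into (carrier (Hom C y z)) (enc y z) g) (inv_into (carrier (Hom C x y)) (enc x y) f))"
  "Ident (encode_cat C W enc) x = enc x x (Ident C x)"
  by (simp_all add: encode_cat_def)

context k_category
begin

lemma encode_cat:
  assumes W: "W \<subseteq> Obj C" and inj: "\<And>x y. x \<in> W \<Longrightarrow> y \<in> W \<Longrightarrow> inj_on (enc x y) (carrier (Hom C x y))"
  shows "k_category K (encode_cat C W enc)" (is "k_category K ?E")
    and "fully_faithful K (pull_cat C (\<lambda>x. x) W) (encode_cat C W enc) \<lparr>fobj = \<lambda>x. x, fmor = enc\<rparr>"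
proof -
  have W: "x \<in> Obj C" if "x \<in> W" for x using that W by auto
  note cong = linear_congruence_inj[OF inj]
  have lin: "enc x y \<in> linear_maps K (Hom C x y) (image_space (enc x y) (Hom C x y))" if "x \<in> W" "y \<in> W" for x y
    using that by (intro image_space_linear hom_space cong W)
  note e = linear_mapsD(2,3)[OF lin, symmetric]
  show "k_category K ?E"
  proof (intro k_category.intro k_category_axioms.intro field_axioms)
    show "module K (Hom ?E x y)" if "x \<in> Obj ?E" "y \<in> Obj ?E" for x y
      using that by (auto simp: encode_cat_simps intro!: module_image_space hom_space cong W)
    show "Ident ?E x \<in> carrier (Hom ?E x x)" if "x \<in> Obj ?E" for x
      using that by (auto simp: encode_cat_simps carrier_image_space ident_closed W)
    show "(\<lambda>g. Comp ?E x y z g f) \<in> linear_maps K (Hom ?E y z) (Hom ?E x z)"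
      if "x \<in> Obj ?E" "y \<in> Obj ?E" "z \<in> Obj ?E" "f \<in> carrier (Hom ?E x y)" for x y z f
      using that by (intro linear_mapsI)
        (auto simp: encode_cat_simps carrier_image_space inj W e comp_closed comp_add_left comp_smult_left
          add_hom module.smult_closed[OF hom_space])
    show "(\<lambda>f. Comp ?E x y z g f) \<in> linear_maps K (Hom ?E x y) (Hom ?E x z)"
      if "x \<in> Obj ?E" "y \<in> Obj ?E" "z \<in> Obj ?E" "g \<in> carrier (Hom ?E y z)" for x y z g
      using that by (intro linear_mapsI)
        (auto simp: encode_cat_simps carrier_image_space inj W e comp_closed comp_add_right comp_smult_right
          add_hom module.smult_closed[OF hom_space])
    show "Comp ?E w y z h (Comp ?E w x y g f) = Comp ?E w x z (Comp ?E x y z h g) f"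
      if "w \<in> Obj ?E" "x \<in> Obj ?E" "y \<in> Obj ?E" "z \<in> Obj ?E" "f \<in> carrier (Hom ?E w x)"
        "g \<in> carrier (Hom ?E x y)" "h \<in> carrier (Hom ?E y z)" for w x y z f g h
      using that by (auto simp: encode_cat_simps carrier_image_space inj W comp_closed comp_assoc)
    show "Comp ?E x y y (Ident ?E y) f = f" "Comp ?E x x y f (Ident ?E x) = f"
      if "x \<in> Obj ?E" "y \<in> Obj ?E" "f \<in> carrier (Hom ?E x y)" for x y f
      using that by (auto simp: encode_cat_simps carrier_image_space inj W ident_closed comp_ident_left comp_ident_right)
  qed
  show "fully_faithful K (pull_cat C (\<lambda>x. x) W) ?E \<lparr>fobj = \<lambda>x. x, fmor = enc\<rparr>"
    unfolding fully_faithful_def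
    by (auto intro!: k_functorI simp: lin encode_cat_simps inj W carrier_image_space bij_betw_def)
qed

lemma thru_full_subcategory:
  "f \<in> thru C T x y \<Longrightarrow> f \<in> thru (pull_cat C (\<lambda>x. x) W) T x y"
proof (induction rule: thru.induct)
  case zero
  show ?case using thru.zero[of "pull_cat C (\<lambda>x. x) W"] by simp
next
  case (add f t u v)
  then show ?case using thru.add[of f "pull_cat C (\<lambda>x. x) W" T x y t u v] by simp
qed

text \<open>As the identity of \<open>x\<close> is a finite sum of \<open>v j\<close> after
  \<open>u j\<close>, a morphism out of \<open>x\<close> is determined by its composites with the
  \<open>v j\<close>. The codes of these composites form a list, which again has a code in
  \<open>'u\<close>.\<close>

lemma small_hom_left:
  assumes inf: "infinite (UNIV :: 'u set)" and T: "T \<subseteq> Obj C" and x: "x \<in> Obj C" "Ident C x \<in> thru C T x x"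
    and y: "y \<in> Obj C" and small: "\<And>t. t \<in> T \<Longrightarrow> \<exists>f :: 'm \<Rightarrow> 'u. inj_on f (carrier (Hom C t y))"
  shows "\<exists>f :: 'm \<Rightarrow> 'u. inj_on f (carrier (Hom C x y))"
proof -
  obtain n :: nat and t u v where
    tuv: "\<And>j. j < n \<Longrightarrow> t j \<in> T \<and> Ident C (t j) \<noteq> \<zero>\<^bsub>Hom C (t j) (t j)\<^esub> \<and>
      u j \<in> carrier (Hom C x (t j)) \<and> v j \<in> carrier (Hom C (t j) x)"
    and sum: "Ident C x = (\<Oplus>\<^bsub>Hom C x x\<^esub>j\<in>{..<n}. Comp C x (t j) x (v j) (u j))"
    using thru_family[OF x(2) T x(1) x(1)] by blast
  define e :: "'o \<Rightarrow> 'm \<Rightarrow> 'u" where "e s = (SOME f. inj_on f (carrier (Hom C s y)))" for s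
  have e: "inj_on (e s) (carrier (Hom C s y))" if "s \<in> T" for s
    unfolding e_def using small[OF that] by (rule someI_ex)
  obtain c :: "'u list \<Rightarrow> 'u" where c: "inj c" using infinite_inj_list[OF inf] by blast
  have tO: "t j \<in> Obj C" if "j < n" for j using tuv that T by blast
  have expand: "f = (\<Oplus>\<^bsub>Hom C x y\<^esub>j\<in>{..<n}. Comp C x (t j) y (Comp C (t j) x y f (v j)) (u j))"
    if f: "f \<in> carrier (Hom C x y)" for f
  proof -
    have "f = Comp C x x y f (Ident C x)" using f x y by (simp add: comp_ident_right)
    also have "\<dots> = (\<Oplus>\<^bsub>Hom C x y\<^esub>j\<in>{..<n}. Comp C x x y f (Comp C x (t j) x (v j) (u j)))"
      unfolding sum using f x y tO tuv by (intro comp_finsum_right) (auto intro!: comp_closed)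
    also have "\<dots> = (\<Oplus>\<^bsub>Hom C x y\<^esub>j\<in>{..<n}. Comp C x (t j) y (Comp C (t j) x y f (v j)) (u j))"
      using f x y tO tuv by (intro abelian_monoid.finsum_cong'[OF hom_monoid])
        (auto simp: comp_assoc intro!: comp_closed)
    finally show ?thesis .
  qed
  have "inj_on (\<lambda>f. c (map (\<lambda>j. e (t j) (Comp C (t j) x y f (v j))) [0..<n])) (carrier (Hom C x y))"
  proof (rule inj_onI)
    fix f g assume f: "f \<in> carrier (Hom C x y)" and g: "g \<in> carrier (Hom C x y)"
      and eq: "c (map (\<lambda>j. e (t j) (Comp C (t j) x y f (v j))) [0..<n]) =
        c (map (\<lambda>j. e (t j) (Comp C (t j) x y g (v j))) [0..<n])"
    have fv: "Comp C (t j) x y f (v j) = Comp C (t j) x y g (v j)" if "j < n" for j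
    proof (rule inj_onD[OF e])
      show "e (t j) (Comp C (t j) x y f (v j)) = e (t j) (Comp C (t j) x y g (v j))"
        using injD[OF c eq] that by auto
    qed (use f g x y tO tuv that in \<open>auto intro!: comp_closed\<close>)
    have "f = (\<Oplus>\<^bsub>Hom C x y\<^esub>j\<in>{..<n}. Comp C x (t j) y (Comp C (t j) x y f (v j)) (u j))"
      by (rule expand[OF f])
    also have "\<dots> = (\<Oplus>\<^bsub>Hom C x y\<^esub>j\<in>{..<n}. Comp C x (t j) y (Comp C (t j) x y g (v j)) (u j))"
      using g x y tO tuv fv by (intro abelian_monoid.finsum_cong'[OF hom_monoid]) (auto intro!: comp_closed)
    also have "\<dots> = g" by (rule expand[OF g, symmetric])
    finally show "f = g" .
  qed
  then show ?thesis by blast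
qed

end

section \<open>Opposite categories\<close>

definition op_cat :: "('o, 'm, 'k) kcat \<Rightarrow> ('o, 'm, 'k) kcat" where
  "op_cat C = \<lparr>Obj = Obj C, Hom = (\<lambda>x y. Hom C y x), Comp = (\<lambda>x y z g f. Comp C z y x f g), Ident = Ident C\<rparr>"

lemma op_cat_simps [simp]:
  "Obj (op_cat C) = Obj C" "Hom (op_cat C) x y = Hom C y x"
  "Comp (op_cat C) x y z g f = Comp C z y x f g" "Ident (op_cat C) = Ident C"
  by (simp_all add: op_cat_def)

lemma op_cat_op_cat [simp]: "op_cat (op_cat C) = C"
  by (simp add: op_cat_def)

text \<open>One inclusion, shown for every category, yields the other when applied to the opposite
  category.\<close>

lemma thru_op_cat:
  fixes C :: "('o, 'm, 'k) kcat"
  shows "thru (op_cat C) T x y = thru C T y x"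
proof -
  have "f \<in> thru (op_cat C) T x y" if "f \<in> thru C T y x" for f and C :: "('o, 'm, 'k) kcat" and x y
    using that
  proof (induction rule: thru.induct)
    case zero
    show ?case using thru.zero[of "op_cat C" x y T] by simp
  next
    case (add f t u v)
    then show ?case using thru.add[of f "op_cat C" T x y t v u] by simp
  qed
  from this[of _ C y x] this[of _ "op_cat C" x y] show ?thesis by auto
qed

lemma biproduct_op_cat: "biproduct C J t s i p \<Longrightarrow> biproduct (op_cat C) J t s p i"
  unfolding biproduct_def by auto

lemma has_biproducts_op_cat: "has_biproducts C \<Longrightarrow> has_biproducts (op_cat C)"
  unfolding has_biproducts_def op_cat_simps by (meson biproduct_op_cat)

lemma splits_idempotents_op_cat: "splits_idempotents C \<Longrightarrow> splits_idempotents (op_cat C)"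
  unfolding splits_idempotents_def op_cat_simps by blast

context k_category
begin

lemma op_cat: "k_category K (op_cat C)"
  by (intro k_category.intro k_category_axioms.intro field_axioms)
    (simp_all add: ident_closed comp_ident_left comp_ident_right
        comp_linear_left comp_linear_right hom_space, simp add: comp_assoc)

lemma small_hom_right:
  assumes inf: "infinite (UNIV :: 'u set)" and T: "T \<subseteq> Obj C" and y: "y \<in> Obj C" "Ident C y \<in> thru C T y y"
    and x: "x \<in> Obj C" and small: "\<And>t. t \<in> T \<Longrightarrow> \<exists>f :: 'm \<Rightarrow> 'u. inj_on f (carrier (Hom C x t))"
  shows "\<exists>f :: 'm \<Rightarrow> 'u. inj_on f (carrier (Hom C x y))"
proof -
  interpret op: k_category K "op_cat C" by (rule op_cat)
  show ?thesis using op.small_hom_left[OF inf, of T y x] assms by (simp add: thru_op_cat)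
qed

end

text \<open>On the full subcategory \<open>W\<close> of retracts of finite sums of objects of
  \<open>D\<close>, the morphism spaces are small enough to be recoded in \<open>'u\<close>. It
  contains the images of \<open>C\<close> and \<open>D\<close> and is closed under finite biproducts
  and under splitting idempotents, so the previous result applies to it.\<close>

lemma morita_steps_large_ambient:
  fixes B :: "('o, 'm, 'k) kcat" and C D :: "('u, 'u, 'k) kcat"
  assumes inf: "infinite (UNIV :: 'u set)"
    and B: "k_category K B" and C: "k_category K C" and D: "k_category K D"
    and F: "fully_faithful K C B F" and G: "fully_faithful K D B G"
    and split: "splits_idempotents B" and has: "has_biproducts B"
    and FG: "\<And>x. x \<in> Obj C \<Longrightarrow> Ident B (fobj F x) \<in> thru B (fobj G ` Obj D) (fobj F x) (fobj F x)"
    and GF: "\<And>y. y \<in> Obj D \<Longrightarrow> Ident B (fobj G y) \<in> thru B (fobj F ` Obj C) (fobj G y) (fobj G y)"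
  shows "(morita_step K)\<^sup>*\<^sup>* C D"
proof -
  interpret B: k_category K B by fact
  interpret D: k_category K D by fact
  let ?TC = "fobj F ` Obj C" and ?TD = "fobj G ` Obj D"
  have TC: "?TC \<subseteq> Obj B" and TD: "?TD \<subseteq> Obj B"
    using k_functorD(1)[OF fully_faithfulD(1)[OF F]] k_functorD(1)[OF fully_faithfulD(1)[OF G]] by auto
  define W where "W = {A \<in> Obj B. Ident B A \<in> thru B ?TD A A}"
  have W: "W \<subseteq> Obj B" by (auto simp: W_def)
  have TCW: "?TC \<subseteq> W" using TC FG by (auto simp: W_def)
  have TDW: "?TD \<subseteq> W"
  proof
    fix A assume A: "A \<in> ?TD"
    then have "Ident B A \<in> thru B ?TC A A" "A \<in> Obj B" using GF TD by auto
    moreover have "Ident B t \<in> thru B ?TD t t" if "t \<in> ?TC" for t using FG that by blast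
    ultimately have "Ident B A \<in> thru B ?TD A A" using B.thru_trans[OF _ _ TC TD, of "Ident B A" A A] by blast
    then show "A \<in> W" using \<open>A \<in> Obj B\<close> by (simp add: W_def)
  qed
  have "\<exists>f :: 'm \<Rightarrow> 'u. inj_on f (carrier (Hom B x y))" if xy: "x \<in> W" "y \<in> W" for x y
  proof -
    \<comment> \<open>Between objects coming from \<open>D\<close>, full faithfulness of
      \<open>G\<close> supplies codes. They are then extended to all of \<open>W\<close>, first in
      the target and then in the source.\<close>
    have 0: "\<exists>f :: 'm \<Rightarrow> 'u. inj_on f (carrier (Hom B s t))" if st: "s \<in> ?TD" "t \<in> ?TD" for s t
    proof -
      obtain a b where ab: "a \<in> Obj D" "b \<in> Obj D" "s = fobj G a" "t = fobj G b" using st by blast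
      show ?thesis
        using bij_betw_imp_inj_on[OF bij_betw_inv_into[OF fully_faithfulD(2)[OF G ab(1,2)]]]
        unfolding ab(3,4) by blast
    qed
    have 1: "\<exists>f :: 'm \<Rightarrow> 'u. inj_on f (carrier (Hom B s y))" if "s \<in> ?TD" for s
      by (rule B.small_hom_right[OF inf TD]) (use that TD xy 0 W in \<open>auto simp: W_def\<close>)
    show ?thesis
      by (rule B.small_hom_left[OF inf TD]) (use 1 xy in \<open>auto simp: W_def\<close>)
  qed
  then obtain enc :: "'o \<Rightarrow> 'o \<Rightarrow> 'm \<Rightarrow> 'u" where
    inj: "\<And>x y. x \<in> W \<Longrightarrow> y \<in> W \<Longrightarrow> inj_on (enc x y) (carrier (Hom B x y))" by metis
  let ?P = "pull_cat B (\<lambda>x. x) W" and ?E = "encode_cat B W enc"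
  let ?e = "\<lparr>fobj = \<lambda>x :: 'o. x, fmor = enc\<rparr>"
  have P: "k_category K ?P" using W by (intro k_category_pull_cat[OF B]) auto
  have E: "k_category K ?E" and e: "fully_faithful K ?P ?E ?e"
    by (rule B.encode_cat[OF W inj], assumption+)+
  interpret P: k_category K ?P by fact
  interpret E: k_category K ?E by fact
  have FP: "fully_faithful K C ?P F"
    using F TCW unfolding fully_faithful_def k_functor_def by auto
  have GP: "fully_faithful K D ?P G"
    using G TDW unfolding fully_faithful_def k_functor_def by auto
  have thruE: "Ident ?E x \<in> thru ?E T x x" if "Ident B x \<in> thru B T x x" "x \<in> W" "T \<subseteq> W" for x T
    using thru_functor[OF B.thru_full_subcategory[OF that(1)] fully_faithfulD(1)[OF e] P E] that
    by (simp add: encode_cat_simps)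
  show ?thesis
  proof (rule morita_steps_ambient[OF inf E C D fully_faithful_comp[OF FP e] fully_faithful_comp[OF GP e]])
    have "has_biproducts ?P"
      unfolding has_biproducts_def
    proof (intro allI impI)
      fix n :: nat and t assume t: "\<forall>j<n. t j \<in> Obj ?P"
      then obtain s i p where bp: "biproduct B {..<n} t s i p"
        using has W unfolding has_biproducts_def by (metis pull_cat_simps(1) subsetD)
      note bpD = biproductD[OF bp]
      have tW: "t ` {..<n} \<subseteq> W" using t by auto
      \<comment> \<open>The biproduct stays in \<open>W\<close>: its identity factors through the
        \<open>t j\<close>, and their identities factor through objects of \<open>D\<close>.\<close>
      have "Ident B s \<in> thru B (t ` {..<n}) s s" using tW W by (intro B.biproduct_thru[OF bp]) auto
      then have "Ident B s \<in> thru B ?TD s s"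
        by (rule B.thru_trans) (use tW W TD bpD in \<open>auto simp: W_def\<close>)
      then have "s \<in> W" using bpD by (simp add: W_def)
      then have "biproduct ?P {..<n} t s i p" using bp tW by (auto simp: biproduct_def)
      then show "\<exists>s i p. biproduct ?P {..<n} t s i p" by blast
    qed
    then show "has_biproducts ?E"
      unfolding has_biproducts_def
    proof (intro allI impI)
      fix n :: nat and t assume "\<forall>j<n. t j \<in> Obj ?E"
      then obtain s i p where "biproduct ?P {..<n} t s i p"
        using \<open>has_biproducts ?P\<close> unfolding has_biproducts_def encode_cat_simps pull_cat_simps by blast
      from P.biproduct_functor[OF this fully_faithfulD(1)[OF e] E]
      show "\<exists>s i p. biproduct ?E {..<n} t s i p" unfolding kfunctor.simps by blast
    qed
    show "splits_idempotents ?E" unfolding splits_idempotents_def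
    proof (intro ballI impI)
      fix x c assume x: "x \<in> Obj ?E" and c: "c \<in> carrier (Hom ?E x x)" "Comp ?E x x x c c = c"
      have x': "x \<in> W" "x \<in> Obj B" using x W by (auto simp: encode_cat_simps)
      obtain d where d: "d \<in> carrier (Hom B x x)" "c = enc x x d"
        using c by (auto simp: encode_cat_simps carrier_image_space)
      have "enc x x (Comp B x x x d d) = enc x x d"
        using c(2) d x' inj by (simp add: encode_cat_simps)
      then have "Comp B x x x d d = d"
        using inj_onD[OF inj[OF x'(1) x'(1)]] d B.comp_closed x' by blast
      then obtain y q j where y: "y \<in> Obj B" and q: "q \<in> carrier (Hom B x y)" and j: "j \<in> carrier (Hom B y x)"
        and qj: "Comp B y x y q j = Ident B y" and jq: "Comp B x y x j q = d"
        using split x' d unfolding splits_idempotents_def by blast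
      \<comment> \<open>The splitting object is a retract of \<open>x\<close>, so its identity
        \<open>q\<close> after \<open>j\<close> inherits the factorization of the identity of
        \<open>x\<close>.\<close>
      have "Comp B y x x (Ident B x) j \<in> thru B ?TD y x"
        using x' y j TD by (intro B.thru_comp_right) (auto simp: W_def)
      then have "Comp B y x y q j \<in> thru B ?TD y y"
        using x' y j q TD by (intro B.thru_comp_left) (auto simp: B.comp_ident_left)
      then have yW: "y \<in> W" using y qj by (simp add: W_def)
      show "\<exists>y\<in>Obj ?E. \<exists>q\<in>carrier (Hom ?E x y). \<exists>j\<in>carrier (Hom ?E y x).
        Comp ?E y x y q j = Ident ?E y \<and> Comp ?E x y x j q = c"
      proof (intro bexI conjI)
        show "Comp ?E y x y (enc x y q) (enc y x j) = Ident ?E y" "Comp ?E x y x (enc y x j) (enc x y q) = c"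
          using q j qj jq x' yW inj d by (simp_all add: encode_cat_simps)
      qed (use yW q j in \<open>auto simp: encode_cat_simps carrier_image_space\<close>)
    qed
  qed (use thruE FG GF TCW TDW in \<open>auto simp: comp_functor_def image_subset_iff\<close>)
qed

section \<open>The category of modules\<close>

lemma vect_cat_simps:
  "Obj (vect_cat K) = {V. module K V}"
  "carrier (Hom (vect_cat K) V W) = linear_maps K V W \<inter> extensional (carrier V)"
  "\<zero>\<^bsub>Hom (vect_cat K) V W\<^esub> = (\<lambda>v\<in>carrier V. \<zero>\<^bsub>W\<^esub>)"
  "f \<oplus>\<^bsub>Hom (vect_cat K) V W\<^esub> g = (\<lambda>v\<in>carrier V. f v \<oplus>\<^bsub>W\<^esub> g v)"
  "a \<odot>\<^bsub>Hom (vect_cat K) V W\<^esub> f = (\<lambda>v\<in>carrier V. a \<odot>\<^bsub>W\<^esub> f v)"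
  "Comp (vect_cat K) U V W g f = compose (carrier U) g f"
  "Ident (vect_cat K) V = (\<lambda>v\<in>carrier V. v)"
  by (simp_all add: vect_cat_def prod_space_def)

lemma functor_cat_simps:
  "Obj (functor_cat K C D) = {F. k_functor K C D F}"
  "carrier (Hom (functor_cat K C D) F G) = nat_transformations C D F G"
  "\<zero>\<^bsub>Hom (functor_cat K C D) F G\<^esub> = (\<lambda>x\<in>Obj C. \<zero>\<^bsub>Hom D (fobj F x) (fobj G x)\<^esub>)"
  "\<eta> \<oplus>\<^bsub>Hom (functor_cat K C D) F G\<^esub> \<theta> = (\<lambda>x\<in>Obj C. \<eta> x \<oplus>\<^bsub>Hom D (fobj F x) (fobj G x)\<^esub> \<theta> x)"
  "a \<odot>\<^bsub>Hom (functor_cat K C D) F G\<^esub> \<eta> = (\<lambda>x\<in>Obj C. a \<odot>\<^bsub>Hom D (fobj F x) (fobj G x)\<^esub> \<eta> x)"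
  "Comp (functor_cat K C D) F G H \<theta> \<eta> =
    (\<lambda>x\<in>Obj C. Comp D (fobj F x) (fobj G x) (fobj H x) (\<theta> x) (\<eta> x))"
  "Ident (functor_cat K C D) F = (\<lambda>x\<in>Obj C. Ident D (fobj F x))"
  by (simp_all add: functor_cat_def prod_space_def)

lemma k_category_vect_cat:
  assumes "field K"
  shows "k_category K (vect_cat K :: (('k, 'v) module, 'v \<Rightarrow> 'v, 'k) kcat)" (is "k_category K ?V")
proof (intro k_category.intro k_category_axioms.intro assms)
  interpret K: field K by fact
  fix V W assume "V \<in> Obj ?V" "W \<in> Obj ?V"
  then have V: "module K V" and W: "module K W" by (auto simp: vect_cat_simps)
  interpret V: module K V by fact
  interpret W: module K W by fact
  have "module K ((prod_space (carrier V) (\<lambda>_. W))\<lparr>carrier := linear_maps K V W \<inter> extensional (carrier V)\<rparr>)"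
  proof (rule module_restrict_carrier)
    show "module K (prod_space (carrier V) (\<lambda>_. W))" by (intro module_prod_space K.is_cring W)
    show "linear_maps K V W \<inter> extensional (carrier V) \<subseteq> carrier (prod_space (carrier V) (\<lambda>_. W))"
      by (simp add: prod_space_simps PiE_def linear_maps_def) blast
    show "\<zero>\<^bsub>prod_space (carrier V) (\<lambda>_. W)\<^esub> \<in> linear_maps K V W \<inter> extensional (carrier V)"
      by (auto simp: prod_space_simps intro!: linear_mapsI)
    fix f g assume fg: "f \<in> linear_maps K V W \<inter> extensional (carrier V)" "g \<in> linear_maps K V W \<inter> extensional (carrier V)"
    then show "f \<oplus>\<^bsub>prod_space (carrier V) (\<lambda>_. W)\<^esub> g \<in> linear_maps K V W \<inter> extensional (carrier V)"
      by (auto simp: prod_space_simps linear_mapsD W.a_ac W.smult_r_distr intro!: linear_mapsI)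
  next
    fix a f assume a: "a \<in> carrier K" and f: "f \<in> linear_maps K V W \<inter> extensional (carrier V)"
    have "a \<odot>\<^bsub>W\<^esub> (b \<odot>\<^bsub>W\<^esub> w) = b \<odot>\<^bsub>W\<^esub> (a \<odot>\<^bsub>W\<^esub> w)" if "b \<in> carrier K" "w \<in> carrier W" for b w
      using a that by (simp add: W.smult_assoc1[symmetric] K.m_comm)
    then show "a \<odot>\<^bsub>prod_space (carrier V) (\<lambda>_. W)\<^esub> f \<in> linear_maps K V W \<inter> extensional (carrier V)"
      using a f by (auto simp: prod_space_simps linear_mapsD W.smult_r_distr intro!: linear_mapsI)
  qed
  then show "module K (Hom ?V V W)" by (simp add: vect_cat_def)
next
  fix V assume "V \<in> Obj ?V"
  then interpret V: module K V by (simp add: vect_cat_simps)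
  show "Ident ?V V \<in> carrier (Hom ?V V V)"
    by (auto simp: vect_cat_simps intro!: linear_mapsI)
next
  fix U V W f assume "U \<in> Obj ?V" "V \<in> Obj ?V" "W \<in> Obj ?V" and f: "f \<in> carrier (Hom ?V U V)"
  then interpret U: module K U + V: module K V + W: module K W by (simp_all add: vect_cat_simps)
  show "(\<lambda>g. Comp ?V U V W g f) \<in> linear_maps K (Hom ?V V W) (Hom ?V U W)"
    using f by (intro linear_mapsI)
      (auto simp: vect_cat_simps compose_def linear_mapsD fun_eq_iff intro!: linear_mapsI)
next
  fix U V W g assume "U \<in> Obj ?V" "V \<in> Obj ?V" "W \<in> Obj ?V" and g: "g \<in> carrier (Hom ?V V W)"
  then interpret U: module K U + V: module K V + W: module K W by (simp_all add: vect_cat_simps)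
  show "(\<lambda>f. Comp ?V U V W g f) \<in> linear_maps K (Hom ?V U V) (Hom ?V U W)"
    using g by (intro linear_mapsI)
      (auto simp: vect_cat_simps compose_def linear_mapsD fun_eq_iff intro!: linear_mapsI)
qed (auto simp: vect_cat_simps compose_def linear_mapsD fun_eq_iff extensional_def)

section \<open>Functor categories, and modules in terms of their elements\<close>

lemma nat_transformationsD:
  assumes "\<eta> \<in> nat_transformations C D F G"
  shows "\<And>x. x \<in> Obj C \<Longrightarrow> \<eta> x \<in> carrier (Hom D (fobj F x) (fobj G x))"
    and "\<And>x y f. \<lbrakk>x \<in> Obj C; y \<in> Obj C; f \<in> carrier (Hom C x y)\<rbrakk> \<Longrightarrow>
        Comp D (fobj F x) (fobj F y) (fobj G y) (\<eta> y) (fmor F x y f) =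
        Comp D (fobj F x) (fobj G x) (fobj G y) (fmor G x y f) (\<eta> x)"
    and "\<eta> \<in> extensional (Obj C)"
  using assms unfolding nat_transformations_def by (auto simp: PiE_iff)

lemma nat_transformationsI:
  assumes "\<And>x. x \<in> Obj C \<Longrightarrow> \<eta> x \<in> carrier (Hom D (fobj F x) (fobj G x))"
    and "\<And>x y f. \<lbrakk>x \<in> Obj C; y \<in> Obj C; f \<in> carrier (Hom C x y)\<rbrakk> \<Longrightarrow>
        Comp D (fobj F x) (fobj F y) (fobj G y) (\<eta> y) (fmor F x y f) =
        Comp D (fobj F x) (fobj G x) (fobj G y) (fmor G x y f) (\<eta> x)"
    and "\<eta> \<in> extensional (Obj C)"
  shows "\<eta> \<in> nat_transformations C D F G"
  using assms unfolding nat_transformations_def by (auto simp: PiE_iff)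

lemma k_category_functor_cat:
  assumes "k_category K D"
  shows "k_category K (functor_cat K C D)" (is "k_category K ?F")
proof -
  interpret D: k_category K D by fact
  have ob: "fobj F x \<in> Obj D" if "F \<in> Obj ?F" "x \<in> Obj C" for F x
    using that k_functorD(1) by (auto simp: functor_cat_simps)
  have mo: "fmor F x y f \<in> carrier (Hom D (fobj F x) (fobj F y))"
    if "F \<in> Obj ?F" "x \<in> Obj C" "y \<in> Obj C" "f \<in> carrier (Hom C x y)" for F x y f
    using that k_functorD(5) by (auto simp: functor_cat_simps)
  have sm: "a \<odot>\<^bsub>Hom D (fobj F x) (fobj G x)\<^esub> h \<in> carrier (Hom D (fobj F x) (fobj G x))"
    if "F \<in> Obj ?F" "G \<in> Obj ?F" "x \<in> Obj C" "a \<in> carrier K" "h \<in> carrier (Hom D (fobj F x) (fobj G x))" for F G x a h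
    using that ob by (intro module.smult_closed[OF D.hom_space]) auto
  show ?thesis
  proof (intro k_category.intro k_category_axioms.intro D.field_axioms)
    fix F G assume F: "F \<in> Obj ?F" and G: "G \<in> Obj ?F"
    let ?P = "prod_space (Obj C) (\<lambda>x. Hom D (fobj F x) (fobj G x))"
    have "module K (?P\<lparr>carrier := nat_transformations C D F G\<rparr>)"
    proof (rule module_restrict_carrier)
      show "module K ?P" using F G ob by (intro module_prod_space D.cring_K D.hom_space)
      show "nat_transformations C D F G \<subseteq> carrier ?P"
        by (auto simp: nat_transformations_def prod_space_simps)
      show "\<zero>\<^bsub>?P\<^esub> \<in> nat_transformations C D F G"
        using F G by (intro nat_transformationsI)
          (auto simp: prod_space_simps D.zero_hom ob mo D.comp_zero_left D.comp_zero_right)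
      fix \<eta> \<theta> assume "\<eta> \<in> nat_transformations C D F G" "\<theta> \<in> nat_transformations C D F G"
      then show "\<eta> \<oplus>\<^bsub>?P\<^esub> \<theta> \<in> nat_transformations C D F G"
        using F G by (intro nat_transformationsI)
          (auto simp: prod_space_simps D.add_hom ob mo D.comp_add_left D.comp_add_right nat_transformationsD)
    next
      fix a \<eta> assume "a \<in> carrier K" "\<eta> \<in> nat_transformations C D F G"
      then show "a \<odot>\<^bsub>?P\<^esub> \<eta> \<in> nat_transformations C D F G"
        using F G by (intro nat_transformationsI)
          (auto simp: prod_space_simps sm ob mo D.comp_smult_left D.comp_smult_right nat_transformationsD)
    qed
    then show "module K (Hom ?F F G)" by (simp add: functor_cat_def)
  next
    fix F assume F: "F \<in> Obj ?F"
    show "Ident ?F F \<in> carrier (Hom ?F F F)"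
      unfolding functor_cat_simps
      using F by (intro nat_transformationsI) (auto simp: D.ident_closed ob mo D.comp_ident_left D.comp_ident_right)
  next
    fix F G H assume F: "F \<in> Obj ?F" and G: "G \<in> Obj ?F" and H: "H \<in> Obj ?F"
    have c: "Comp ?F F G H \<theta> \<eta> \<in> carrier (Hom ?F F H)"
      if "\<eta> \<in> carrier (Hom ?F F G)" "\<theta> \<in> carrier (Hom ?F G H)" for \<eta> \<theta>
    proof -
      have nt: "\<eta> \<in> nat_transformations C D F G" "\<theta> \<in> nat_transformations C D G H"
        using that by (simp_all add: functor_cat_simps)
      note n = nat_transformationsD[OF nt(1)] nat_transformationsD[OF nt(2)]
      show ?thesis unfolding functor_cat_simps
      proof (rule nat_transformationsI)
        fix x y f assume xy: "x \<in> Obj C" "y \<in> Obj C" "f \<in> carrier (Hom C x y)"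
        let ?F = "fobj F" and ?G = "fobj G" and ?H = "fobj H"
        have "Comp D (?F x) (?F y) (?H y) (Comp D (?F y) (?G y) (?H y) (\<theta> y) (\<eta> y)) (fmor F x y f) =
          Comp D (?F x) (?G y) (?H y) (\<theta> y) (Comp D (?F x) (?F y) (?G y) (\<eta> y) (fmor F x y f))"
          using xy F G H n(1,4) by (intro D.comp_assoc[symmetric]) (auto simp: ob mo)
        also have "\<dots> = Comp D (?F x) (?G y) (?H y) (\<theta> y) (Comp D (?F x) (?G x) (?G y) (fmor G x y f) (\<eta> x))"
          using xy n by simp
        also have "\<dots> = Comp D (?F x) (?G x) (?H y) (Comp D (?G x) (?G y) (?H y) (\<theta> y) (fmor G x y f)) (\<eta> x)"
          using xy F G H n(1,4) by (intro D.comp_assoc) (auto simp: ob mo)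
        also have "\<dots> = Comp D (?F x) (?G x) (?H y) (Comp D (?G x) (?H x) (?H y) (fmor H x y f) (\<theta> x)) (\<eta> x)"
          using xy n by simp
        also have "\<dots> = Comp D (?F x) (?H x) (?H y) (fmor H x y f) (Comp D (?F x) (?G x) (?H x) (\<theta> x) (\<eta> x))"
          using xy F G H n(1,4) by (intro D.comp_assoc[symmetric]) (auto simp: ob mo)
        finally show "Comp D (?F x) (?F y) (?H y) ((\<lambda>x\<in>Obj C. Comp D (?F x) (?G x) (?H x) (\<theta> x) (\<eta> x)) y) (fmor F x y f) =
          Comp D (?F x) (?H x) (?H y) (fmor H x y f) ((\<lambda>x\<in>Obj C. Comp D (?F x) (?G x) (?H x) (\<theta> x) (\<eta> x)) x)"
          using xy by simp
      qed (use F G H n in \<open>auto simp: ob D.comp_closed\<close>)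
    qed
    show "(\<lambda>\<theta>. Comp ?F F G H \<theta> \<eta>) \<in> linear_maps K (Hom ?F G H) (Hom ?F F H)" if "\<eta> \<in> carrier (Hom ?F F G)" for \<eta>
      using that c F G H nat_transformationsD(1) by (intro linear_mapsI)
        (auto simp: functor_cat_simps fun_eq_iff intro!: D.comp_add_left D.comp_smult_left k_functorD(1)
          dest: nat_transformationsD(1))
    show "(\<lambda>\<eta>. Comp ?F F G H \<theta> \<eta>) \<in> linear_maps K (Hom ?F F G) (Hom ?F F H)" if "\<theta> \<in> carrier (Hom ?F G H)" for \<theta>
      using that c F G H by (intro linear_mapsI)
        (auto simp: functor_cat_simps fun_eq_iff intro!: D.comp_add_right D.comp_smult_right k_functorD(1)
          dest: nat_transformationsD(1))
  next
    fix F G H L \<eta> \<theta> \<kappa> assume "F \<in> Obj ?F" "G \<in> Obj ?F" "H \<in> Obj ?F" "L \<in> Obj ?F"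
      "\<eta> \<in> carrier (Hom ?F F G)" "\<theta> \<in> carrier (Hom ?F G H)" "\<kappa> \<in> carrier (Hom ?F H L)"
    then show "Comp ?F F H L \<kappa> (Comp ?F F G H \<theta> \<eta>) = Comp ?F F G L (Comp ?F G H L \<kappa> \<theta>) \<eta>"
      by (auto simp: functor_cat_simps fun_eq_iff intro!: D.comp_assoc k_functorD(1) dest: nat_transformationsD(1))
  next
    fix F G \<eta> assume "F \<in> Obj ?F" "G \<in> Obj ?F" and \<eta>: "\<eta> \<in> carrier (Hom ?F F G)"
    then show "Comp ?F F G G (Ident ?F G) \<eta> = \<eta>" "Comp ?F F F G \<eta> (Ident ?F F) = \<eta>"
      using nat_transformationsD(3)[of \<eta> C D F G]
      by (auto simp: functor_cat_simps fun_eq_iff extensional_def k_functorD(1) D.comp_ident_left D.comp_ident_right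
          dest: nat_transformationsD(1))
  qed
qed

lemma k_category_module_cat: "field K \<Longrightarrow> k_category K (module_cat K C)"
  unfolding module_cat_def by (intro k_category_functor_cat k_category_vect_cat)

lemma module_cat_simps:
  "Obj (module_cat K C) = {M. k_functor K C (vect_cat K) M}"
  "carrier (Hom (module_cat K C) M N) = nat_transformations C (vect_cat K) M N"
  by (simp_all add: module_cat_def functor_cat_simps)

text \<open>Composition in \<open>vect_cat\<close> is restricted to the source carrier, so the
  functor laws are unfolded for vectors of that carrier only.\<close>

lemma module_functorD:
  assumes "k_functor K C (vect_cat K) M"
  shows "\<And>x. x \<in> Obj C \<Longrightarrow> module K (fobj M x)"
    and "\<And>x y f. \<lbrakk>x \<in> Obj C; y \<in> Obj C; f \<in> carrier (Hom C x y)\<rbrakk> \<Longrightarrow>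
      fmor M x y f \<in> linear_maps K (fobj M x) (fobj M y)"
    and "\<And>x y f. \<lbrakk>x \<in> Obj C; y \<in> Obj C; f \<in> carrier (Hom C x y)\<rbrakk> \<Longrightarrow>
      fmor M x y f \<in> extensional (carrier (fobj M x))"
    and "\<And>x y f g v. \<lbrakk>x \<in> Obj C; y \<in> Obj C; f \<in> carrier (Hom C x y); g \<in> carrier (Hom C x y); v \<in> carrier (fobj M x)\<rbrakk> \<Longrightarrow>
      fmor M x y (f \<oplus>\<^bsub>Hom C x y\<^esub> g) v = fmor M x y f v \<oplus>\<^bsub>fobj M y\<^esub> fmor M x y g v"
    and "\<And>x y f a v. \<lbrakk>x \<in> Obj C; y \<in> Obj C; a \<in> carrier K; f \<in> carrier (Hom C x y); v \<in> carrier (fobj M x)\<rbrakk> \<Longrightarrow>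
      fmor M x y (a \<odot>\<^bsub>Hom C x y\<^esub> f) v = a \<odot>\<^bsub>fobj M y\<^esub> fmor M x y f v"
    and "\<And>x v. \<lbrakk>x \<in> Obj C; v \<in> carrier (fobj M x)\<rbrakk> \<Longrightarrow> fmor M x x (Ident C x) v = v"
    and "\<And>x y z f g v. \<lbrakk>x \<in> Obj C; y \<in> Obj C; z \<in> Obj C; f \<in> carrier (Hom C x y); g \<in> carrier (Hom C y z);
      v \<in> carrier (fobj M x)\<rbrakk> \<Longrightarrow> fmor M x z (Comp C x y z g f) v = fmor M y z g (fmor M x y f v)"
    and "\<And>x y f v. \<lbrakk>x \<in> Obj C; y \<in> Obj C; f \<in> carrier (Hom C x y); v \<in> carrier (fobj M x)\<rbrakk> \<Longrightarrow>
      fmor M x y f v \<in> carrier (fobj M y)"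
proof -
  note M = k_functorD[OF assms]
  show m: "\<And>x y f. \<lbrakk>x \<in> Obj C; y \<in> Obj C; f \<in> carrier (Hom C x y)\<rbrakk> \<Longrightarrow>
      fmor M x y f \<in> linear_maps K (fobj M x) (fobj M y)"
    using M(5) by (auto simp: vect_cat_simps)
  show "\<And>x y f v. \<lbrakk>x \<in> Obj C; y \<in> Obj C; f \<in> carrier (Hom C x y); v \<in> carrier (fobj M x)\<rbrakk> \<Longrightarrow>
      fmor M x y f v \<in> carrier (fobj M y)" using linear_mapsD(1)[OF m] .
qed (use k_functorD(1,3,4,5)[OF assms] linear_mapsD(2,3)[OF k_functorD(2)[OF assms]] in \<open>auto simp: vect_cat_simps compose_def\<close>)

text \<open>The action is cut down to the carrier because morphisms of \<open>vect_cat\<close> are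
  extensional.\<close>

definition module_functor ::
  "('o \<Rightarrow> ('k, 'v) module) \<Rightarrow> ('o \<Rightarrow> 'o \<Rightarrow> 'm \<Rightarrow> 'v \<Rightarrow> 'v) \<Rightarrow> ('o, 'm, ('k, 'v) module, 'v \<Rightarrow> 'v) kfunctor" where
  "module_functor V act = \<lparr>fobj = V, fmor = (\<lambda>x y f. \<lambda>v\<in>carrier (V x). act x y f v)\<rparr>"

lemma module_functor_simps [simp]:
  "fobj (module_functor V act) x = V x"
  "v \<in> carrier (V x) \<Longrightarrow> fmor (module_functor V act) x y f v = act x y f v"
  by (simp_all add: module_functor_def)

lemma module_functorI:
  assumes "\<And>x. x \<in> Obj C \<Longrightarrow> module K (V x)"
    and "\<And>x y f. \<lbrakk>x \<in> Obj C; y \<in> Obj C; f \<in> carrier (Hom C x y)\<rbrakk> \<Longrightarrow> act x y f \<in> linear_maps K (V x) (V y)"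
    and "\<And>x y f g v. \<lbrakk>x \<in> Obj C; y \<in> Obj C; f \<in> carrier (Hom C x y); g \<in> carrier (Hom C x y); v \<in> carrier (V x)\<rbrakk> \<Longrightarrow>
      act x y (f \<oplus>\<^bsub>Hom C x y\<^esub> g) v = act x y f v \<oplus>\<^bsub>V y\<^esub> act x y g v"
    and "\<And>x y f a v. \<lbrakk>x \<in> Obj C; y \<in> Obj C; a \<in> carrier K; f \<in> carrier (Hom C x y); v \<in> carrier (V x)\<rbrakk> \<Longrightarrow>
      act x y (a \<odot>\<^bsub>Hom C x y\<^esub> f) v = a \<odot>\<^bsub>V y\<^esub> act x y f v"
    and "\<And>x v. \<lbrakk>x \<in> Obj C; v \<in> carrier (V x)\<rbrakk> \<Longrightarrow> act x x (Ident C x) v = v"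
    and "\<And>x y z f g v. \<lbrakk>x \<in> Obj C; y \<in> Obj C; z \<in> Obj C; f \<in> carrier (Hom C x y); g \<in> carrier (Hom C y z);
      v \<in> carrier (V x)\<rbrakk> \<Longrightarrow> act x z (Comp C x y z g f) v = act y z g (act x y f v)"
  shows "k_functor K C (vect_cat K) (module_functor V act)"
proof (rule k_functorI)
  fix x y assume xy: "x \<in> Obj C" "y \<in> Obj C"
  have "(\<lambda>v\<in>carrier (V x). act x y f v) \<in> linear_maps K (V x) (V y)" if "f \<in> carrier (Hom C x y)" for f
    using assms(2)[OF xy that] module.axioms(2)[OF assms(1)[OF xy(1)]] module.smult_closed[OF assms(1)[OF xy(1)]]
    by (intro linear_mapsI) (auto simp: linear_mapsD abelian_monoid.a_closed abelian_group.axioms(1))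
  then show "fmor (module_functor V act) x y \<in> linear_maps K (Hom C x y)
      (Hom (vect_cat K) (fobj (module_functor V act) x) (fobj (module_functor V act) y))"
    using xy assms(3,4) by (intro linear_mapsI) (auto simp: vect_cat_simps module_functor_def fun_eq_iff)
qed (use assms(1,5,6) linear_mapsD(1)[OF assms(2)] in
    \<open>auto simp: vect_cat_simps module_functor_def compose_def fun_eq_iff\<close>)

lemma module_natD:
  assumes "\<eta> \<in> nat_transformations C (vect_cat K) M N" "k_functor K C (vect_cat K) M"
  shows "\<And>x. x \<in> Obj C \<Longrightarrow> \<eta> x \<in> linear_maps K (fobj M x) (fobj N x)"
    and "\<And>x. x \<in> Obj C \<Longrightarrow> \<eta> x \<in> extensional (carrier (fobj M x))"
    and "\<And>x y f v. \<lbrakk>x \<in> Obj C; y \<in> Obj C; f \<in> carrier (Hom C x y); v \<in> carrier (fobj M x)\<rbrakk> \<Longrightarrow>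
        \<eta> y (fmor M x y f v) = fmor N x y f (\<eta> x v)"
    and "\<eta> \<in> extensional (Obj C)"
    and "\<And>x v. \<lbrakk>x \<in> Obj C; v \<in> carrier (fobj M x)\<rbrakk> \<Longrightarrow> \<eta> x v \<in> carrier (fobj N x)"
proof -
  note n = nat_transformationsD[OF assms(1)]
  show 1: "\<And>x. x \<in> Obj C \<Longrightarrow> \<eta> x \<in> linear_maps K (fobj M x) (fobj N x)"
    using n(1) by (auto simp: vect_cat_simps)
  show "\<And>x. x \<in> Obj C \<Longrightarrow> \<eta> x \<in> extensional (carrier (fobj M x))"
    using n(1) by (auto simp: vect_cat_simps)
  show "\<eta> y (fmor M x y f v) = fmor N x y f (\<eta> x v)"
    if "x \<in> Obj C" "y \<in> Obj C" "f \<in> carrier (Hom C x y)" "v \<in> carrier (fobj M x)" for x y f v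
    using fun_cong[OF n(2)[OF that(1-3)], of v] that(4) by (simp add: vect_cat_simps compose_def)
  show "\<eta> \<in> extensional (Obj C)" by (rule n)
  show "\<And>x v. \<lbrakk>x \<in> Obj C; v \<in> carrier (fobj M x)\<rbrakk> \<Longrightarrow> \<eta> x v \<in> carrier (fobj N x)"
    using linear_mapsD(1)[OF 1] .
qed

lemma module_natI:
  assumes M: "k_functor K C (vect_cat K) M"
    and "\<And>x. x \<in> Obj C \<Longrightarrow> h x \<in> linear_maps K (fobj M x) (fobj N x)"
    and "\<And>x y f v. \<lbrakk>x \<in> Obj C; y \<in> Obj C; f \<in> carrier (Hom C x y); v \<in> carrier (fobj M x)\<rbrakk> \<Longrightarrow>
        h y (fmor M x y f v) = fmor N x y f (h x v)"
  shows "(\<lambda>x\<in>Obj C. \<lambda>v\<in>carrier (fobj M x). h x v) \<in> nat_transformations C (vect_cat K) M N"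
proof (rule nat_transformationsI)
  fix x assume x: "x \<in> Obj C"
  interpret module K "fobj M x" using module_functorD(1)[OF M x] .
  show "(\<lambda>x\<in>Obj C. \<lambda>v\<in>carrier (fobj M x). h x v) x \<in> carrier (Hom (vect_cat K) (fobj M x) (fobj N x))"
    using x assms(2)[OF x] by (auto simp: vect_cat_simps linear_mapsD intro!: linear_mapsI)
qed (use assms(3) module_functorD(8)[OF M] in \<open>auto simp: vect_cat_simps compose_def fun_eq_iff\<close>)

lemma module_nat_eqI:
  assumes "\<eta> \<in> nat_transformations C (vect_cat K) M N" "\<theta> \<in> nat_transformations C (vect_cat K) M N"
    and "k_functor K C (vect_cat K) M"
    and "\<And>x v. \<lbrakk>x \<in> Obj C; v \<in> carrier (fobj M x)\<rbrakk> \<Longrightarrow> \<eta> x v = \<theta> x v"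
  shows "\<eta> = \<theta>"
proof (rule extensionalityI)
  note n = module_natD[OF assms(1,3)] module_natD[OF assms(2,3)]
  show "\<eta> \<in> extensional (Obj C)" "\<theta> \<in> extensional (Obj C)" using n by auto
  show "\<eta> x = \<theta> x" if "x \<in> Obj C" for x
    by (rule extensionalityI[where A = "carrier (fobj M x)"]) (use n(2,7) that assms(4) in auto)
qed

lemma module_cat_ops:
  "\<lbrakk>x \<in> Obj C; v \<in> carrier (fobj M x)\<rbrakk> \<Longrightarrow> \<zero>\<^bsub>Hom (module_cat K C) M N\<^esub> x v = \<zero>\<^bsub>fobj N x\<^esub>"
  "\<lbrakk>x \<in> Obj C; v \<in> carrier (fobj M x)\<rbrakk> \<Longrightarrow>
    (\<eta> \<oplus>\<^bsub>Hom (module_cat K C) M N\<^esub> \<theta>) x v = \<eta> x v \<oplus>\<^bsub>fobj N x\<^esub> \<theta> x v"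
  "\<lbrakk>x \<in> Obj C; v \<in> carrier (fobj M x)\<rbrakk> \<Longrightarrow> (a \<odot>\<^bsub>Hom (module_cat K C) M N\<^esub> \<eta>) x v = a \<odot>\<^bsub>fobj N x\<^esub> \<eta> x v"
  "\<lbrakk>x \<in> Obj C; v \<in> carrier (fobj L x)\<rbrakk> \<Longrightarrow> Comp (module_cat K C) L M N \<theta> \<eta> x v = \<theta> x (\<eta> x v)"
  "\<lbrakk>x \<in> Obj C; v \<in> carrier (fobj M x)\<rbrakk> \<Longrightarrow> Ident (module_cat K C) M x v = v"
  by (simp_all add: module_cat_def functor_cat_simps vect_cat_simps compose_def)

section \<open>Constructions of modules\<close>

text \<open>With injective codes it moves representable modules and finite products into the
  universe \<open>'v\<close>; with coset representatives it forms quotient modules.\<close>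

definition image_functor ::
  "('o \<Rightarrow> 'a \<Rightarrow> 'b) \<Rightarrow> ('o, 'm, ('k, 'a) module, 'a \<Rightarrow> 'a) kfunctor \<Rightarrow> ('o, 'm, ('k, 'b) module, 'b \<Rightarrow> 'b) kfunctor" where
  "image_functor r M = module_functor (\<lambda>x. image_space (r x) (fobj M x))
    (\<lambda>x y f a. r y (fmor M x y f (inv_into (carrier (fobj M x)) (r x) a)))"

lemma fobj_image_functor [simp]: "fobj (image_functor r M) x = image_space (r x) (fobj M x)"
  by (simp add: image_functor_def)

text \<open>By \<open>comp\<close> the action respects the identification made by \<open>r\<close>,
  so decoding, acting and encoding does not depend on the decoded vector.\<close>

lemma image_functor:
  assumes C: "k_category K C" and M: "k_functor K C (vect_cat K) M"
    and cong: "\<And>x. x \<in> Obj C \<Longrightarrow> linear_congruence K (fobj M x) (r x)"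
    and comp: "\<And>x y f v w. \<lbrakk>x \<in> Obj C; y \<in> Obj C; f \<in> carrier (Hom C x y); v \<in> carrier (fobj M x);
      w \<in> carrier (fobj M x); r x v = r x w\<rbrakk> \<Longrightarrow> r y (fmor M x y f v) = r y (fmor M x y f w)"
  shows "k_functor K C (vect_cat K) (image_functor r M)"
    and "\<And>x y f v. \<lbrakk>x \<in> Obj C; y \<in> Obj C; f \<in> carrier (Hom C x y); v \<in> carrier (fobj M x)\<rbrakk> \<Longrightarrow>
      fmor (image_functor r M) x y f (r x v) = r y (fmor M x y f v)"
proof -
  interpret C: k_category K C by fact
  note MD = module_functorD[OF M]
  have act: "r y (fmor M x y f (inv_into (carrier (fobj M x)) (r x) (r x v))) = r y (fmor M x y f v)"
    if "x \<in> Obj C" "y \<in> Obj C" "f \<in> carrier (Hom C x y)" "v \<in> carrier (fobj M x)" for x y f v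
    using that by (intro comp) (auto intro: inv_into_into f_inv_into_f)
  then show "\<And>x y f v. \<lbrakk>x \<in> Obj C; y \<in> Obj C; f \<in> carrier (Hom C x y); v \<in> carrier (fobj M x)\<rbrakk> \<Longrightarrow>
      fmor (image_functor r M) x y f (r x v) = r y (fmor M x y f v)"
    by (simp add: image_functor_def carrier_image_space)
  have lin: "r x \<in> linear_maps K (fobj M x) (image_space (r x) (fobj M x))" if "x \<in> Obj C" for x
    using that by (intro image_space_linear MD cong)
  note e = linear_mapsD(2,3)[OF lin, symmetric]
  have ac: "v \<oplus>\<^bsub>fobj M x\<^esub> w \<in> carrier (fobj M x)" if "x \<in> Obj C" "v \<in> carrier (fobj M x)" "w \<in> carrier (fobj M x)" for x v w
    using that abelian_monoid.a_closed[OF abelian_group.axioms(1)[OF module.axioms(2)[OF MD(1)]]] by blast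
  have sc: "a \<odot>\<^bsub>fobj M x\<^esub> w \<in> carrier (fobj M x)" if "x \<in> Obj C" "a \<in> carrier K" "w \<in> carrier (fobj M x)" for x a w
    using that module.smult_closed[OF MD(1)] by blast
  show "k_functor K C (vect_cat K) (image_functor r M)"
    unfolding image_functor_def
  proof (rule module_functorI)
    fix x y f assume xy: "x \<in> Obj C" "y \<in> Obj C" "f \<in> carrier (Hom C x y)"
    show "(\<lambda>a. r y (fmor M x y f (inv_into (carrier (fobj M x)) (r x) a)))
       \<in> linear_maps K (image_space (r x) (fobj M x)) (image_space (r y) (fobj M y))"
      using xy by (intro linear_mapsI)
        (auto simp: carrier_image_space e act ac sc MD(8) linear_mapsD(2,3)[OF MD(2)])
  qed (auto simp: carrier_image_space e act MD C.add_hom C.comp_closed C.ident_closed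
      module.smult_closed[OF C.hom_space] intro!: module_image_space cong)
qed

definition sub_functor ::
  "('o \<Rightarrow> 'v set) \<Rightarrow> ('o, 'm, ('k, 'v) module, 'v \<Rightarrow> 'v) kfunctor \<Rightarrow> ('o, 'm, ('k, 'v) module, 'v \<Rightarrow> 'v) kfunctor" where
  "sub_functor N M = module_functor (\<lambda>x. (fobj M x)\<lparr>carrier := N x\<rparr>) (fmor M)"

lemma sub_functor:
  assumes M: "k_functor K C (vect_cat K) M"
    and N: "\<And>x. x \<in> Obj C \<Longrightarrow> module K ((fobj M x)\<lparr>carrier := N x\<rparr>)" "\<And>x. x \<in> Obj C \<Longrightarrow> N x \<subseteq> carrier (fobj M x)"
    and act: "\<And>x y f v. \<lbrakk>x \<in> Obj C; y \<in> Obj C; f \<in> carrier (Hom C x y); v \<in> N x\<rbrakk> \<Longrightarrow> fmor M x y f v \<in> N y"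
  shows "k_functor K C (vect_cat K) (sub_functor N M)"
  unfolding sub_functor_def
proof (rule module_functorI)
  note MD = module_functorD[OF M]
  have N': "v \<in> carrier (fobj M x)" if "x \<in> Obj C" "v \<in> N x" for x v using that N(2) by auto
  fix x y f assume xy: "x \<in> Obj C" "y \<in> Obj C" "f \<in> carrier (Hom C x y)"
  show "fmor M x y f \<in> linear_maps K ((fobj M x)\<lparr>carrier := N x\<rparr>) ((fobj M y)\<lparr>carrier := N y\<rparr>)"
    using xy by (intro linear_mapsI) (auto simp: act N' linear_mapsD(2,3)[OF MD(2)])
qed (use N act module_functorD[OF M] in \<open>auto simp: subset_iff\<close>)

text \<open>The splitting object is the image of \<open>e\<close>, with \<open>e\<close> itself as
  projection and the inclusion as section; an idempotent is the identity on its image.\<close>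

lemma splits_idempotents_module_cat:
  assumes "field K"
  shows "splits_idempotents (module_cat K C :: (('o, 'm, ('k, 'v) module, 'v \<Rightarrow> 'v) kfunctor, 'o \<Rightarrow> 'v \<Rightarrow> 'v, 'k) kcat)"
    (is "splits_idempotents ?M")
  unfolding splits_idempotents_def
proof (intro ballI impI)
  fix M e assume M: "M \<in> Obj ?M" and e: "e \<in> carrier (Hom ?M M M)" and ee: "Comp ?M M M M e e = e"
  have M: "k_functor K C (vect_cat K) M" using M by (simp add: module_cat_simps)
  note MD = module_functorD[OF M]
  have e: "e \<in> nat_transformations C (vect_cat K) M M" using e by (simp add: module_cat_simps)
  note eD = module_natD[OF e M]
  have ee: "e x (e x v) = e x v" if "x \<in> Obj C" "v \<in> carrier (fobj M x)" for x v
    using fun_cong[OF fun_cong[OF ee, of x], of v] that by (simp add: module_cat_ops)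
  define N where "N x = e x ` carrier (fobj M x)" for x
  have N: "module K ((fobj M x)\<lparr>carrier := N x\<rparr>)" if x: "x \<in> Obj C" for x
  proof -
    interpret V: module K "fobj M x" by (rule MD(1)[OF x])
    note l = linear_mapsD[OF eD(1)[OF x]]
    show ?thesis
    proof (rule module_restrict_carrier)
      show "\<zero>\<^bsub>fobj M x\<^esub> \<in> N x"
        using linear_maps_zero[OF eD(1)[OF x] MD(1)[OF x] MD(1)[OF x]]
        unfolding N_def by (metis V.zero_closed image_eqI)
    qed (use l in \<open>auto simp: N_def V.module_axioms l(2,3)[symmetric]\<close>)
  qed
  let ?N = "sub_functor N M"
  have NM: "N x \<subseteq> carrier (fobj M x)" if "x \<in> Obj C" for x using eD(5) that by (auto simp: N_def)
  have act: "fmor M x y f v \<in> N y" if "x \<in> Obj C" "y \<in> Obj C" "f \<in> carrier (Hom C x y)" "v \<in> N x" for x y f v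
    using that MD(8) by (auto simp: N_def eD(3)[symmetric])
  have NF: "k_functor K C (vect_cat K) ?N" by (rule sub_functor[OF M N NM act])
  have fN: "fobj ?N x = (fobj M x)\<lparr>carrier := N x\<rparr>" for x by (simp add: sub_functor_def)
  have mN: "fmor ?N x y f v = fmor M x y f v" if "v \<in> N x" for x y f v
    using that by (simp add: sub_functor_def)
  let ?q = "\<lambda>x\<in>Obj C. \<lambda>v\<in>carrier (fobj M x). e x v" and ?j = "\<lambda>x\<in>Obj C. \<lambda>v\<in>carrier (fobj ?N x). v"
  have q: "?q \<in> nat_transformations C (vect_cat K) M ?N"
    using eD by (intro module_natI[OF M] linear_mapsI)
      (auto simp: fN linear_mapsD[OF eD(1)] N_def mN)
  have j: "?j \<in> nat_transformations C (vect_cat K) ?N M"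
    using NM by (intro module_natI[OF NF] linear_mapsI) (auto simp: fN mN)
  interpret MC: k_category K ?M by (rule k_category_module_cat[OF assms])
  have obj: "M \<in> Obj ?M" "?N \<in> Obj ?M" using M NF by (auto simp: module_cat_simps)
  have h: "?q \<in> carrier (Hom ?M M ?N)" "?j \<in> carrier (Hom ?M ?N M)" "e \<in> carrier (Hom ?M M M)"
    using q j e by (auto simp: module_cat_simps)
  have eN: "e x v = v" if "x \<in> Obj C" "v \<in> N x" for x v using that ee by (auto simp: N_def)
  have "Comp ?M ?N M ?N ?q ?j = Ident ?M ?N"
  proof (rule module_nat_eqI[OF _ _ NF])
    show "Comp ?M ?N M ?N ?q ?j \<in> nat_transformations C (vect_cat K) ?N ?N"
      "Ident ?M ?N \<in> nat_transformations C (vect_cat K) ?N ?N"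
      using MC.comp_closed[OF obj(2,1,2) h(2,1)] MC.ident_closed[OF obj(2)] by (simp_all add: module_cat_simps)
  qed (use NM in \<open>auto simp: module_cat_ops fN eN subset_iff\<close>)
  moreover have "Comp ?M M ?N M ?j ?q = e"
  proof (rule module_nat_eqI[OF _ e M])
    show "Comp ?M M ?N M ?j ?q \<in> nat_transformations C (vect_cat K) M M"
      using MC.comp_closed[OF obj(1,2,1) h(1,2)] by (simp add: module_cat_simps)
  qed (auto simp: module_cat_ops fN N_def)
  ultimately show "\<exists>y\<in>Obj ?M. \<exists>q\<in>carrier (Hom ?M M y). \<exists>j\<in>carrier (Hom ?M y M).
      Comp ?M y M y q j = Ident ?M y \<and> Comp ?M M y M j q = e"
    using obj h by blast
qed

text \<open>Completeness is tested after composing with each \<open>p l\<close>, where orthogonality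
  reduces the sum to one term. For products of modules the joint cancellation of the projections is
  immediate, whereas the sum would be awkward to evaluate.\<close>

lemma (in k_category) biproductI:
  assumes J: "finite J" and s: "s \<in> Obj C" and t: "\<And>j. j \<in> J \<Longrightarrow> t j \<in> Obj C"
    and i: "\<And>j. j \<in> J \<Longrightarrow> i j \<in> carrier (Hom C (t j) s)" and p: "\<And>j. j \<in> J \<Longrightarrow> p j \<in> carrier (Hom C s (t j))"
    and pi: "\<And>j l. \<lbrakk>j \<in> J; l \<in> J\<rbrakk> \<Longrightarrow> Comp C (t j) s (t l) (p l) (i j) =
      (if j = l then Ident C (t j) else \<zero>\<^bsub>Hom C (t j) (t l)\<^esub>)"
    and monic: "\<And>f g. \<lbrakk>f \<in> carrier (Hom C s s); g \<in> carrier (Hom C s s);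
      \<And>j. j \<in> J \<Longrightarrow> Comp C s s (t j) (p j) f = Comp C s s (t j) (p j) g\<rbrakk> \<Longrightarrow> f = g"
  shows "biproduct C J t s i p"
proof -
  have "(\<Oplus>\<^bsub>Hom C s s\<^esub>j\<in>J. Comp C s (t j) s (i j) (p j)) = Ident C s"
  proof (rule monic)
    fix l assume l: "l \<in> J"
    have "Comp C s s (t l) (p l) (\<Oplus>\<^bsub>Hom C s s\<^esub>j\<in>J. Comp C s (t j) s (i j) (p j))
      = (\<Oplus>\<^bsub>Hom C s (t l)\<^esub>j\<in>J. Comp C s s (t l) (p l) (Comp C s (t j) s (i j) (p j)))"
      using l J s t i p by (intro comp_finsum_right) (auto intro: comp_closed)
    also have "\<dots> = (\<Oplus>\<^bsub>Hom C s (t l)\<^esub>j\<in>J. if l = j then p j else \<zero>\<^bsub>Hom C s (t l)\<^esub>)"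
    proof (rule abelian_monoid.finsum_cong'[OF hom_monoid])
      fix j assume j: "j \<in> J"
      have "Comp C s s (t l) (p l) (Comp C s (t j) s (i j) (p j))
        = Comp C s (t j) (t l) (Comp C (t j) s (t l) (p l) (i j)) (p j)"
        using j l s t i p by (intro comp_assoc) auto
      also have "\<dots> = (if l = j then p j else \<zero>\<^bsub>Hom C s (t l)\<^esub>)"
        using j l s t i p pi by (auto simp: comp_ident_left comp_zero_left)
      finally show "Comp C s s (t l) (p l) (Comp C s (t j) s (i j) (p j))
        = (if l = j then p j else \<zero>\<^bsub>Hom C s (t l)\<^esub>)" .
    qed (use l s t p in \<open>auto simp: zero_hom\<close>)
    also have "\<dots> = p l" using l J s t p by (intro finsum_delta) auto
    also have "\<dots> = Comp C s s (t l) (p l) (Ident C s)" using l s t p by (simp add: comp_ident_right)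
    finally show "Comp C s s (t l) (p l) (\<Oplus>\<^bsub>Hom C s s\<^esub>j\<in>J. Comp C s (t j) s (i j) (p j))
      = Comp C s s (t l) (p l) (Ident C s)" .
  qed (use J s t i p in \<open>auto intro!: finsum_hom comp_closed ident_closed\<close>)
  then show ?thesis unfolding biproduct_def using J s t i p pi by auto
qed

text \<open>The biproduct is the pointwise product. Its elements are functions on
  \<open>{..<n}\<close>; the list of their values has a code in the infinite type \<open>'v\<close>,
  which puts the product into the universe of modules.\<close>

lemma has_biproducts_module_cat:
  assumes C: "k_category K C" and inf: "infinite (UNIV :: 'v set)"
  shows "has_biproducts (module_cat K C :: (('o, 'm, ('k, 'v) module, 'v \<Rightarrow> 'v) kfunctor, 'o \<Rightarrow> 'v \<Rightarrow> 'v, 'k) kcat)"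
    (is "has_biproducts ?M")
  unfolding has_biproducts_def
proof (intro allI impI)
  fix n :: nat and t assume "\<forall>j<n. t j \<in> Obj ?M"
  then have t: "k_functor K C (vect_cat K) (t j)" if "j < n" for j using that by (simp add: module_cat_simps)
  interpret K: field K by (rule k_category.axioms(1)[OF C])
  interpret MC: k_category K ?M by (rule k_category_module_cat[OF K.field_axioms])
  note tD = module_functorD[OF t]
  obtain c :: "'v list \<Rightarrow> 'v" where c: "inj c" using infinite_inj_list[OF inf] by blast
  define enc where "enc s = c (map s [0..<n])" for s
  define V where "V x = prod_space {..<n} (\<lambda>j. fobj (t j) x)" for x
  define P where "P = module_functor V (\<lambda>x y f s. \<lambda>j\<in>{..<n}. fmor (t j) x y f (s j))"
  have V: "module K (V x)" if "x \<in> Obj C" for x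
    unfolding V_def using that tD(1) by (intro module_prod_space K.is_cring) auto
  have inj: "inj_on enc (carrier (V x))" for x
  proof (rule inj_onI)
    fix s s' assume s: "s \<in> carrier (V x)" "s' \<in> carrier (V x)" and "enc s = enc s'"
    then have "\<forall>j<n. s j = s' j" using c by (simp add: enc_def inj_eq)
    then show "s = s'" using s unfolding V_def prod_space_simps by (intro PiE_ext) auto
  qed
  have P: "k_functor K C (vect_cat K) P"
    unfolding P_def
  proof (rule module_functorI)
    show "\<And>x. x \<in> Obj C \<Longrightarrow> module K (V x)" by (rule V)
  next
    fix x y f assume xy: "x \<in> Obj C" "y \<in> Obj C" "f \<in> carrier (Hom C x y)"
    show "(\<lambda>s. \<lambda>j\<in>{..<n}. fmor (t j) x y f (s j)) \<in> linear_maps K (V x) (V y)"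
      using xy by (intro linear_mapsI)
        (auto simp: V_def prod_space_simps fun_eq_iff tD(8) PiE_iff linear_mapsD(2,3)[OF tD(2)])
  qed (auto simp: V_def prod_space_simps fun_eq_iff tD PiE_iff extensional_def)
  have fP: "fobj P x = V x" for x by (simp add: P_def)
  have mP: "fmor P x y f s = (\<lambda>j\<in>{..<n}. fmor (t j) x y f (s j))" if "s \<in> carrier (V x)" for x y f s
    using that by (simp add: P_def)
  define S where "S = image_functor (\<lambda>_. enc) P"
  have S: "k_functor K C (vect_cat K) S"
    and mS: "\<And>x y f v. \<lbrakk>x \<in> Obj C; y \<in> Obj C; f \<in> carrier (Hom C x y); v \<in> carrier (V x)\<rbrakk> \<Longrightarrow>
      fmor S x y f (enc v) = enc (fmor P x y f v)"
  proof -
    have 1: "linear_congruence K (fobj P x) enc" for x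
      unfolding fP by (rule linear_congruence_inj[OF inj])
    have 2: "enc (fmor P x y f v) = enc (fmor P x y f w)"
      if "v \<in> carrier (fobj P x)" "w \<in> carrier (fobj P x)" "enc v = enc w" for x y f v w
      using inj_on_eq_iff[OF inj[of x], of v w] that by (simp add: fP)
    note * = image_functor[where r = "\<lambda>_. enc", OF C P]
    show "k_functor K C (vect_cat K) S" unfolding S_def by (rule *(1)) (rule 1, rule 2, assumption+)
    show "fmor S x y f (enc v) = enc (fmor P x y f v)"
      if "x \<in> Obj C" "y \<in> Obj C" "f \<in> carrier (Hom C x y)" "v \<in> carrier (V x)" for x y f v
      unfolding S_def by (rule *(2)) (rule 1, rule 2, assumption+, use that in \<open>simp_all add: fP\<close>)
  qed
  have fS: "fobj S x = image_space enc (V x)" for x by (simp add: S_def fP)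
  have encl: "enc \<in> linear_maps K (V x) (fobj S x)" if "x \<in> Obj C" for x
    unfolding fS using that V by (intro image_space_linear linear_congruence_inj inj)
  define dec where "dec x = inv_into (carrier (V x)) enc" for x
  have dec: "dec x (enc s) = s" if "s \<in> carrier (V x)" for x s
    using that inj by (simp add: dec_def)
  have decl: "dec x \<in> linear_maps K (fobj S x) (V x)" if "x \<in> Obj C" for x
    unfolding fS dec_def using that V inj by (intro inv_into_image_space_linear)
  have cS: "carrier (fobj S x) = enc ` carrier (V x)" for x by (simp add: fS carrier_image_space)
  define u where "u j x v = (\<lambda>l\<in>{..<n}. if l = j then v else \<zero>\<^bsub>fobj (t l) x\<^esub>)" for j x v
  have tz: "\<zero>\<^bsub>fobj (t l) x\<^esub> \<in> carrier (fobj (t l) x)" if "l < n" "x \<in> Obj C" for l x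
    using that abelian_monoid.zero_closed[OF abelian_group.axioms(1)[OF module.axioms(2)[OF tD(1)]]] by blast
  have tzz: "\<zero>\<^bsub>fobj (t l) x\<^esub> \<oplus>\<^bsub>fobj (t l) x\<^esub> \<zero>\<^bsub>fobj (t l) x\<^esub> = \<zero>\<^bsub>fobj (t l) x\<^esub>" if "l < n" "x \<in> Obj C" for l x
    using that tz abelian_monoid.l_zero[OF abelian_group.axioms(1)[OF module.axioms(2)[OF tD(1)]]] by blast
  have taz: "a \<odot>\<^bsub>fobj (t l) x\<^esub> \<zero>\<^bsub>fobj (t l) x\<^esub> = \<zero>\<^bsub>fobj (t l) x\<^esub>" if "l < n" "x \<in> Obj C" "a \<in> carrier K" for l x a
    using that module.smult_r_null[OF tD(1)] by blast
  have tfz: "fmor (t l) x y f \<zero>\<^bsub>fobj (t l) x\<^esub> = \<zero>\<^bsub>fobj (t l) y\<^esub>"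
    if "l < n" "x \<in> Obj C" "y \<in> Obj C" "f \<in> carrier (Hom C x y)" for l x y f
    using that by (intro linear_maps_zero[OF tD(2)] tD(1))
  have u: "u j x v \<in> carrier (V x)" if "j < n" "x \<in> Obj C" "v \<in> carrier (fobj (t j) x)" for j x v
    using that tz by (auto simp: u_def V_def prod_space_simps)
  have ul: "u j x \<in> linear_maps K (fobj (t j) x) (V x)" if "j < n" "x \<in> Obj C" for j x
    using that u by (intro linear_mapsI) (auto simp: u_def V_def prod_space_simps fun_eq_iff tzz taz)
  define i where "i j = (\<lambda>x\<in>Obj C. \<lambda>v\<in>carrier (fobj (t j) x). enc (u j x v))" for j
  define p where "p j = (\<lambda>x\<in>Obj C. \<lambda>a\<in>carrier (fobj S x). dec x a j)" for j
  have i: "i j \<in> nat_transformations C (vect_cat K) (t j) S" if j: "j < n" for j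
    unfolding i_def
  proof (rule module_natI[OF t[OF j]])
    fix x assume x: "x \<in> Obj C"
    show "(\<lambda>v. enc (u j x v)) \<in> linear_maps K (fobj (t j) x) (fobj S x)"
      using linear_mapsD[OF ul[OF j x]] linear_mapsD[OF encl[OF x]] by (intro linear_mapsI) auto
  next
    fix x y f v assume *: "x \<in> Obj C" "y \<in> Obj C" "f \<in> carrier (Hom C x y)" "v \<in> carrier (fobj (t j) x)"
    then show "enc (u j y (fmor (t j) x y f v)) = fmor S x y f (enc (u j x v))"
      using j by (simp add: mS u mP) (intro arg_cong[where f = enc], auto simp: u_def tfz fun_eq_iff)
  qed
  have p: "p j \<in> nat_transformations C (vect_cat K) S (t j)" if j: "j < n" for j
    unfolding p_def
  proof (rule module_natI[OF S])
    fix x assume x: "x \<in> Obj C"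
    show "(\<lambda>a. dec x a j) \<in> linear_maps K (fobj S x) (fobj (t j) x)"
      using linear_mapsD[OF decl[OF x]] j by (intro linear_mapsI) (auto simp: V_def prod_space_simps PiE_iff)
  next
    fix x y f v assume *: "x \<in> Obj C" "y \<in> Obj C" "f \<in> carrier (Hom C x y)" "v \<in> carrier (fobj S x)"
    then obtain s where s: "s \<in> carrier (V x)" "v = enc s" by (auto simp: cS)
    have "(\<lambda>j\<in>{..<n}. fmor (t j) x y f (s j)) \<in> carrier (V y)"
      using * s by (auto simp: V_def prod_space_simps PiE_iff tD(8))
    then show "dec y (fmor S x y f v) j = fmor (t j) x y f (dec x v j)"
      using * s j by (simp add: mS mP dec)
  qed
  have S': "S \<in> Obj ?M" and t': "\<And>j. j < n \<Longrightarrow> t j \<in> Obj ?M" using S t by (auto simp: module_cat_simps)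
  have i': "i j \<in> carrier (Hom ?M (t j) S)" and p': "p j \<in> carrier (Hom ?M S (t j))" if "j < n" for j
    using i p that by (auto simp: module_cat_simps)
  have "biproduct ?M {..<n} t S i p"
  proof (rule MC.biproductI)
    fix j l assume "j \<in> {..<n}" "l \<in> {..<n}"
    then have jl: "j < n" "l < n" by auto
    show "Comp ?M (t j) S (t l) (p l) (i j) = (if j = l then Ident ?M (t j) else \<zero>\<^bsub>Hom ?M (t j) (t l)\<^esub>)"
    proof (rule module_nat_eqI[OF _ _ t[OF jl(1)]])
      show "Comp ?M (t j) S (t l) (p l) (i j) \<in> nat_transformations C (vect_cat K) (t j) (t l)"
        using MC.comp_closed[OF t'[OF jl(1)] S' t'[OF jl(2)] i'[OF jl(1)] p'[OF jl(2)]] by (simp add: module_cat_simps)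
      have "(if j = l then Ident ?M (t j) else \<zero>\<^bsub>Hom ?M (t j) (t l)\<^esub>) \<in> carrier (Hom ?M (t j) (t l))"
        using jl t' MC.ident_closed MC.zero_hom by auto
      then show "(if j = l then Ident ?M (t j) else \<zero>\<^bsub>Hom ?M (t j) (t l)\<^esub>) \<in> nat_transformations C (vect_cat K) (t j) (t l)"
        by (simp add: module_cat_simps)
      fix x v assume x: "x \<in> Obj C" and v: "v \<in> carrier (fobj (t j) x)"
      have "u j x v \<in> carrier (V x)" using u jl x v by blast
      moreover then have "enc (u j x v) \<in> carrier (fobj S x)" by (simp add: cS)
      ultimately have "Comp ?M (t j) S (t l) (p l) (i j) x v = u j x v l"
        using x v by (simp add: module_cat_ops i_def p_def dec)
      then show "Comp ?M (t j) S (t l) (p l) (i j) x v = (if j = l then Ident ?M (t j) else \<zero>\<^bsub>Hom ?M (t j) (t l)\<^esub>) x v"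
        using x v jl by (auto simp: u_def module_cat_ops)
    qed
  next
    fix f g assume f: "f \<in> carrier (Hom ?M S S)" and g: "g \<in> carrier (Hom ?M S S)"
      and eq: "\<And>j. j \<in> {..<n} \<Longrightarrow> Comp ?M S S (t j) (p j) f = Comp ?M S S (t j) (p j) g"
    have f': "f \<in> nat_transformations C (vect_cat K) S S" and g': "g \<in> nat_transformations C (vect_cat K) S S"
      using f g by (simp_all add: module_cat_simps)
    show "f = g"
    proof (rule module_nat_eqI[OF f' g' S])
      fix x v assume x: "x \<in> Obj C" "v \<in> carrier (fobj S x)"
      have fv: "f x v \<in> carrier (fobj S x)" "g x v \<in> carrier (fobj S x)"
        using module_natD(5)[OF f' S x] module_natD(5)[OF g' S x] by auto
      have "dec x (f x v) j = dec x (g x v) j" if "j < n" for j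
        using fun_cong[OF fun_cong[OF eq[of j], of x], of v] that x fv by (simp add: module_cat_ops p_def)
      moreover obtain s s' where s: "s \<in> carrier (V x)" "f x v = enc s" "s' \<in> carrier (V x)" "g x v = enc s'"
        using fv by (auto simp: cS)
      ultimately have "\<forall>j<n. s j = s' j" by (simp add: dec)
      then have "map s [0..<n] = map s' [0..<n]" by (intro map_cong) auto
      then show "f x v = g x v" using s(2,4) by (simp only: enc_def)
    qed
  qed (use S' t' i' p' in auto)
  then show "\<exists>s i p. biproduct ?M {..<n} t s i p" by blast
qed

section \<open>The Yoneda embedding\<close>

text \<open>The map \<open>\<iota>\<close> turns morphisms into vectors of the universe
  \<open>'v\<close>, so that the functors \<open>Hom x -\<close> become objects of the module
  category.\<close>

locale yoneda = k_category K C for K :: "('k, 'r) ring_scheme" (structure) and C :: "('o, 'm, 'k) kcat" +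
  fixes \<iota> :: "'m \<Rightarrow> 'v"
  assumes inj_\<iota>: "inj \<iota>"
begin

abbreviation "Mods \<equiv> (module_cat K C :: (('o, 'm, ('k, 'v) module, 'v \<Rightarrow> 'v) kfunctor, 'o \<Rightarrow> 'v \<Rightarrow> 'v, 'k) kcat)"

sublocale Mods: k_category K Mods
  by (rule k_category_module_cat[OF field_axioms])

definition hom_functor :: "'o \<Rightarrow> ('o, 'm, ('k, 'm) module, 'm \<Rightarrow> 'm) kfunctor" where
  "hom_functor x = module_functor (\<lambda>y. Hom C x y) (\<lambda>y z f g. Comp C x y z f g)"

lemma hom_functor:
  assumes "x \<in> Obj C"
  shows "k_functor K C (vect_cat K) (hom_functor x)"
  unfolding hom_functor_def
  by (rule module_functorI)
    (use assms in \<open>auto simp: hom_space comp_add_left comp_smult_left comp_ident_left comp_assoc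
      intro: comp_linear_right\<close>)

definition rep :: "'o \<Rightarrow> ('o, 'm, ('k, 'v) module, 'v \<Rightarrow> 'v) kfunctor" where
  "rep x = image_functor (\<lambda>_. \<iota>) (hom_functor x)"

lemma fobj_rep: "fobj (rep x) y = image_space \<iota> (Hom C x y)"
  by (simp add: rep_def hom_functor_def)

lemma carrier_rep: "carrier (fobj (rep x) y) = \<iota> ` carrier (Hom C x y)"
  by (simp add: fobj_rep carrier_image_space)

lemma \<iota>_linear: "x \<in> Obj C \<Longrightarrow> y \<in> Obj C \<Longrightarrow> \<iota> \<in> linear_maps K (Hom C x y) (fobj (rep x) y)"
  unfolding fobj_rep
  by (intro image_space_linear hom_space linear_congruence_inj inj_on_subset[OF inj_\<iota>]) auto

lemma rep:
  assumes "x \<in> Obj C"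
  shows "k_functor K C (vect_cat K) (rep x)"
    and "\<And>y z f g. \<lbrakk>y \<in> Obj C; z \<in> Obj C; f \<in> carrier (Hom C y z); g \<in> carrier (Hom C x y)\<rbrakk> \<Longrightarrow>
      fmor (rep x) y z f (\<iota> g) = \<iota> (Comp C x y z f g)"
proof -
  have 1: "linear_congruence K V \<iota>" for V :: "('k, 'm) module"
    by (intro linear_congruence_inj inj_on_subset[OF inj_\<iota>]) auto
  have 2: "\<iota> (fmor M y z f v) = \<iota> (fmor M y z f w)" if "\<iota> v = \<iota> w" for M :: "('o, 'm, ('k, 'm) module, 'm \<Rightarrow> 'm) kfunctor" and y z f v w
    using injD[OF inj_\<iota> that] by simp
  note * = image_functor[where r = "\<lambda>_. \<iota>", OF k_category_axioms hom_functor[OF assms]]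
  show "k_functor K C (vect_cat K) (rep x)"
    unfolding rep_def by (rule *(1)) (rule 1, rule 2, assumption)
  show "fmor (rep x) y z f (\<iota> g) = \<iota> (Comp C x y z f g)"
    if "y \<in> Obj C" "z \<in> Obj C" "f \<in> carrier (Hom C y z)" "g \<in> carrier (Hom C x y)" for y z f g
  proof -
    have "fmor (rep x) y z f (\<iota> g) = \<iota> (fmor (hom_functor x) y z f g)"
      unfolding rep_def by (rule *(2)) (rule 1, rule 2, assumption, use that in \<open>simp_all add: hom_functor_def\<close>)
    then show ?thesis using that by (simp add: hom_functor_def)
  qed
qed

text \<open>The Yoneda correspondence: the code of \<open>g\<close> is sent to the action of
  \<open>g\<close> on \<open>m\<close>. Its inverse is evaluation at the code of the
  identity.\<close>

definition yo :: "'o \<Rightarrow> ('o, 'm, ('k, 'v) module, 'v \<Rightarrow> 'v) kfunctor \<Rightarrow> 'v \<Rightarrow> 'o \<Rightarrow> 'v \<Rightarrow> 'v" where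
  "yo x M m = (\<lambda>y\<in>Obj C. \<lambda>v\<in>carrier (fobj (rep x) y). fmor M x y (inv_into UNIV \<iota> v) m)"

lemma yo_apply: "\<lbrakk>y \<in> Obj C; g \<in> carrier (Hom C x y)\<rbrakk> \<Longrightarrow> yo x M m y (\<iota> g) = fmor M x y g m"
  by (simp add: yo_def carrier_rep inv_f_f[OF inj_\<iota>])

lemma yo_nat:
  assumes x: "x \<in> Obj C" and M: "k_functor K C (vect_cat K) M" and m: "m \<in> carrier (fobj M x)"
  shows "yo x M m \<in> nat_transformations C (vect_cat K) (rep x) M"
  unfolding yo_def
proof (rule module_natI[OF rep(1)[OF x]])
  note MD = module_functorD[OF M]
  note inv = inv_f_f[OF inj_\<iota>]
  fix y assume y: "y \<in> Obj C"
  note e = linear_mapsD(2,3)[OF \<iota>_linear[OF x y], symmetric]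
  show "(\<lambda>v. fmor M x y (inv_into UNIV \<iota> v) m) \<in> linear_maps K (fobj (rep x) y) (fobj M y)"
    using x y m by (intro linear_mapsI) (auto simp: carrier_rep e inv MD)
next
  note MD = module_functorD[OF M]
  fix y z f v assume "y \<in> Obj C" "z \<in> Obj C" "f \<in> carrier (Hom C y z)" "v \<in> carrier (fobj (rep x) y)"
  then show "fmor M x z (inv_into UNIV \<iota> (fmor (rep x) y z f v)) m = fmor M y z f (fmor M x y (inv_into UNIV \<iota> v) m)"
    using x m by (auto simp: carrier_rep rep(2) inv_f_f[OF inj_\<iota>] MD)
qed

lemma yo_eval:
  assumes "x \<in> Obj C" "k_functor K C (vect_cat K) M" "m \<in> carrier (fobj M x)"
  shows "yo x M m x (\<iota> (Ident C x)) = m"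
  using assms by (simp add: yo_apply ident_closed module_functorD(6))

text \<open>The code of \<open>g\<close> is the result of acting with \<open>g\<close> on the code
  of the identity, so by naturality the value there determines everything.\<close>

lemma yo_unique:
  assumes x: "x \<in> Obj C" and M: "k_functor K C (vect_cat K) M"
    and \<eta>: "\<eta> \<in> nat_transformations C (vect_cat K) (rep x) M"
  shows "\<eta> = yo x M (\<eta> x (\<iota> (Ident C x)))" and "\<eta> x (\<iota> (Ident C x)) \<in> carrier (fobj M x)"
proof -
  note n = module_natD[OF \<eta> rep(1)[OF x]]
  have i: "\<iota> (Ident C x) \<in> carrier (fobj (rep x) x)" using x by (simp add: carrier_rep ident_closed)
  show m: "\<eta> x (\<iota> (Ident C x)) \<in> carrier (fobj M x)" by (rule n(5)[OF x i])
  show "\<eta> = yo x M (\<eta> x (\<iota> (Ident C x)))"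
  proof (rule module_nat_eqI[OF \<eta> yo_nat[OF x M m] rep(1)[OF x]])
    fix y v assume y: "y \<in> Obj C" and v: "v \<in> carrier (fobj (rep x) y)"
    then obtain g where g: "g \<in> carrier (Hom C x y)" "v = \<iota> g" by (auto simp: carrier_rep)
    have "v = fmor (rep x) x y g (\<iota> (Ident C x))"
      using x y g by (simp add: rep(2) ident_closed comp_ident_right)
    then have "\<eta> y v = fmor M x y g (\<eta> x (\<iota> (Ident C x)))" using n(3)[OF x y g(1) i] by simp
    then show "\<eta> y v = yo x M (\<eta> x (\<iota> (Ident C x))) y v" using y g by (simp add: yo_apply)
  qed
qed

lemma rep_obj: "x \<in> Obj C \<Longrightarrow> rep x \<in> Obj Mods"
  by (simp add: module_cat_simps rep)

lemma yo_hom: "\<lbrakk>x \<in> Obj C; M \<in> Obj Mods; m \<in> carrier (fobj M x)\<rbrakk> \<Longrightarrow> yo x M m \<in> carrier (Hom Mods (rep x) M)"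
  using yo_nat by (simp add: module_cat_simps)

text \<open>Both sides agree at the code of the identity, which suffices by uniqueness.\<close>

lemma yo_comp:
  assumes x: "x \<in> Obj C" and M: "M \<in> Obj Mods" and N: "N \<in> Obj Mods" and m: "m \<in> carrier (fobj M x)"
    and \<theta>: "\<theta> \<in> carrier (Hom Mods M N)"
  shows "Comp Mods (rep x) M N \<theta> (yo x M m) = yo x N (\<theta> x m)"
proof -
  have M': "k_functor K C (vect_cat K) M" and N': "k_functor K C (vect_cat K) N" using M N by (simp_all add: module_cat_simps)
  have "Comp Mods (rep x) M N \<theta> (yo x M m) \<in> nat_transformations C (vect_cat K) (rep x) N"
    using Mods.comp_closed[OF rep_obj[OF x] M N yo_hom[OF x M m] \<theta>] by (simp add: module_cat_simps)
  from yo_unique(1)[OF x N' this] show ?thesis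
    using x m M' by (simp add: module_cat_ops carrier_rep ident_closed yo_eval)
qed

lemma yo_bij:
  assumes x: "x \<in> Obj C" and M: "M \<in> Obj Mods"
  shows "bij_betw (yo x M) (carrier (fobj M x)) (carrier (Hom Mods (rep x) M))"
proof -
  have M': "k_functor K C (vect_cat K) M" using M by (simp add: module_cat_simps)
  show ?thesis
    by (rule bij_betw_byWitness[where f' = "\<lambda>\<eta>. \<eta> x (\<iota> (Ident C x))"])
      (use yo_eval[OF x M'] yo_unique[OF x M'] yo_hom[OF x M] in \<open>auto simp: module_cat_simps\<close>)
qed

lemma yo_linear:
  assumes x: "x \<in> Obj C" and M: "M \<in> Obj Mods"
  shows "yo x M \<in> linear_maps K (fobj M x) (Hom Mods (rep x) M)"
proof (rule linear_mapsI)
  have M': "k_functor K C (vect_cat K) M" using M by (simp add: module_cat_simps)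
  note MD = module_functorD[OF M']
  note rx = rep(1)[OF x]
  interpret V: module K "fobj M x" by (rule MD(1)[OF x])
  show "yo x M m \<in> carrier (Hom Mods (rep x) M)" if "m \<in> carrier (fobj M x)" for m using yo_hom x M that .
  fix v w assume vw: "v \<in> carrier (fobj M x)" "w \<in> carrier (fobj M x)"
  show "yo x M (v \<oplus>\<^bsub>fobj M x\<^esub> w) = yo x M v \<oplus>\<^bsub>Hom Mods (rep x) M\<^esub> yo x M w"
  proof (rule module_nat_eqI[OF _ _ rx])
    show "yo x M (v \<oplus>\<^bsub>fobj M x\<^esub> w) \<in> nat_transformations C (vect_cat K) (rep x) M" using vw by (intro yo_nat x M') simp
    show "yo x M v \<oplus>\<^bsub>Hom Mods (rep x) M\<^esub> yo x M w \<in> nat_transformations C (vect_cat K) (rep x) M"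
      using Mods.add_hom[OF rep_obj[OF x] M yo_hom[OF x M vw(1)] yo_hom[OF x M vw(2)]] by (simp add: module_cat_simps)
  qed (use x vw in \<open>auto simp: module_cat_ops carrier_rep yo_apply linear_mapsD(2)[OF MD(2)]\<close>)
next
  have M': "k_functor K C (vect_cat K) M" using M by (simp add: module_cat_simps)
  note MD = module_functorD[OF M']
  note rx = rep(1)[OF x]
  interpret V: module K "fobj M x" by (rule MD(1)[OF x])
  fix a v assume a: "a \<in> carrier K" and v: "v \<in> carrier (fobj M x)"
  show "yo x M (a \<odot>\<^bsub>fobj M x\<^esub> v) = a \<odot>\<^bsub>Hom Mods (rep x) M\<^esub> yo x M v"
  proof (rule module_nat_eqI[OF _ _ rx])
    show "yo x M (a \<odot>\<^bsub>fobj M x\<^esub> v) \<in> nat_transformations C (vect_cat K) (rep x) M" using a v by (intro yo_nat x M') simp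
    show "a \<odot>\<^bsub>Hom Mods (rep x) M\<^esub> yo x M v \<in> nat_transformations C (vect_cat K) (rep x) M"
      using module.smult_closed[OF Mods.hom_space[OF rep_obj[OF x] M] a yo_hom[OF x M v]] by (simp add: module_cat_simps)
  qed (use x a v in \<open>auto simp: module_cat_ops carrier_rep yo_apply linear_mapsD(3)[OF MD(2)]\<close>)
qed

text \<open>A morphism from \<open>x\<close> to \<open>y\<close> induces a morphism from
  \<open>rep y\<close> to \<open>rep x\<close> by precomposition; hence the target is the opposite
  of the module category.\<close>

definition embedding :: "('o, 'm, ('o, 'm, ('k, 'v) module, 'v \<Rightarrow> 'v) kfunctor, 'o \<Rightarrow> 'v \<Rightarrow> 'v) kfunctor" where
  "embedding = \<lparr>fobj = rep, fmor = \<lambda>x y f. yo y (rep x) (\<iota> f)\<rparr>"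

lemma embedding_fully_faithful: "fully_faithful K C (op_cat Mods) embedding"
  unfolding fully_faithful_def
proof (intro conjI ballI)
  show "k_functor K C (op_cat Mods) embedding"
  proof (rule k_functorI)
    fix x y assume xy: "x \<in> Obj C" "y \<in> Obj C"
    have "(\<lambda>f. yo y (rep x) (\<iota> f)) \<in> linear_maps K (Hom C x y) (Hom Mods (rep y) (rep x))"
      using linear_mapsD[OF \<iota>_linear[OF xy]] linear_mapsD[OF yo_linear[OF xy(2) rep_obj[OF xy(1)]]]
      by (intro linear_mapsI) auto
    then show "fmor embedding x y \<in> linear_maps K (Hom C x y) (Hom (op_cat Mods) (fobj embedding x) (fobj embedding y))"
      by (simp add: embedding_def)
  next
    fix x assume x: "x \<in> Obj C"
    have i: "\<iota> (Ident C x) \<in> carrier (fobj (rep x) x)" using x by (simp add: carrier_rep ident_closed)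
    have "Ident Mods (rep x) \<in> nat_transformations C (vect_cat K) (rep x) (rep x)"
      using Mods.ident_closed[OF rep_obj[OF x]] by (simp add: module_cat_simps)
    from yo_unique(1)[OF x rep(1)[OF x] this] have "Ident Mods (rep x) = yo x (rep x) (\<iota> (Ident C x))"
      using x i by (simp add: module_cat_ops)
    then show "fmor embedding x x (Ident C x) = Ident (op_cat Mods) (fobj embedding x)"
      by (simp add: embedding_def)
  next
    fix x y z f g assume xyz: "x \<in> Obj C" "y \<in> Obj C" "z \<in> Obj C"
      and fg: "f \<in> carrier (Hom C x y)" "g \<in> carrier (Hom C y z)"
    have f: "\<iota> f \<in> carrier (fobj (rep x) y)" and g: "\<iota> g \<in> carrier (fobj (rep y) z)"
      using fg by (simp_all add: carrier_rep)
    have "Comp Mods (rep z) (rep y) (rep x) (yo y (rep x) (\<iota> f)) (yo z (rep y) (\<iota> g)) =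
      yo z (rep x) (yo y (rep x) (\<iota> f) z (\<iota> g))"
      using xyz f g by (intro yo_comp yo_hom rep_obj)
    also have "yo y (rep x) (\<iota> f) z (\<iota> g) = \<iota> (Comp C x y z g f)"
      using xyz fg by (simp add: yo_apply rep(2))
    finally show "fmor embedding x z (Comp C x y z g f) =
       Comp (op_cat Mods) (fobj embedding x) (fobj embedding y) (fobj embedding z) (fmor embedding y z g) (fmor embedding x y f)"
      by (simp add: embedding_def)
  qed (simp add: embedding_def rep_obj)
  fix x y assume xy: "x \<in> Obj C" "y \<in> Obj C"
  have "bij_betw \<iota> (carrier (Hom C x y)) (carrier (fobj (rep x) y))"
    using inj_on_subset[OF inj_\<iota>] by (auto simp: carrier_rep bij_betw_def)
  from bij_betw_trans[OF this yo_bij[OF xy(2) rep_obj[OF xy(1)]]]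
  show "bij_betw (fmor embedding x y) (carrier (Hom C x y)) (carrier (Hom (op_cat Mods) (fobj embedding x) (fobj embedding y)))"
    by (simp add: embedding_def comp_def)
qed

end

section \<open>Generators and equivalences\<close>

text \<open>Testing only for zero is enough to separate parallel morphisms, by additivity. As no
  coproducts are mentioned, the notion passes along equivalences.\<close>

definition generates :: "('p, 'n, 'k) kcat \<Rightarrow> 'p set \<Rightarrow> bool" where
  "generates M S \<longleftrightarrow> (\<forall>x\<in>Obj M. \<forall>y\<in>Obj M. \<forall>f\<in>carrier (Hom M x y).
    (\<forall>s\<in>S. \<forall>g\<in>carrier (Hom M s x). Comp M s x y f g = \<zero>\<^bsub>Hom M s y\<^esub>) \<longrightarrow> f = \<zero>\<^bsub>Hom M x y\<^esub>)"

text \<open>A scalar multiple is a composite with a multiple of an identity, so the ideal property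
  applies.\<close>

lemma (in k_category) thru_smult:
  assumes "f \<in> thru C T x y" "a \<in> carrier K" "T \<subseteq> Obj C" "x \<in> Obj C" "y \<in> Obj C"
  shows "a \<odot>\<^bsub>Hom C x y\<^esub> f \<in> thru C T x y"
proof -
  have f: "f \<in> carrier (Hom C x y)" using thru_hom assms by blast
  have "Comp C x y y (a \<odot>\<^bsub>Hom C y y\<^esub> Ident C y) f \<in> thru C T x y"
    using assms by (intro thru_comp_left) (auto simp: ident_closed module.smult_closed[OF hom_space])
  then show ?thesis using assms f by (simp add: comp_smult_left ident_closed comp_ident_left)
qed

context yoneda
begin

text \<open>Every vector \<open>v\<close> of \<open>M\<close> is the image of the code of an
  identity under a morphism from a representable module; composing this morphism with
  \<open>f\<close> gives \<open>f x v\<close> there.\<close>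

lemma generates_rep: "generates Mods (rep ` Obj C)"
  unfolding generates_def
proof (intro ballI impI)
  fix M N f assume M: "M \<in> Obj Mods" and N: "N \<in> Obj Mods" and f: "f \<in> carrier (Hom Mods M N)"
    and z: "\<forall>s\<in>rep ` Obj C. \<forall>g\<in>carrier (Hom Mods s M). Comp Mods s M N f g = \<zero>\<^bsub>Hom Mods s N\<^esub>"
  have M': "k_functor K C (vect_cat K) M" using M by (simp add: module_cat_simps)
  have f': "f \<in> nat_transformations C (vect_cat K) M N" using f by (simp add: module_cat_simps)
  show "f = \<zero>\<^bsub>Hom Mods M N\<^esub>"
  proof (rule module_nat_eqI[OF f' _ M'])
    show "\<zero>\<^bsub>Hom Mods M N\<^esub> \<in> nat_transformations C (vect_cat K) M N"
      using Mods.zero_hom[OF M N] by (simp add: module_cat_simps)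
    fix x v assume x: "x \<in> Obj C" and v: "v \<in> carrier (fobj M x)"
    have i: "\<iota> (Ident C x) \<in> carrier (fobj (rep x) x)" using x by (simp add: carrier_rep ident_closed)
    have "Comp Mods (rep x) M N f (yo x M v) = \<zero>\<^bsub>Hom Mods (rep x) N\<^esub>"
      using z x yo_hom[OF x M v] by blast
    from fun_cong[OF fun_cong[OF this, of x], of "\<iota> (Ident C x)"]
    show "f x v = \<zero>\<^bsub>Hom Mods M N\<^esub> x v"
      using x v i by (simp add: module_cat_ops yo_eval[OF x M' v])
  qed
qed

text \<open>The elements of \<open>rep x\<close> that correspond to morphisms factoring through sums of generators form a
  submodule; the projection onto the quotient by it kills all maps from the generators, so it is zero.\<close>

lemma generates_thru:
  assumes S: "S \<subseteq> Obj Mods" and gen: "generates Mods S" and x: "x \<in> Obj C"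
  shows "Ident Mods (rep x) \<in> thru Mods S (rep x) (rep x)"
proof -
  define P where "P = rep x"
  have P: "k_functor K C (vect_cat K) P" and PM: "P \<in> Obj Mods"
    unfolding P_def using rep x rep_obj by auto
  note PD = module_functorD[OF P]
  define N where "N z = {v \<in> carrier (fobj P z). yo z P v \<in> thru Mods S (rep z) P}" for z
  have sub: "submodule (N z) K (fobj P z)" if z: "z \<in> Obj C" for z
  proof -
    interpret V: module K "fobj P z" by (rule PD(1)[OF z])
    note lin = linear_mapsD[OF yo_linear[OF z PM]]
    have "module K ((fobj P z)\<lparr>carrier := N z\<rparr>)"
    proof (rule module_restrict_carrier)
      show "\<zero>\<^bsub>fobj P z\<^esub> \<in> N z"
        using linear_maps_zero[OF yo_linear[OF z PM] PD(1)[OF z] Mods.hom_space[OF rep_obj[OF z] PM]]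
        by (simp add: N_def thru.zero)
      show "v \<oplus>\<^bsub>fobj P z\<^esub> w \<in> N z" if "v \<in> N z" "w \<in> N z" for v w
        using that Mods.thru_add[OF _ _ S rep_obj[OF z] PM] by (simp add: N_def lin)
      show "a \<odot>\<^bsub>fobj P z\<^esub> v \<in> N z" if "a \<in> carrier K" "v \<in> N z" for a v
        using that Mods.thru_smult[OF _ _ S rep_obj[OF z] PM] by (simp add: N_def lin)
    qed (auto simp: N_def PD(1)[OF z])
    then show ?thesis by (intro V.module_incl_imp_submodule) (auto simp: N_def)
  qed
  \<comment> \<open>Acting with \<open>f\<close> on \<open>v\<close> amounts to precomposing the
    morphism belonging to \<open>v\<close> with the one induced by \<open>f\<close>, and
    \<open>thru\<close> is closed under precomposition.\<close>
  have act: "fmor P y z f v \<in> N z" if yz: "y \<in> Obj C" "z \<in> Obj C" "f \<in> carrier (Hom C y z)" and v: "v \<in> N y" for y z f v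
  proof -
    have v': "v \<in> carrier (fobj P y)" using v by (simp add: N_def)
    have fi: "\<iota> f \<in> carrier (fobj (rep y) z)" using yz by (simp add: carrier_rep)
    have "Comp Mods (rep z) (rep y) P (yo y P v) (yo z (rep y) (\<iota> f)) \<in> thru Mods S (rep z) P"
      using v yz fi by (intro Mods.thru_comp_right S rep_obj PM yo_hom) (auto simp: N_def)
    also have "Comp Mods (rep z) (rep y) P (yo y P v) (yo z (rep y) (\<iota> f)) = yo z P (yo y P v z (\<iota> f))"
      using yz fi v' by (intro yo_comp rep_obj PM yo_hom)
    also have "yo y P v z (\<iota> f) = fmor P y z f v" using yz by (simp add: yo_apply)
    finally show ?thesis using PD(8) yz v' by (simp add: N_def)
  qed
  define r where "r z = coset_rep (fobj P z) (N z)" for z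
  have cong: "linear_congruence K (fobj P z) (r z)" if "z \<in> Obj C" for z
    unfolding r_def using that by (intro linear_congruence_coset_rep PD(1) sub)
  have r_eq: "r z v = r z w \<longleftrightarrow> v \<ominus>\<^bsub>fobj P z\<^esub> w \<in> N z"
    if "z \<in> Obj C" "v \<in> carrier (fobj P z)" "w \<in> carrier (fobj P z)" for z v w
    unfolding r_def using that by (intro coset_rep_eq_iff[OF PD(1) sub])
  have comp: "r z (fmor P y z f v) = r z (fmor P y z f w)"
    if yz: "y \<in> Obj C" "z \<in> Obj C" "f \<in> carrier (Hom C y z)" and vw: "v \<in> carrier (fobj P y)" "w \<in> carrier (fobj P y)"
      and eq: "r y v = r y w" for y z f v w
  proof -
    interpret V: module K "fobj P y" by (rule PD(1)[OF yz(1)])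
    interpret W: module K "fobj P z" by (rule PD(1)[OF yz(2)])
    have d: "v \<ominus>\<^bsub>fobj P y\<^esub> w \<in> N y" using r_eq[OF yz(1) vw] eq by simp
    have c: "v \<ominus>\<^bsub>fobj P y\<^esub> w \<in> carrier (fobj P y)" using vw by simp
    have "v = (v \<ominus>\<^bsub>fobj P y\<^esub> w) \<oplus>\<^bsub>fobj P y\<^esub> w" using vw by (simp add: V.minus_eq V.a_assoc V.l_neg)
    then have "fmor P y z f v = fmor P y z f (v \<ominus>\<^bsub>fobj P y\<^esub> w) \<oplus>\<^bsub>fobj P z\<^esub> fmor P y z f w"
      using linear_mapsD(2)[OF PD(2)[OF yz] c vw(2)] by simp
    then have "fmor P y z f v \<ominus>\<^bsub>fobj P z\<^esub> fmor P y z f w = fmor P y z f (v \<ominus>\<^bsub>fobj P y\<^esub> w)"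
      using PD(8)[OF yz c] PD(8)[OF yz vw(2)] by (simp add: W.minus_eq W.a_assoc W.r_neg)
    then show ?thesis using r_eq[OF yz(2) PD(8)[OF yz vw(1)] PD(8)[OF yz vw(2)]] act[OF yz d] by simp
  qed
  define Q where "Q = image_functor r P"
  have Q: "k_functor K C (vect_cat K) Q" unfolding Q_def by (rule image_functor(1)[OF k_category_axioms P cong comp])
  have QM: "Q \<in> Obj Mods" using Q by (simp add: module_cat_simps)
  have mQ: "fmor Q y z f (r y v) = r z (fmor P y z f v)"
    if "y \<in> Obj C" "z \<in> Obj C" "f \<in> carrier (Hom C y z)" "v \<in> carrier (fobj P y)" for y z f v
    unfolding Q_def by (rule image_functor(2)[OF k_category_axioms P cong comp that])
  define q where "q = (\<lambda>z\<in>Obj C. \<lambda>v\<in>carrier (fobj P z). r z v)"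
  have qn: "q \<in> nat_transformations C (vect_cat K) P Q"
    unfolding q_def
  proof (rule module_natI[OF P])
    show "r z \<in> linear_maps K (fobj P z) (fobj Q z)" if "z \<in> Obj C" for z
      using image_space_linear[OF PD(1) cong] that by (simp add: Q_def)
  qed (simp add: mQ)
  then have qh: "q \<in> carrier (Hom Mods P Q)" by (simp add: module_cat_simps)
  have "Comp Mods s P Q q g = \<zero>\<^bsub>Hom Mods s Q\<^esub>" if s: "s \<in> S" and g: "g \<in> carrier (Hom Mods s P)" for s g
  proof -
    have sM: "s \<in> Obj Mods" using s S by auto
    then have s': "k_functor K C (vect_cat K) s" by (simp add: module_cat_simps)
    have g': "g \<in> nat_transformations C (vect_cat K) s P" using g by (simp add: module_cat_simps)
    show ?thesis
    proof (rule module_nat_eqI[OF _ _ s'])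
      show "Comp Mods s P Q q g \<in> nat_transformations C (vect_cat K) s Q"
        "\<zero>\<^bsub>Hom Mods s Q\<^esub> \<in> nat_transformations C (vect_cat K) s Q"
        using Mods.comp_closed[OF sM PM QM g qh] Mods.zero_hom[OF sM QM] by (simp_all add: module_cat_simps)
      fix z v assume z: "z \<in> Obj C" and v: "v \<in> carrier (fobj s z)"
      interpret V: module K "fobj P z" by (rule PD(1)[OF z])
      have gv: "g z v \<in> carrier (fobj P z)" using module_natD(5)[OF g' s' z v] .
      \<comment> \<open>The vector \<open>g z v\<close> belongs to the composite of \<open>g\<close>
        with the morphism from \<open>rep z\<close> to \<open>s\<close> given by \<open>v\<close>,
        which visibly passes through the generator \<open>s\<close>.\<close>
      have "Comp Mods (rep z) s P g (yo z s v) \<in> thru Mods S (rep z) P"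
        using s z sM v g by (intro Mods.thru_single S rep_obj PM yo_hom)
      then have "g z v \<in> N z" using yo_comp[OF z sM PM v g] gv by (simp add: N_def)
      then have "r z (g z v) = r z \<zero>\<^bsub>fobj P z\<^esub>"
        using r_eq[OF z gv V.zero_closed] gv by (simp add: V.minus_eq a_inv_def V.add.inv_one)
      then show "Comp Mods s P Q q g z v = \<zero>\<^bsub>Hom Mods s Q\<^esub> z v"
        using z v gv by (simp add: module_cat_ops q_def Q_def zero_image_space)
    qed
  qed
  then have "q = \<zero>\<^bsub>Hom Mods P Q\<^esub>" using gen PM QM qh unfolding generates_def by blast
  moreover have i: "\<iota> (Ident C x) \<in> carrier (fobj P x)" using x by (simp add: P_def carrier_rep ident_closed)
  ultimately have "q x (\<iota> (Ident C x)) = \<zero>\<^bsub>fobj Q x\<^esub>" using x by (simp add: module_cat_ops)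
  then have eq: "r x (\<iota> (Ident C x)) = r x \<zero>\<^bsub>fobj P x\<^esub>" using x i by (simp add: q_def Q_def zero_image_space)
  interpret V: module K "fobj P x" by (rule PD(1)[OF x])
  have "\<iota> (Ident C x) \<in> N x"
    using r_eq[OF x i V.zero_closed] eq i by (simp add: V.minus_eq a_inv_def V.add.inv_one)
  then have "yo x P (\<iota> (Ident C x)) \<in> thru Mods S (rep x) P" by (simp add: N_def)
  \<comment> \<open>The morphism belonging to the code of the identity of \<open>x\<close> is the
    identity of \<open>rep x\<close>, because the embedding preserves identities.\<close>
  moreover have "fmor embedding x x (Ident C x) = Ident (op_cat Mods) (fobj embedding x)"
    by (rule k_functorD(3)[OF fully_faithfulD(1)[OF embedding_fully_faithful] x])
  ultimately show ?thesis by (simp add: embedding_def P_def)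
qed

end

section \<open>Equivalences are fully faithful and preserve generating families\<close>

lemma nat_iso_obtain:
  assumes "nat_isomorphic X X (comp_functor G F) id_functor"
  obtains \<eta> \<eta>' where "\<And>x. x \<in> Obj X \<Longrightarrow> \<eta> x \<in> carrier (Hom X (fobj G (fobj F x)) x)"
    and "\<And>x. x \<in> Obj X \<Longrightarrow> \<eta>' x \<in> carrier (Hom X x (fobj G (fobj F x)))"
    and "\<And>x. x \<in> Obj X \<Longrightarrow> Comp X (fobj G (fobj F x)) x (fobj G (fobj F x)) (\<eta>' x) (\<eta> x) = Ident X (fobj G (fobj F x))"
    and "\<And>x. x \<in> Obj X \<Longrightarrow> Comp X x (fobj G (fobj F x)) x (\<eta> x) (\<eta>' x) = Ident X x"
    and "\<And>x y f. \<lbrakk>x \<in> Obj X; y \<in> Obj X; f \<in> carrier (Hom X x y)\<rbrakk> \<Longrightarrow>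
      Comp X (fobj G (fobj F x)) (fobj G (fobj F y)) y (\<eta> y) (fmor G (fobj F x) (fobj F y) (fmor F x y f)) =
      Comp X (fobj G (fobj F x)) x y f (\<eta> x)"
proof -
  obtain \<eta> where \<eta>: "\<eta> \<in> nat_transformations X X (comp_functor G F) id_functor"
    and iso: "\<forall>x\<in>Obj X. is_iso X (fobj G (fobj F x)) x (\<eta> x)"
    using assms unfolding nat_isomorphic_def
    by (elim bexE) (simp add: comp_functor_def id_functor_def)
  have "\<forall>x\<in>Obj X. \<exists>g. g \<in> carrier (Hom X x (fobj G (fobj F x))) \<and>
     Comp X (fobj G (fobj F x)) x (fobj G (fobj F x)) g (\<eta> x) = Ident X (fobj G (fobj F x)) \<and>
     Comp X x (fobj G (fobj F x)) x (\<eta> x) g = Ident X x"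
    using iso unfolding is_iso_def by blast
  from bchoice[OF this] obtain \<eta>' where \<eta>': "\<forall>x\<in>Obj X. \<eta>' x \<in> carrier (Hom X x (fobj G (fobj F x))) \<and>
     Comp X (fobj G (fobj F x)) x (fobj G (fobj F x)) (\<eta>' x) (\<eta> x) = Ident X (fobj G (fobj F x)) \<and>
     Comp X x (fobj G (fobj F x)) x (\<eta> x) (\<eta>' x) = Ident X x" by blast
  show thesis
    by (rule that[of \<eta> \<eta>'])
      (use \<eta>' nat_transformationsD[OF \<eta>] in \<open>auto simp: comp_functor_def id_functor_def\<close>)
qed

text \<open>By naturality, \<open>f\<close> after \<open>\<eta> x\<close> depends only on the image
  of \<open>f\<close> under \<open>F\<close>, and \<open>\<eta> x\<close> can be cancelled.\<close>

lemma nat_iso_faithful: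
  assumes X: "k_category K X" and F: "k_functor K X Y F" and G: "k_functor K Y X G"
    and iso: "nat_isomorphic X X (comp_functor G F) id_functor"
    and xy: "x \<in> Obj X" "y \<in> Obj X" and fg: "f \<in> carrier (Hom X x y)" "g \<in> carrier (Hom X x y)"
    and eq: "fmor F x y f = fmor F x y g"
  shows "f = g"
proof -
  interpret X: k_category K X by fact
  obtain \<eta> \<eta>' where e: "\<And>x. x \<in> Obj X \<Longrightarrow> \<eta> x \<in> carrier (Hom X (fobj G (fobj F x)) x)"
    "\<And>x. x \<in> Obj X \<Longrightarrow> \<eta>' x \<in> carrier (Hom X x (fobj G (fobj F x)))"
    "\<And>x. x \<in> Obj X \<Longrightarrow> Comp X (fobj G (fobj F x)) x (fobj G (fobj F x)) (\<eta>' x) (\<eta> x) = Ident X (fobj G (fobj F x))"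
    "\<And>x. x \<in> Obj X \<Longrightarrow> Comp X x (fobj G (fobj F x)) x (\<eta> x) (\<eta>' x) = Ident X x"
    "\<And>x y f. \<lbrakk>x \<in> Obj X; y \<in> Obj X; f \<in> carrier (Hom X x y)\<rbrakk> \<Longrightarrow>
      Comp X (fobj G (fobj F x)) (fobj G (fobj F y)) y (\<eta> y) (fmor G (fobj F x) (fobj F y) (fmor F x y f)) =
      Comp X (fobj G (fobj F x)) x y f (\<eta> x)"
    by (rule nat_iso_obtain[OF iso]) blast
  have o: "fobj G (fobj F x) \<in> Obj X" using k_functorD(1)[OF G] k_functorD(1)[OF F] xy by blast
  have c: "h = Comp X x (fobj G (fobj F x)) y (Comp X (fobj G (fobj F x)) x y h (\<eta> x)) (\<eta>' x)"
    if h: "h \<in> carrier (Hom X x y)" for h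
    using X.comp_assoc[OF xy(1) o xy(1) xy(2) e(2)[OF xy(1)] e(1)[OF xy(1)] h] e(4)[OF xy(1)]
      X.comp_ident_right[OF xy h] by simp
  have "Comp X (fobj G (fobj F x)) x y f (\<eta> x) = Comp X (fobj G (fobj F x)) x y g (\<eta> x)"
    using e(5)[OF xy fg(1)] e(5)[OF xy fg(2)] eq by simp
  then show ?thesis using c[OF fg(1)] c[OF fg(2)] by simp
qed

lemma k_equivalence_fully_faithful:
  assumes X: "k_category K X" and Y: "k_category K Y" and F: "k_functor K X Y F" and G: "k_functor K Y X G"
    and iso: "nat_isomorphic X X (comp_functor G F) id_functor" "nat_isomorphic Y Y (comp_functor F G) id_functor"
  shows "fully_faithful K X Y F"
  unfolding fully_faithful_def
proof (intro conjI ballI F)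
  interpret X: k_category K X by fact
  note FD = k_functorD[OF F] and GD = k_functorD[OF G]
  obtain \<eta> \<eta>' where e: "\<And>x. x \<in> Obj X \<Longrightarrow> \<eta> x \<in> carrier (Hom X (fobj G (fobj F x)) x)"
    "\<And>x. x \<in> Obj X \<Longrightarrow> \<eta>' x \<in> carrier (Hom X x (fobj G (fobj F x)))"
    "\<And>x. x \<in> Obj X \<Longrightarrow> Comp X (fobj G (fobj F x)) x (fobj G (fobj F x)) (\<eta>' x) (\<eta> x) = Ident X (fobj G (fobj F x))"
    "\<And>x. x \<in> Obj X \<Longrightarrow> Comp X x (fobj G (fobj F x)) x (\<eta> x) (\<eta>' x) = Ident X x"
    "\<And>x y f. \<lbrakk>x \<in> Obj X; y \<in> Obj X; f \<in> carrier (Hom X x y)\<rbrakk> \<Longrightarrow>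
      Comp X (fobj G (fobj F x)) (fobj G (fobj F y)) y (\<eta> y) (fmor G (fobj F x) (fobj F y) (fmor F x y f)) =
      Comp X (fobj G (fobj F x)) x y f (\<eta> x)"
    by (rule nat_iso_obtain[OF iso(1)]) blast
  fix x y assume x: "x \<in> Obj X" and y: "y \<in> Obj X"
  let ?x = "fobj G (fobj F x)" and ?y = "fobj G (fobj F y)"
  have o: "?x \<in> Obj X" "?y \<in> Obj X" using FD(1) GD(1) x y by auto
  show "bij_betw (fmor F x y) (carrier (Hom X x y)) (carrier (Hom Y (fobj F x) (fobj F y)))"
  proof (rule bij_betw_imageI)
    show "inj_on (fmor F x y) (carrier (Hom X x y))"
      by (rule inj_onI) (rule nat_iso_faithful[OF X F G iso(1) x y])
    show "fmor F x y ` carrier (Hom X x y) = carrier (Hom Y (fobj F x) (fobj F y))"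
    proof (intro equalityI subsetI)
      fix h assume "h \<in> fmor F x y ` carrier (Hom X x y)"
      then show "h \<in> carrier (Hom Y (fobj F x) (fobj F y))" using FD(5) x y by auto
    next
      fix h assume h: "h \<in> carrier (Hom Y (fobj F x) (fobj F y))"
      let ?h = "fmor G (fobj F x) (fobj F y) h"
      have Gh: "?h \<in> carrier (Hom X ?x ?y)" using GD(5) FD(1) x y h by blast
      let ?yh = "Comp X ?x ?y y (\<eta> y) ?h"
      have yh: "?yh \<in> carrier (Hom X ?x y)" using X.comp_closed[OF o y Gh e(1)[OF y]] .
      \<comment> \<open>The candidate preimage of \<open>h\<close> is \<open>G\<close> of
        \<open>h\<close>, conjugated by the natural isomorphism. Naturality shows that its image
        under \<open>F\<close> and \<open>h\<close> itself become equal under \<open>G\<close>, and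
        \<open>G\<close> is faithful by the other natural isomorphism.\<close>
      let ?f = "Comp X x ?x y ?yh (\<eta>' x)"
      have f: "?f \<in> carrier (Hom X x y)" using X.comp_closed[OF x o(1) y e(2)[OF x] yh] .
      have Ff: "fmor F x y ?f \<in> carrier (Hom Y (fobj F x) (fobj F y))" using FD(5) x y f by blast
      have GFf: "fmor G (fobj F x) (fobj F y) (fmor F x y ?f) \<in> carrier (Hom X ?x ?y)" using GD(5) FD(1) x y Ff by blast
      have "Comp X ?x ?y y (\<eta> y) (fmor G (fobj F x) (fobj F y) (fmor F x y ?f)) = Comp X ?x x y ?f (\<eta> x)"
        by (rule e(5)[OF x y f])
      also have "\<dots> = Comp X ?x ?x y ?yh (Comp X ?x x ?x (\<eta>' x) (\<eta> x))"
        by (rule X.comp_assoc[OF o(1) x o(1) y e(1)[OF x] e(2)[OF x] yh, symmetric])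
      also have "\<dots> = ?yh" using e(3)[OF x] X.comp_ident_right[OF o(1) y yh] by simp
      finally have eq: "Comp X ?x ?y y (\<eta> y) (fmor G (fobj F x) (fobj F y) (fmor F x y ?f)) = ?yh" .
      have canc: "k = Comp X ?x y ?y (\<eta>' y) (Comp X ?x ?y y (\<eta> y) k)" if k: "k \<in> carrier (Hom X ?x ?y)" for k
        using X.comp_assoc[OF o(1) o(2) y o(2) k e(1)[OF y] e(2)[OF y]] e(3)[OF y] X.comp_ident_left[OF o k] by simp
      have "fmor G (fobj F x) (fobj F y) (fmor F x y ?f) = ?h"
        using canc[OF GFf] canc[OF Gh] eq by simp
      then have "fmor F x y ?f = h"
        using nat_iso_faithful[OF Y G F iso(2) FD(1)[OF x] FD(1)[OF y] Ff h] by simp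
      then show "h \<in> fmor F x y ` carrier (Hom X x y)" using f by force
    qed
  qed
qed

text \<open>If \<open>f\<close> kills every morphism from the objects \<open>G s\<close>, then
  \<open>F f\<close> kills every morphism from the objects \<open>s\<close>: this may be tested
  under the faithful functor \<open>G\<close>, where naturality replaces \<open>G (F f)\<close> by
  \<open>f\<close>.\<close>

lemma generates_equivalence:
  assumes X: "k_category K X" and Y: "k_category K Y" and F: "k_functor K X Y F" and G: "k_functor K Y X G"
    and iso: "nat_isomorphic X X (comp_functor G F) id_functor" "nat_isomorphic Y Y (comp_functor F G) id_functor"
    and S: "S \<subseteq> Obj Y" and gen: "generates Y S"
  shows "generates X (fobj G ` S)"
  unfolding generates_def
proof (intro ballI impI)
  interpret X: k_category K X by fact
  interpret Y: k_category K Y by fact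
  note FD = k_functorD[OF F] and GD = k_functorD[OF G]
  obtain \<eta> \<eta>' where e: "\<And>x. x \<in> Obj X \<Longrightarrow> \<eta> x \<in> carrier (Hom X (fobj G (fobj F x)) x)"
    "\<And>x. x \<in> Obj X \<Longrightarrow> \<eta>' x \<in> carrier (Hom X x (fobj G (fobj F x)))"
    "\<And>x. x \<in> Obj X \<Longrightarrow> Comp X (fobj G (fobj F x)) x (fobj G (fobj F x)) (\<eta>' x) (\<eta> x) = Ident X (fobj G (fobj F x))"
    "\<And>x. x \<in> Obj X \<Longrightarrow> Comp X x (fobj G (fobj F x)) x (\<eta> x) (\<eta>' x) = Ident X x"
    "\<And>x y f. \<lbrakk>x \<in> Obj X; y \<in> Obj X; f \<in> carrier (Hom X x y)\<rbrakk> \<Longrightarrow>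
      Comp X (fobj G (fobj F x)) (fobj G (fobj F y)) y (\<eta> y) (fmor G (fobj F x) (fobj F y) (fmor F x y f)) =
      Comp X (fobj G (fobj F x)) x y f (\<eta> x)"
    by (rule nat_iso_obtain[OF iso(1)]) blast
  fix x y f assume x: "x \<in> Obj X" and y: "y \<in> Obj X" and f: "f \<in> carrier (Hom X x y)"
    and z: "\<forall>s\<in>fobj G ` S. \<forall>g\<in>carrier (Hom X s x). Comp X s x y f g = \<zero>\<^bsub>Hom X s y\<^esub>"
  let ?x = "fobj G (fobj F x)" and ?y = "fobj G (fobj F y)"
  have o: "?x \<in> Obj X" "?y \<in> Obj X" "fobj F x \<in> Obj Y" "fobj F y \<in> Obj Y" using FD(1) GD(1) x y by auto
  have Ff: "fmor F x y f \<in> carrier (Hom Y (fobj F x) (fobj F y))" using FD(5) x y f by blast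
  have GFf: "fmor G (fobj F x) (fobj F y) (fmor F x y f) \<in> carrier (Hom X ?x ?y)" using GD(5)[OF o(3,4) Ff] .
  have "Comp Y s (fobj F x) (fobj F y) (fmor F x y f) h = \<zero>\<^bsub>Hom Y s (fobj F y)\<^esub>"
    if s: "s \<in> S" and h: "h \<in> carrier (Hom Y s (fobj F x))" for s h
  proof -
    have sY: "s \<in> Obj Y" using s S by auto
    let ?s = "fobj G s"
    have sX: "?s \<in> Obj X" using GD(1)[OF sY] .
    have Gh: "fmor G s (fobj F x) h \<in> carrier (Hom X ?s ?x)" using GD(5)[OF sY o(3) h] .
    let ?k = "Comp X ?s ?x ?y (fmor G (fobj F x) (fobj F y) (fmor F x y f)) (fmor G s (fobj F x) h)"
    have k: "?k \<in> carrier (Hom X ?s ?y)" using X.comp_closed[OF sX o(1,2) Gh GFf] .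
    have "Comp X ?s ?y y (\<eta> y) ?k = Comp X ?s ?x y (Comp X ?x ?y y (\<eta> y) (fmor G (fobj F x) (fobj F y) (fmor F x y f))) (fmor G s (fobj F x) h)"
      by (rule X.comp_assoc[OF sX o(1,2) y Gh GFf e(1)[OF y]])
    also have "\<dots> = Comp X ?s ?x y (Comp X ?x x y f (\<eta> x)) (fmor G s (fobj F x) h)" using e(5)[OF x y f] by simp
    also have "\<dots> = Comp X ?s x y f (Comp X ?s ?x x (\<eta> x) (fmor G s (fobj F x) h))"
      by (rule X.comp_assoc[OF sX o(1) x y Gh e(1)[OF x] f, symmetric])
    also have "\<dots> = \<zero>\<^bsub>Hom X ?s y\<^esub>"
      using z s X.comp_closed[OF sX o(1) x Gh e(1)[OF x]] by blast
    finally have "Comp X ?s ?y y (\<eta> y) ?k = \<zero>\<^bsub>Hom X ?s y\<^esub>" .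
    moreover have "?k = Comp X ?s y ?y (\<eta>' y) (Comp X ?s ?y y (\<eta> y) ?k)"
      using X.comp_assoc[OF sX o(2) y o(2) k e(1)[OF y] e(2)[OF y]] e(3)[OF y] X.comp_ident_left[OF sX o(2) k] by simp
    ultimately have "?k = \<zero>\<^bsub>Hom X ?s ?y\<^esub>" using X.comp_zero_right[OF sX y o(2) e(2)[OF y]] by simp
    then have "fmor G s (fobj F y) (Comp Y s (fobj F x) (fobj F y) (fmor F x y f) h) =
      fmor G s (fobj F y) \<zero>\<^bsub>Hom Y s (fobj F y)\<^esub>"
      using GD(4)[OF sY o(3,4) h Ff] k_functor_zero[OF G Y X sY o(4)] by simp
    then show ?thesis
      by (rule nat_iso_faithful[OF Y G F iso(2) sY o(4) Y.comp_closed[OF sY o(3,4) h Ff] Y.zero_hom[OF sY o(4)]])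
  qed
  then have "fmor F x y f = \<zero>\<^bsub>Hom Y (fobj F x) (fobj F y)\<^esub>"
    using gen o(3,4) Ff unfolding generates_def by blast
  then have "fmor F x y f = fmor F x y \<zero>\<^bsub>Hom X x y\<^esub>" using k_functor_zero[OF F X Y x y] by simp
  then show "f = \<zero>\<^bsub>Hom X x y\<^esub>" by (rule nat_iso_faithful[OF X F G iso(1) x y f X.zero_hom[OF x y]])
qed

definition op_functor :: "('o, 'm, 'p, 'n) kfunctor \<Rightarrow> ('o, 'm, 'p, 'n) kfunctor" where
  "op_functor F = \<lparr>fobj = fobj F, fmor = (\<lambda>x y. fmor F y x)\<rparr>"

lemma fully_faithful_op_cat:
  assumes "fully_faithful K X Y F"
  shows "fully_faithful K (op_cat X) (op_cat Y) (op_functor F)"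
  using assms unfolding fully_faithful_def k_functor_def op_functor_def by simp

theorem theorem4p7:
  fixes K :: "('k, 'r) ring_scheme"
    and C D :: "('u, 'u, 'k) kcat"
  assumes "infinite (UNIV :: 'u set)"
    and "\<exists>\<iota> :: 'u \<Rightarrow> 'v. inj \<iota>"
    and "field K"
    and "k_category K C" and "k_category K D"
    and "morita_equivalent TYPE('v) K C D"
  shows "\<exists>(m :: nat) (S :: nat \<Rightarrow> ('u, 'u, 'k) kcat).
    S 0 = C \<and> S m = D \<and> (\<forall>i\<le>m. k_category K (S i)) \<and>
    (\<forall>i<m. k_equivalent K (S i) (S (Suc i)) \<or>
           is_contraction K (S i) (S (Suc i)) \<or>
           is_expansion K (S i) (S (Suc i)))"
proof -
  obtain \<iota> :: "'u \<Rightarrow> 'v" where \<iota>: "inj \<iota>" using assms(2) by blast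
  interpret C: yoneda K C \<iota> by (intro yoneda.intro yoneda_axioms.intro assms \<iota>)
  interpret D: yoneda K D \<iota> by (intro yoneda.intro yoneda_axioms.intro assms \<iota>)
  have inf: "infinite (UNIV :: 'v set)"
    using assms(1) \<iota> finite_imageD[of \<iota> UNIV] finite_subset[of "range \<iota>" UNIV] by blast
  obtain F G where F: "k_functor K C.Mods D.Mods F" and G: "k_functor K D.Mods C.Mods G"
    and FG: "nat_isomorphic C.Mods C.Mods (comp_functor G F) id_functor"
      "nat_isomorphic D.Mods D.Mods (comp_functor F G) id_functor"
    using assms(6) unfolding morita_equivalent_def k_equivalent_def by blast
  note CM = C.Mods.k_category_axioms and DM = D.Mods.k_category_axioms
  let ?B = "op_cat D.Mods"
  \<comment> \<open>The embedding of \<open>C\<close> ends in the opposite of the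
    \<open>C\<close>-modules, so the equivalence is applied there in its opposite form.\<close>
  let ?F = "comp_functor (op_functor F) C.embedding"
  have repC: "C.rep ` Obj C \<subseteq> Obj C.Mods" and repD: "D.rep ` Obj D \<subseteq> Obj D.Mods"
    using C.rep_obj D.rep_obj by auto
  have "fully_faithful K C.Mods D.Mods F" by (rule k_equivalence_fully_faithful[OF CM DM F G FG])
  then have ffF: "fully_faithful K C ?B ?F"
    by (rule fully_faithful_comp[OF C.embedding_fully_faithful fully_faithful_op_cat])
  have fF: "fobj ?F x = fobj F (C.rep x)" for x by (simp add: comp_functor_def op_functor_def C.embedding_def)
  have fD: "fobj D.embedding y = D.rep y" for y by (simp add: D.embedding_def)
  have "(morita_step K)\<^sup>*\<^sup>* C D"
  proof (rule morita_steps_large_ambient[OF assms(1) D.Mods.op_cat assms(4,5) ffF D.embedding_fully_faithful])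
    show "splits_idempotents ?B"
      by (intro splits_idempotents_op_cat splits_idempotents_module_cat assms)
    show "has_biproducts ?B"
      by (intro has_biproducts_op_cat has_biproducts_module_cat assms inf)
    fix x assume x: "x \<in> Obj C"
    \<comment> \<open>The representable \<open>D\<close>-modules, transported by \<open>G\<close>,
      generate the \<open>C\<close>-modules. Hence the identity of \<open>C.rep x\<close> factors
      through finite sums of them, and \<open>F\<close> carries this factorization over to the
      \<open>D\<close>-modules.\<close>
    let ?S = "fobj G ` D.rep ` Obj D"
    have S: "?S \<subseteq> Obj C.Mods" using repD k_functorD(1)[OF G] by auto
    have "generates C.Mods ?S" by (rule generates_equivalence[OF CM DM F G FG repD D.generates_rep])
    from C.generates_thru[OF S this x]
    have "fmor F (C.rep x) (C.rep x) (Ident C.Mods (C.rep x)) \<in> thru D.Mods (fobj F ` ?S) (fobj F (C.rep x)) (fobj F (C.rep x))"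
      by (intro thru_functor[OF _ F CM DM S] C.rep_obj[OF x])
    then have 1: "Ident D.Mods (fobj F (C.rep x)) \<in> thru D.Mods (fobj F ` ?S) (fobj F (C.rep x)) (fobj F (C.rep x))"
      using k_functorD(3)[OF F C.rep_obj[OF x]] by simp
    obtain \<eta> \<eta>' where e: "\<And>y. y \<in> Obj D.Mods \<Longrightarrow> \<eta> y \<in> carrier (Hom D.Mods (fobj F (fobj G y)) y)"
      "\<And>y. y \<in> Obj D.Mods \<Longrightarrow> \<eta>' y \<in> carrier (Hom D.Mods y (fobj F (fobj G y)))"
      "\<And>y. y \<in> Obj D.Mods \<Longrightarrow> Comp D.Mods (fobj F (fobj G y)) y (fobj F (fobj G y)) (\<eta>' y) (\<eta> y) = Ident D.Mods (fobj F (fobj G y))"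
      by (rule nat_iso_obtain[OF FG(2)]) blast
    \<comment> \<open>The objects \<open>F (G (D.rep y))\<close> still have to be replaced by
      \<open>D.rep y\<close>; the natural isomorphism factors the identity of the former through the
      latter.\<close>
    have "Ident D.Mods (fobj F (C.rep x)) \<in> thru D.Mods (D.rep ` Obj D) (fobj F (C.rep x)) (fobj F (C.rep x))"
    proof (rule D.Mods.thru_trans[OF 1])
      fix t assume "t \<in> fobj F ` ?S"
      then obtain y where y: "y \<in> Obj D" "t = fobj F (fobj G (D.rep y))" by auto
      have yM: "D.rep y \<in> Obj D.Mods" by (rule D.rep_obj[OF y(1)])
      have "Comp D.Mods t (D.rep y) t (\<eta>' (D.rep y)) (\<eta> (D.rep y)) \<in> thru D.Mods (D.rep ` Obj D) t t"
        using y yM e(1,2)[OF yM] k_functorD(1)[OF F k_functorD(1)[OF G yM]]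
        by (intro D.Mods.thru_single repD) auto
      then show "Ident D.Mods t \<in> thru D.Mods (D.rep ` Obj D) t t" using e(3)[OF yM] y by simp
    qed (use S repD k_functorD(1)[OF F] C.rep_obj[OF x] in auto)
    then show "Ident ?B (fobj ?F x) \<in> thru ?B (fobj D.embedding ` Obj D) (fobj ?F x) (fobj ?F x)"
      unfolding thru_op_cat fF fD by simp
  next
    fix y assume y: "y \<in> Obj D"
    \<comment> \<open>In this direction the transported modules \<open>F (C.rep x)\<close> are
      already the ones that represent \<open>C\<close> in the ambient category, so one application
      of the generator argument suffices.\<close>
    have S: "fobj F ` C.rep ` Obj C \<subseteq> Obj D.Mods" using repC k_functorD(1)[OF F] by auto
    have "generates D.Mods (fobj F ` C.rep ` Obj C)"
      by (rule generates_equivalence[OF DM CM G F FG(2,1) repC C.generates_rep])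
    from D.generates_thru[OF S this y]
    show "Ident ?B (fobj D.embedding y) \<in> thru ?B (fobj ?F ` Obj C) (fobj D.embedding y) (fobj D.embedding y)"
      unfolding thru_op_cat fF fD by (simp add: image_image)
  qed
  then obtain m where "(morita_step K ^^ m) C D" using rtranclp_imp_relpowp by metis
  then obtain S where S: "S 0 = C" "S m = D" "\<And>i. i < m \<Longrightarrow> morita_step K (S i) (S (Suc i))"
    unfolding relpowp_fun_conv by blast
  \<comment> \<open>The first member is \<open>C\<close>; every later one is the target of a step,
    which includes the axioms.\<close>
  have "k_category K (S i)" if "i \<le> m" for i
    using S that assms(4) by (cases i) (auto simp: morita_step_def)
  then show ?thesis using S unfolding morita_step_def by blast
qed

end
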